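(* Let $\mathfrak n$ be a square-free nonzero ideal of $A$, and let $k\ge1$ and $0\le l\le q-2$ be integers with $k\equiv 2l\pmod{q-1}$. The spaces $S_{k,l}^{\mathrm{old}}(\Gamma_0(\mathfrak n))$ and $S_{k,l}^{\mathrm{new}}(\Gamma_0(\mathfrak n))$ are invariant under the action of the Hecke operators $T_{\mathfrak p}$ for all primes $\mathfrak p\nmid\mathfrak n$ and $U_{\mathfrak p}$ for all primes $\mathfrak p\mid\mathfrak n$.
   Context: Let $q$ be a power of an odd prime, $A=\mathbb{F}_q[T]$, $K_\infty=\mathbb{F}_q((1/T))$, $C$ the completion of an algebraic closure of $K_\infty$, and $\Omega=C\setminus K_\infty$ the Drinfeld upper half-plane with its rigid analytic structure. For $\gamma=\begin{pmatrix} a & b \\ c & d \end{pmatrix}\in\mathrm{GL}_2(K_\infty)$ and $f:\Omega\to C$ rigid holomorphic put $(f|_{k,l}\gamma)(z)=(\det\gamma)^l(cz+d)^{-k}f(\gamma z)$. For a nonzero ideal $\mathfrak n=(n)$ of $A$ ($n$ monic), $\Gamma_0(\mathfrak n)=\{\begin{pmatrix} a & b \\ c & d \end{pmatrix}\in\mathrm{GL}_2(A): c\in\mathfrak n\}$. Let $\tilde\pi$ be the Carlitz period (so $L=\tilde\pi A$ is the lattice of the Carlitz module $\rho_T=TX+X^q$), $e_L(z)=z\prod_{0\ne\lambda\in L}(1-z/\lambda)$, $u(z)=1/e_L(\tilde\pi z)$. $S_{k,l}(\Gamma_0(\mathfrak n))$ is the $C$-space of Drinfeld cusp forms of weight $k$,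 type $l$: rigid holomorphic $f:\Omega\to C$ with $f|_{k,l}\gamma=f$ for all $\gamma\in\Gamma_0(\mathfrak n)$ which are holomorphic and vanish at the cusps, i.e. for every $\gamma\in\mathrm{GL}_2(A)$ the expansion of $f|_{k,l}\gamma$ in powers of $u(z/n)$ (for $\inf_{x\in K_\infty}|z-x|$ large) has only positive powers. For a prime $\mathfrak p=(P)$ ($P$ monic irreducible) and $f\in S_{k,l}(\Gamma_0(\mathfrak n))$: if $\mathfrak p\mid\mathfrak n$, $U_{\mathfrak p}(f)=P^{k-l}\sum_{Q\in A,\ \deg Q<\deg P}f|_{k,l}\begin{pmatrix} 1 & Q \\ 0 & P \end{pmatrix}$; if $\mathfrak p\nmid\mathfrak n$, $T_{\mathfrak p}(f)=P^{k-l}\sum_{Q\in A,\ \deg Q<\deg P}f|_{k,l}\begin{pmatrix} 1 & Q \\ 0 & P \end{pmatrix}+P^{k-l}f|_{k,l}\begin{pmatrix} P & 0 \\ 0 & 1 \end{pmatrix}$. For $\mathfrak n$ square-free and a prime $\mathfrak p=(P)\mid\mathfrak n$: $\mathrm{Tr}^{\mathfrak n}_{\mathfrak n/\mathfrak p}(f)=\sum_{\gamma\in\Gamma_0(\mathfrak n)\backslash\Gamma_0(\mathfrak n/\mathfrak p)}f|_{k,l}\gamma$; $f|W_{\mathfrak p}^{(\mathfrak n)}=f|_{k,l}\begin{pmatrix} P & b \\ n & P d \end{pmatrix}$ with $b,d\in A$, $P^2d-nb=P$ (independent of choice); $\mathrm{Tr}'^{\,\mathfrak n}_{\mathfrak n/\mathfrak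 p}(f)=\mathrm{Tr}^{\mathfrak n}_{\mathfrak n/\mathfrak p}(f|W_{\mathfrak p}^{(\mathfrak n)})$. Then $S^{\mathrm{old}}_{k,l}(\Gamma_0(\mathfrak n))=\sum_{\mathfrak p\mid\mathfrak n}\{f+g|_{k,l}\begin{pmatrix} P & 0 \\ 0 & 1 \end{pmatrix}: f,g\in S_{k,l}(\Gamma_0(\mathfrak n/\mathfrak p))\}$ and $S^{\mathrm{new}}_{k,l}(\Gamma_0(\mathfrak n))=\bigcap_{\mathfrak p\mid\mathfrak n}\big(\ker(\mathrm{Tr}^{\mathfrak n}_{\mathfrak n/\mathfrak p})\cap\ker(\mathrm{Tr}'^{\,\mathfrak n}_{\mathfrak n/\mathfrak p})\big)\subseteq S_{k,l}(\Gamma_0(\mathfrak n))$, sum and intersection over prime divisors $\mathfrak p$ of $\mathfrak n$. *)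

theory Defs
  imports
    "HOL-Algebra.Algebraic_Closure_Type"
    "HOL-Analysis.Analysis"
    "HOL-Number_Theory.Cong"
begin

hide_const (open) Polynomials.degree Polynomials.lead_coeff Divisibility.irreducible

text \<open>
  Throughout, \<open>'q\<close> is the finite field \<open>\<F>\<^sub>q\<close>, so \<open>q = CARD('q)\<close>; the ring \<open>A = \<F>\<^sub>q[T]\<close> is
  \<open>'q poly\<close>; and \<open>K\<^sub>\<infinity> = \<F>\<^sub>q((1/T))\<close> is \<open>'q fls\<close>, the variable of the formal Laurent series
  being \<open>1/T\<close>. Hence \<open>T\<close> itself is \<open>fls_X_inv\<close>.
\<close>

definition poly_to_fls :: "'q::field poly \<Rightarrow> 'q fls" where
  "poly_to_fls a = poly (map_poly fls_const a) fls_X_inv"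

text \<open>
  Complete non-archimedean valued fields. The library reserves \<open>norm\<close> for real normed vector
  spaces, so the absolute value of \<open>x\<close> is expressed as the distance to \<open>0\<close>.
\<close>

class nonarch_complete_field = field + complete_space +
  assumes dist_diff_0: "dist x y = dist (x - y) 0"
    and dist_mult_0: "dist (x * y) 0 = dist x 0 * dist y 0"
    and dist_add_0_le: "dist (x + y) 0 \<le> max (dist x 0) (dist y 0)"

abbreviation absval :: "'c::nonarch_complete_field \<Rightarrow> real" where
  "absval x \<equiv> dist x 0"

text \<open>
  \<open>\<iota>\<close> exhibits the complete valued field \<open>'c\<close> as a completion \<open>C\<close> of an algebraic closure of
  \<open>K\<^sub>\<infinity>\<close>: it is the restriction to \<open>K\<^sub>\<infinity>\<close> of a field embedding of the algebraic closure with
  dense image, and the absolute value of \<open>'c\<close> extends the one of \<open>K\<^sub>\<infinity>\<close> normalised by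
  \<open>\<bar>T\<bar> = q\<close>. This determines \<open>('c, \<iota>)\<close> up to isometric isomorphism.
\<close>

definition completed_alg_closure ::
  "('q::{field,finite} fls \<Rightarrow> 'c::nonarch_complete_field) \<Rightarrow> bool" where
  "completed_alg_closure \<iota> \<longleftrightarrow>
     (\<exists>j :: 'q fls alg_closure \<Rightarrow> 'c.
        j 1 = 1 \<and> (\<forall>x y. j (x + y) = j x + j y) \<and> (\<forall>x y. j (x * y) = j x * j y) \<and>
        closure (range j) = UNIV \<and> \<iota> = j \<circ> to_ac) \<and>
     (\<forall>x. x \<noteq> 0 \<longrightarrow> absval (\<iota> x) = real CARD('q) powi (- fls_subdegree x))"

definition mat2 :: "'a::zero \<Rightarrow> 'a \<Rightarrow> 'a \<Rightarrow> 'a \<Rightarrow> 'a^2^2" where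
  "mat2 a b c d = vector [vector [a, b], vector [c, d]]"

definition Gamma0 :: "'q::field poly \<Rightarrow> ('q poly^2^2) set" where
  "Gamma0 n = {\<gamma>. invertible \<gamma> \<and> n dvd \<gamma>$2$1}"

definition monic_prime :: "'q::field poly \<Rightarrow> bool" where
  "monic_prime P \<longleftrightarrow> lead_coeff P = 1 \<and> irreducible P"

definition monic_prime_divisors :: "'q::field poly \<Rightarrow> 'q poly set" where
  "monic_prime_divisors n = {P. monic_prime P \<and> P dvd n}"

definition Gamma0_cosets :: "'q::field poly \<Rightarrow> 'q poly \<Rightarrow> ('q poly^2^2) set set" where
  "Gamma0_cosets n m = (\<lambda>\<gamma>. (\<lambda>\<delta>. \<delta> ** \<gamma>) ` Gamma0 n) ` Gamma0 m"

context
  fixes \<iota> :: "'q::{field,finite} fls \<Rightarrow> 'c::nonarch_complete_field"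
begin

definition of_A :: "'q poly \<Rightarrow> 'c" where
  "of_A a = \<iota> (poly_to_fls a)"

definition Omega :: "'c set" where
  "Omega = - range \<iota>"

text \<open>
  The imaginary part \<open>\<bar>z\<bar>\<^sub>i = inf {\<bar>z - x\<bar> | x \<in> K\<^sub>\<infinity>}\<close> is \<open>infdist z (range \<iota>)\<close>. The sets below
  are the standard exhaustion of \<open>\<Omega>\<close> by connected affinoids.
\<close>

definition Omega_affinoid :: "nat \<Rightarrow> 'c set" where
  "Omega_affinoid m =
     {z. absval z \<le> real CARD('q) ^ m \<and> infdist z (range \<iota>) \<ge> 1 / real CARD('q) ^ m}"

text \<open>
  The sections of the structure sheaf over each of these affinoids are the uniform limits of
  rational functions without poles there.
\<close>

definition rigid_holomorphic :: "('c \<Rightarrow> 'c) \<Rightarrow> bool" where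
  "rigid_holomorphic f \<longleftrightarrow>
     (\<forall>m. \<exists>p r :: nat \<Rightarrow> 'c poly.
        (\<forall>i. \<forall>z\<in>Omega_affinoid m. poly (r i) z \<noteq> 0) \<and>
        uniform_limit (Omega_affinoid m) (\<lambda>i z. poly (p i) z / poly (r i) z) f sequentially)"

text \<open>
  Functions on \<open>\<Omega>\<close> are represented by functions on \<open>'c\<close> that vanish outside \<open>\<Omega>\<close>, so that
  equality of functions is equality on \<open>\<Omega>\<close>.
\<close>

definition slash :: "nat \<Rightarrow> nat \<Rightarrow> ('c \<Rightarrow> 'c) \<Rightarrow> 'q fls^2^2 \<Rightarrow> 'c \<Rightarrow> 'c" where
  "slash k l f \<gamma> = (\<lambda>z. if z \<in> Omega
     then \<iota> (det \<gamma>) ^ l / (\<iota> (\<gamma>$2$1) * z + \<iota> (\<gamma>$2$2)) ^ k *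
          f ((\<iota> (\<gamma>$1$1) * z + \<iota> (\<gamma>$1$2)) / (\<iota> (\<gamma>$2$1) * z + \<iota> (\<gamma>$2$2)))
     else 0)"

abbreviation slash_A :: "nat \<Rightarrow> nat \<Rightarrow> ('c \<Rightarrow> 'c) \<Rightarrow> 'q poly^2^2 \<Rightarrow> 'c \<Rightarrow> 'c" where
  "slash_A k l f \<gamma> \<equiv> slash k l f (map_matrix poly_to_fls \<gamma>)"

text \<open>
  The product over the nonzero lattice points is unordered: a limit along the finite subsets.
\<close>

definition lattice_exp :: "'c set \<Rightarrow> 'c \<Rightarrow> 'c" where
  "lattice_exp L z =
     z * Lim (finite_subsets_at_top (L - {0})) (\<lambda>F. \<Prod>w\<in>F. 1 - z / w)"

definition period_lattice :: "'c \<Rightarrow> 'c set" where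
  "period_lattice \<pi> = range (\<lambda>a. \<pi> * of_A a)"

text \<open>
  \<open>\<pi> A\<close> is the lattice of the Carlitz module \<open>\<rho>\<^sub>T = T X + X\<^sup>q\<close> iff its exponential function
  intertwines multiplication by \<open>T\<close> with \<open>\<rho>\<^sub>T\<close>. The period is determined up to a factor in
  \<open>\<F>\<^sub>q\<^sup>\<times>\<close>.
\<close>

definition carlitz_period :: "'c \<Rightarrow> bool" where
  "carlitz_period \<pi> \<longleftrightarrow> \<pi> \<noteq> 0 \<and>
     (\<forall>z. lattice_exp (period_lattice \<pi>) (of_A [:0, 1:] * z) =
          of_A [:0, 1:] * lattice_exp (period_lattice \<pi>) z +
          lattice_exp (period_lattice \<pi>) z ^ CARD('q))"

definition cusp_parameter :: "'c \<Rightarrow> 'c \<Rightarrow> 'c" where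
  "cusp_parameter \<pi> z = 1 / lattice_exp (period_lattice \<pi>) (\<pi> * z)"

definition vanishes_at_infinity :: "'c \<Rightarrow> 'q poly \<Rightarrow> ('c \<Rightarrow> 'c) \<Rightarrow> bool" where
  "vanishes_at_infinity \<pi> n f \<longleftrightarrow>
     (\<exists>(a :: nat \<Rightarrow> 'c) (R :: real). \<forall>z\<in>Omega. infdist z (range \<iota>) > R \<longrightarrow>
        (\<lambda>i. a (Suc i) * cusp_parameter \<pi> (z / of_A n) ^ Suc i) sums f z)"

definition cusp_forms :: "'c \<Rightarrow> nat \<Rightarrow> nat \<Rightarrow> 'q poly \<Rightarrow> ('c \<Rightarrow> 'c) set" where
  "cusp_forms \<pi> k l n =
     {f. rigid_holomorphic f \<and> (\<forall>z. z \<notin> Omega \<longrightarrow> f z = 0) \<and>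
         (\<forall>\<gamma>\<in>Gamma0 n. slash_A k l f \<gamma> = f) \<and>
         (\<forall>\<gamma>. invertible \<gamma> \<longrightarrow> vanishes_at_infinity \<pi> n (slash_A k l f \<gamma>))}"

definition hecke_U :: "nat \<Rightarrow> nat \<Rightarrow> 'q poly \<Rightarrow> ('c \<Rightarrow> 'c) \<Rightarrow> 'c \<Rightarrow> 'c" where
  "hecke_U k l P f = (\<lambda>z. of_A P powi (int k - int l) *
     (\<Sum>Q | degree Q < degree P. slash_A k l f (mat2 1 Q 0 P) z))"

definition hecke_T :: "nat \<Rightarrow> nat \<Rightarrow> 'q poly \<Rightarrow> ('c \<Rightarrow> 'c) \<Rightarrow> 'c \<Rightarrow> 'c" where
  "hecke_T k l P f = (\<lambda>z. of_A P powi (int k - int l) *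
     (\<Sum>Q | degree Q < degree P. slash_A k l f (mat2 1 Q 0 P) z) +
     of_A P powi (int k - int l) * slash_A k l f (mat2 P 0 0 1) z)"

definition trace_form :: "nat \<Rightarrow> nat \<Rightarrow> 'q poly \<Rightarrow> 'q poly \<Rightarrow> ('c \<Rightarrow> 'c) \<Rightarrow> 'c \<Rightarrow> 'c" where
  "trace_form k l n P f =
     (\<lambda>z. \<Sum>c\<in>Gamma0_cosets n (n div P). slash_A k l f (SOME \<gamma>. \<gamma> \<in> c) z)"

definition atkin_lehner_matrix :: "'q poly \<Rightarrow> 'q poly \<Rightarrow> 'q poly^2^2" where
  "atkin_lehner_matrix n P =
     (SOME \<gamma>. \<exists>b d. \<gamma> = mat2 P b n (P * d) \<and> P\<^sup>2 * d - n * b = P)"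

definition atkin_lehner :: "nat \<Rightarrow> nat \<Rightarrow> 'q poly \<Rightarrow> 'q poly \<Rightarrow> ('c \<Rightarrow> 'c) \<Rightarrow> 'c \<Rightarrow> 'c" where
  "atkin_lehner k l n P f = slash_A k l f (atkin_lehner_matrix n P)"

definition twisted_trace_form ::
  "nat \<Rightarrow> nat \<Rightarrow> 'q poly \<Rightarrow> 'q poly \<Rightarrow> ('c \<Rightarrow> 'c) \<Rightarrow> 'c \<Rightarrow> 'c" where
  "twisted_trace_form k l n P f = trace_form k l n P (atkin_lehner k l n P f)"

definition old_forms_at ::
  "'c \<Rightarrow> nat \<Rightarrow> nat \<Rightarrow> 'q poly \<Rightarrow> 'q poly \<Rightarrow> ('c \<Rightarrow> 'c) set" where
  "old_forms_at \<pi> k l n P =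
     {(\<lambda>z. f z + slash_A k l g (mat2 P 0 0 1) z) | f g.
        f \<in> cusp_forms \<pi> k l (n div P) \<and> g \<in> cusp_forms \<pi> k l (n div P)}"

definition old_forms :: "'c \<Rightarrow> nat \<Rightarrow> nat \<Rightarrow> 'q poly \<Rightarrow> ('c \<Rightarrow> 'c) set" where
  "old_forms \<pi> k l n =
     {(\<lambda>z. \<Sum>P\<in>monic_prime_divisors n. h P z) | h.
        \<forall>P\<in>monic_prime_divisors n. h P \<in> old_forms_at \<pi> k l n P}"

definition new_forms :: "'c \<Rightarrow> nat \<Rightarrow> nat \<Rightarrow> 'q poly \<Rightarrow> ('c \<Rightarrow> 'c) set" where
  "new_forms \<pi> k l n =
     {f \<in> cusp_forms \<pi> k l n. \<forall>P\<in>monic_prime_divisors n.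
        trace_form k l n P f = (\<lambda>_. 0) \<and> twisted_trace_form k l n P f = (\<lambda>_. 0)}"

end

end

theory Submission
  imports Defs
begin

text \<open>
  Write \<open>f|\<gamma>\<close> for the slash operator, \<open>\<delta>\<^sub>P\<close> for the matrix with rows \<open>(P, 0), (0, 1)\<close>, and
  \<open>\<Sigma>\<^sub>P f\<close> for the sum of \<open>f|\<beta>\<close> over the matrices \<open>\<beta>\<close> with rows \<open>(1, Q), (0, P)\<close>,
  \<open>deg Q < deg P\<close> (below: \<open>hecke_sum\<close>). Up to the factor \<open>P\<close> to the power \<open>k - l\<close>, the operator
  \<open>U\<^sub>P\<close> is \<open>\<Sigma>\<^sub>P\<close>, and \<open>T\<^sub>P\<close> is \<open>\<Sigma>\<^sub>P\<close> plus the slash by \<open>\<delta>\<^sub>P\<close>. Both are treated as one operator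
  \<open>H\<close> (below: \<open>hecke n P\<close>), a sum over representatives of \<open>\<Gamma>\<^sub>0(n)\<close>-cosets in a set of integral
  matrices of determinant \<open>P\<close>, up to units. Such a sum does not change if the representatives are moved
  injectively on cosets (\<open>hecke_sum_permute\<close>). Moving them by right multiplication with
  \<open>\<Gamma>\<^sub>0(n)\<close> shows that \<open>H f\<close> is again \<open>\<Gamma>\<^sub>0(n)\<close>-invariant; moving them by conjugation with the
  Atkin--Lehner matrix \<open>W\<close> of a prime \<open>R \<noteq> P\<close> shows \<open>(H f)|W = H (f|W)\<close> (\<open>hecke_W\<close>).

  New forms: the cosets of \<open>\<Gamma>\<^sub>0(n)\<close> in \<open>\<Gamma>\<^sub>0(n/R)\<close> are represented by \<open>1\<close> and by \<open>W \<beta> / R\<close>, so the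
  trace of \<open>f\<close> is \<open>f + c \<Sigma>\<^sub>R (f|W)\<close> with a constant \<open>c \<noteq> 0\<close> (\<open>trace_form_eq\<close>). For \<open>R \<noteq> P\<close> the
  operators \<open>H\<close> and \<open>\<Sigma>\<^sub>R\<close> commute (\<open>hecke_hecke_sum\<close>), hence \<open>H\<close> commutes with both traces and
  preserves their kernels. For \<open>R = P\<close> the vanishing of the twisted trace of \<open>f\<close> says
  \<open>\<Sigma>\<^sub>P f = - f|W\<close>, because \<open>W\<close> acts as an involution up to a scalar (\<open>W_squared\<close>). So \<open>U\<^sub>P f\<close> is a
  multiple of \<open>f|W\<close>, and \<open>W\<close> interchanges the two trace conditions.

  Old forms: for \<open>R \<noteq> P\<close> the operator \<open>H\<close> commutes with the slash by \<open>\<delta>\<^sub>R\<close> (\<open>hecke_delta\<close>). For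
  \<open>R = P\<close>, \<open>U\<^sub>P f\<close> equals \<open>T\<^sub>P f\<close> of level \<open>n/P\<close> minus a multiple of \<open>f|\<delta>\<^sub>P\<close>, and
  \<open>\<Sigma>\<^sub>P (g|\<delta>\<^sub>P)\<close> is a sum of \<open>q ^ deg P\<close> equal terms, that is \<open>0\<close>.

  What remains is that \<open>H\<close> maps cusp forms to cusp forms (\<open>hecke_cusp_forms\<close>), and the point is
  the behaviour at the cusps. There every summand of \<open>F = (H f)|\<gamma>\<close> is a power series in
  \<open>t = u(z/(nP))\<close>, whereas a series in \<open>s = u(z/n)\<close> is needed; only the whole sum \<open>F\<close> is invariant
  under \<open>z \<mapsto> z + n x\<close>, \<open>x \<in> A\<close>. Put \<open>e = 1/t\<close>. By the functional equation of the Carlitz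
  exponential, \<open>1/s = \<rho>(e)\<close> for a polynomial \<open>\<rho>\<close> of degree \<open>N = q ^ deg P\<close> without constant term.
  This relation expresses every power of \<open>t\<close> as a combination of \<open>1, e, \<dots>, e ^ (N - 1)\<close> whose
  coefficients are polynomials in \<open>s\<close>; summing up, \<open>F\<close> is a combination of \<open>e ^ j\<close>, \<open>j < N\<close>, with
  coefficients \<open>h\<^sub>j(s)\<close>. A translation \<open>z \<mapsto> z + n x\<close> keeps \<open>F\<close> and \<open>s\<close> and adds to \<open>e\<close> one of \<open>N\<close>
  different constants. So a polynomial in \<open>e\<close> of degree less than \<open>N\<close> takes the same value \<open>F\<close> at
  \<open>N\<close> points: it is constant, and \<open>F = h\<^sub>0(s)\<close> (\<open>power_series_descent\<close>,
  \<open>cusp_expansion_descent\<close>). This works in characteristic \<open>p\<close>, where averaging over the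
  translations is impossible.
\<close>

section \<open>Limits and series over a non-archimedean field\<close>

lemma nonarch_dist: "dist x y = absval (x - y)" for x :: "'c::nonarch_complete_field"
  by (rule dist_diff_0)

lemma absval_mult: "absval (x * y) = absval x * absval y" for x :: "'c::nonarch_complete_field"
  by (rule dist_mult_0)

lemma absval_add: "absval (x + y) \<le> max (absval x) (absval y)" for x :: "'c::nonarch_complete_field"
  by (rule dist_add_0_le)

lemma absval_one [simp]: "absval (1::'c::nonarch_complete_field) = 1"
proof -
  have "absval (1::'c) = absval (1::'c) * absval (1::'c)"
    using absval_mult[of "1::'c" 1] by simp
  moreover have "absval (1::'c) \<noteq> 0" by simp
  ultimately show ?thesis by simp
qed

lemma absval_minus [simp]: "absval (- x) = absval x" for x :: "'c::nonarch_complete_field"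
  by (metis add.right_neutral diff_0 dist_commute nonarch_dist)

lemma absval_diff: "absval (x - y) \<le> max (absval x) (absval y)"
  for x :: "'c::nonarch_complete_field"
  using absval_add[of x "- y"] by simp

lemma absval_power: "absval (x ^ n) = absval x ^ n" for x :: "'c::nonarch_complete_field"
  by (induction n) (simp_all add: absval_mult)

lemma absval_inverse: "absval (inverse x) = inverse (absval x)" for x :: "'c::nonarch_complete_field"
proof (cases "x = 0")
  case False
  then have "absval x * absval (inverse x) = 1" using absval_mult[of x "inverse x"] by simp
  then show ?thesis by (simp add: inverse_unique)
qed simp

lemma absval_divide: "absval (x / y) = absval x / absval y" for x :: "'c::nonarch_complete_field"
  by (simp add: divide_inverse absval_mult absval_inverse)

lemma absval_prod: "absval (\<Prod>i\<in>A. f i) = (\<Prod>i\<in>A. absval (f i))"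
  for f :: "'a \<Rightarrow> 'c::nonarch_complete_field"
  by (induction A rule: infinite_finite_induct) (simp_all add: absval_mult)

lemma absval_sum_le:
  fixes f :: "'a \<Rightarrow> 'c::nonarch_complete_field"
  assumes "\<And>i. i \<in> A \<Longrightarrow> absval (f i) \<le> B" "0 \<le> B"
  shows "absval (\<Sum>i\<in>A. f i) \<le> B"
  using assms
proof (induction A rule: infinite_finite_induct)
  case (insert x F)
  then show ?case using absval_add[of "f x" "sum f F"] by simp (smt (verit))
qed auto

lemma absval_add_eq_left:
  fixes x y :: "'c::nonarch_complete_field"
  assumes "absval y < absval x" shows "absval (x + y) = absval x"
proof -
  have "absval x \<le> max (absval (x + y)) (absval y)" using absval_diff[of "x + y" y] by simp
  then show ?thesis using absval_add[of x y] assms by (simp add: max_def split: if_splits)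
qed

lemma tendsto_iff_absval:
  "((f :: _ \<Rightarrow> 'c::nonarch_complete_field) \<longlongrightarrow> l) F \<longleftrightarrow> ((\<lambda>x. absval (f x - l)) \<longlongrightarrow> 0) F"
  by (subst tendsto_dist_iff) (simp add: nonarch_dist[of _ l])

text \<open>
  The ultrametric inequality makes addition, and below multiplication, continuous. These instances
  give access to the rules for limits and series in topological groups and semigroups; \<open>C\<close> has
  positive characteristic and is not a real normed space.
\<close>

instance nonarch_complete_field \<subseteq> topological_ab_group_add
proof
  fix a b :: 'a
  show "LIM x nhds a \<times>\<^sub>F nhds b. fst x + snd x :> nhds (a + b)"
  proof (rule metric_tendsto_imp_tendsto[where f = "\<lambda>x. x" and a = "(a, b)"])
    show "((\<lambda>x. x) \<longlongrightarrow> (a, b)) (nhds a \<times>\<^sub>F nhds b)"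
      unfolding nhds_prod by (rule filterlim_ident)
    have "dist (fst x + snd x) (a + b) \<le> dist x (a, b)" for x :: "'a \<times> 'a"
    proof -
      have "dist (fst x + snd x) (a + b) = absval ((fst x - a) + (snd x - b))"
        by (simp add: nonarch_dist[of _ "a + b"] algebra_simps)
      also have "\<dots> \<le> max (dist (fst x) a) (dist (snd x) b)"
        using absval_add[of "fst x - a" "snd x - b"] by (simp only: nonarch_dist[symmetric])
      also have "\<dots> \<le> dist x (a, b)"
        using dist_fst_le[of x "(a,b)"] dist_snd_le[of x "(a,b)"] by simp
      finally show ?thesis .
    qed
    then show "\<forall>\<^sub>F x in nhds a \<times>\<^sub>F nhds b. dist (fst x + snd x) (a + b) \<le> dist x (a, b)"
      by simp
  qed
next
  fix a :: 'a
  show "(uminus \<longlongrightarrow> - a) (nhds a)"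
  proof (rule metric_tendsto_imp_tendsto[where f = "\<lambda>x. x" and a = a])
    show "((\<lambda>x. x) \<longlongrightarrow> a) (nhds a)" by (rule filterlim_ident)
    have "dist (- x) (- a) \<le> dist x a" for x :: 'a
      by (metis absval_minus minus_diff_minus nonarch_dist order_refl)
    then show "\<forall>\<^sub>F x in nhds a. dist (- x) (- a) \<le> dist x a" by simp
  qed
qed

lemma tendsto_absval_0_iff:
  "((f :: _ \<Rightarrow> 'c::nonarch_complete_field) \<longlongrightarrow> 0) F \<longleftrightarrow> ((\<lambda>x. absval (f x)) \<longlongrightarrow> 0) F"
  by (simp add: tendsto_iff_absval[of f 0])

lemma nonarch_tendsto_mult_left:
  fixes f :: "_ \<Rightarrow> 'c::nonarch_complete_field"
  assumes "(f \<longlongrightarrow> a) F" shows "((\<lambda>x. c * f x) \<longlongrightarrow> c * a) F"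
proof -
  have "((\<lambda>x. absval c * absval (f x - a)) \<longlongrightarrow> absval c * 0) F"
    using assms by (intro tendsto_mult tendsto_const) (simp add: tendsto_iff_absval[of f])
  then show ?thesis
    by (subst tendsto_iff_absval) (simp add: absval_mult right_diff_distrib[symmetric])
qed

instance nonarch_complete_field \<subseteq> topological_semigroup_mult
proof
  fix a b :: 'a
  let ?F = "nhds a \<times>\<^sub>F nhds b"
  have fst: "(fst \<longlongrightarrow> a) ?F" and snd: "(snd \<longlongrightarrow> b) ?F"
    by (rule filterlim_fst, rule filterlim_snd)
  have "((\<lambda>x. absval (fst x - a) * absval (snd x - b)) \<longlongrightarrow> 0 * 0) ?F"
    using fst snd by (intro tendsto_mult) (simp_all add: tendsto_iff_absval[of fst] tendsto_iff_absval[of snd])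
  then have "((\<lambda>x. (fst x - a) * (snd x - b)) \<longlongrightarrow> 0) ?F"
    by (simp add: tendsto_absval_0_iff absval_mult)
  then have "((\<lambda>x. ((fst x - a) * (snd x - b) + a * snd x) + (b * fst x + - (a * b))) \<longlongrightarrow> (0 + a * b) + (b * a + - (a * b))) ?F"
    by (intro tendsto_add nonarch_tendsto_mult_left fst snd tendsto_const)
  moreover have "(\<lambda>x. ((fst x - a) * (snd x - b) + a * snd x) + (b * fst x + - (a * b))) = (\<lambda>x. fst x * snd x)"
    by (auto simp: algebra_simps)
  ultimately show "LIM x ?F. fst x * snd x :> nhds (a * b)"
    by simp
qed

instance nonarch_complete_field \<subseteq> topological_comm_monoid_mult ..

lemma nonarch_tendsto_absval:
  fixes f :: "_ \<Rightarrow> 'c::nonarch_complete_field"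
  assumes "(f \<longlongrightarrow> a) F" shows "((\<lambda>x. absval (f x)) \<longlongrightarrow> absval a) F"
  by (intro tendsto_dist assms tendsto_const)

lemma nonarch_sums_mult:
  fixes f :: "nat \<Rightarrow> 'c::nonarch_complete_field"
  assumes "f sums a" shows "(\<lambda>i. c * f i) sums (c * a)"
  using nonarch_tendsto_mult_left[OF assms[unfolded sums_def], of c]
  by (simp add: sums_def sum_distrib_left)

text \<open>
  In a complete non-archimedean field a series converges as soon as its terms tend to \<open>0\<close>: a block
  of terms is never larger than its largest member.
\<close>

lemma nonarch_summable:
  fixes f :: "nat \<Rightarrow> 'c::nonarch_complete_field"
  assumes "f \<longlonglongrightarrow> 0" shows "summable f"
proof -
  have "Cauchy (\<lambda>n. sum f {..<n})"
  proof (rule metric_CauchyI)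
    fix e :: real assume "0 < e"
    then have e2: "0 < e / 2" by simp
    obtain N where N: "\<And>n. n \<ge> N \<Longrightarrow> absval (f n) < e / 2"
      using metric_LIMSEQ_D[OF assms e2] by auto
    have *: "dist (sum f {..<m}) (sum f {..<n}) < e" if "N \<le> n" "n \<le> m" for m n
    proof -
      have "sum f {..<m} - sum f {..<n} = sum f {n..<m}"
        using sum_diff_nat_ivl[of 0 n m f] that by (simp add: atLeast0LessThan)
      moreover have "absval (sum f {n..<m}) \<le> e / 2"
        using N that \<open>0 < e\<close> by (intro absval_sum_le) (auto intro: less_imp_le)
      ultimately show ?thesis using \<open>0 < e\<close> by (simp add: nonarch_dist[of "sum f {..<m}"])
    qed
    show "\<exists>M. \<forall>m\<ge>M. \<forall>n\<ge>M. dist (sum f {..<m}) (sum f {..<n}) < e"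
    proof (intro exI allI impI)
      fix m n assume "N \<le> m" "N \<le> n"
      then show "dist (sum f {..<m}) (sum f {..<n}) < e"
        using *[of n m] *[of m n] by (cases "n \<le> m") (auto simp: dist_commute)
    qed
  qed
  then show ?thesis
    by (simp add: Cauchy_convergent_iff summable_iff_convergent)
qed

lemma nonarch_sums_terms_0:
  fixes f :: "nat \<Rightarrow> 'c::nonarch_complete_field"
  assumes "f sums a" shows "f \<longlonglongrightarrow> 0"
proof -
  have "(\<lambda>n. sum f {..<Suc n} - sum f {..<n}) \<longlonglongrightarrow> a - a"
    using assms unfolding sums_def by (intro tendsto_diff LIMSEQ_Suc)
  then show ?thesis by simp
qed

text \<open>
  A non-archimedean Fubini theorem for double series \<open>x i m\<close> supported on \<open>i \<le> N m\<close>. The support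
  condition makes the column sums finite; the geometric bound in \<open>m\<close> makes the error of truncating
  all rows at \<open>m < K\<close> tend to \<open>0\<close> uniformly in \<open>i\<close>.
\<close>

lemma nonarch_sums_swap:
  fixes x :: "nat \<Rightarrow> nat \<Rightarrow> 'c::nonarch_complete_field"
  assumes zero: "\<And>i m. N * m < i \<Longrightarrow> x i m = 0"
    and bound: "\<And>i m. absval (x i m) \<le> M * \<theta> ^ m"
    and \<theta>: "0 \<le> \<theta>" "\<theta> < 1" and N: "0 < N"
    and inner: "\<And>i. x i sums y i" and outer: "y sums Y"
  shows "(\<lambda>m. \<Sum>i\<le>N * m. x i m) sums Y"
proof -
  have M: "0 \<le> M" using order_trans[OF zero_le_dist bound[of 0 0]] by simp
  \<comment> \<open>Truncating the columns at \<open>m < K\<close> leaves only rows \<open>i < N * K\<close>.\<close>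
  have eq: "(\<Sum>m<K. \<Sum>i\<le>N * m. x i m) = (\<Sum>i<N * K. \<Sum>m<K. x i m)" for K
  proof -
    have "(\<Sum>i\<le>N * m. x i m) = (\<Sum>i<N * K. x i m)" if "m < K" for m
    proof (rule sum.mono_neutral_left)
      have *: "N * m < N * K" using N that by simp
      show "{..N * m} \<subseteq> {..<N * K}" using le_less_trans[OF _ *] by blast
      show "\<forall>i\<in>{..<N * K} - {..N * m}. x i m = 0" using zero by auto
    qed simp
    then have "(\<Sum>m<K. \<Sum>i\<le>N * m. x i m) = (\<Sum>m<K. \<Sum>i<N * K. x i m)" by simp
    then show ?thesis by (subst sum.swap)
  qed
  have tail: "absval (sum (x i) {..<K} - y i) \<le> M * \<theta> ^ K" for i K
  proof -
    have "(\<lambda>J. absval (sum (x i) {..<J} - sum (x i) {..<K})) \<longlonglongrightarrow> absval (y i - sum (x i) {..<K})"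
      using inner[of i] unfolding sums_def
      by (intro nonarch_tendsto_absval tendsto_diff tendsto_const)
    moreover have "absval (sum (x i) {..<J} - sum (x i) {..<K}) \<le> M * \<theta> ^ K" if "K \<le> J" for J
    proof -
      have "absval (x i m) \<le> M * \<theta> ^ K" if "K \<le> m" for m
      proof -
        have "\<theta> ^ m \<le> \<theta> ^ K" using that \<theta> by (intro power_decreasing) auto
        then have "M * \<theta> ^ m \<le> M * \<theta> ^ K" using M by (rule mult_left_mono)
        with bound[of i m] show ?thesis by linarith
      qed
      moreover have "sum (x i) {..<J} - sum (x i) {..<K} = sum (x i) {K..<J}"
        using sum_diff_nat_ivl[of 0 K J "x i"] that by (simp add: atLeast0LessThan)
      ultimately show ?thesis using M \<theta> by (auto intro!: absval_sum_le)
    qed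
    ultimately have "absval (y i - sum (x i) {..<K}) \<le> M * \<theta> ^ K"
      by (intro tendsto_upperbound) (auto intro: eventually_sequentiallyI[of K])
    then show ?thesis by (metis absval_minus minus_diff_eq)
  qed
  have le: "absval ((\<Sum>i<N * K. \<Sum>m<K. x i m) - sum y {..<N * K}) \<le> M * \<theta> ^ K" for K
    unfolding sum_subtractf[symmetric] by (rule absval_sum_le) (use tail M \<theta> in auto)
  have lim: "(\<lambda>K. M * \<theta> ^ K) \<longlonglongrightarrow> 0"
    using \<theta> by (auto intro!: tendsto_mult_right_zero LIMSEQ_power_zero)
  have "(\<lambda>K. absval ((\<Sum>i<N * K. \<Sum>m<K. x i m) - sum y {..<N * K})) \<longlonglongrightarrow> 0"
    by (rule tendsto_sandwich[OF _ _ tendsto_const lim]; rule always_eventually; intro allI zero_le_dist le)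
  then have "(\<lambda>K. (\<Sum>i<N * K. \<Sum>m<K. x i m) - sum y {..<N * K}) \<longlonglongrightarrow> 0"
    by (simp add: tendsto_absval_0_iff)
  moreover have "(\<lambda>K. sum y {..<N * K}) \<longlonglongrightarrow> Y"
    using LIMSEQ_subseq_LIMSEQ[OF outer[unfolded sums_def], of "\<lambda>K. N * K"] N
    by (simp add: o_def strict_mono_def)
  ultimately have "(\<lambda>K. ((\<Sum>i<N * K. \<Sum>m<K. x i m) - sum y {..<N * K}) + sum y {..<N * K}) \<longlonglongrightarrow> 0 + Y"
    by (rule tendsto_add)
  then show ?thesis by (simp add: sums_def eq)
qed

lemma absval_prod_one_minus:
  fixes x :: "'a \<Rightarrow> 'c::nonarch_complete_field"
  assumes "\<And>i. i \<in> A \<Longrightarrow> absval (x i) \<le> \<delta>" "0 \<le> \<delta>" "\<delta> \<le> 1"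
  shows "absval ((\<Prod>i\<in>A. 1 - x i) - 1) \<le> \<delta>"
  using assms(1)
proof (induction A rule: infinite_finite_induct)
  case (insert i A)
  let ?p = "\<Prod>i\<in>A. 1 - x i"
  have eq: "(\<Prod>i\<in>insert i A. 1 - x i) - 1 = (?p - 1) * (1 - x i) + - x i"
    using insert by (simp add: algebra_simps)
  have "absval (1 - x i) \<le> 1"
    using absval_diff[of 1 "x i"] insert.prems[of i] \<open>\<delta> \<le> 1\<close> by simp
  then have "absval ((?p - 1) * (1 - x i)) \<le> \<delta> * 1"
    unfolding absval_mult using insert assms by (intro mult_mono) auto
  then show ?case unfolding eq using absval_add[of "(?p - 1) * (1 - x i)" "- x i"] insert.prems[of i]
    by simp
qed (use assms in auto)

text \<open>
  The monic polynomial with simple roots at a finite additive subgroup \<open>V\<close> is additive. As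
  polynomials in \<open>x\<close>, both sides are monic of degree \<open>card V\<close>, and they agree at the points of \<open>V\<close>
  because translation by such a point permutes the factors.
\<close>

lemma prod_diff_additive_subgroup:
  fixes V :: "'c::field set"
  assumes fin: "finite V" and zero: "0 \<in> V" and add: "\<And>v w. v \<in> V \<Longrightarrow> w \<in> V \<Longrightarrow> v + w \<in> V"
  shows "(\<Prod>v\<in>V. x + y - v) = (\<Prod>v\<in>V. x - v) + (\<Prod>v\<in>V. y - v)"
proof -
  let ?N = "card V"
  define p where "p = (\<Prod>v\<in>V. [:y - v, 1:])"
  define r where "r = (\<Prod>v\<in>V. [:- v, 1:])"
  define s where "s = r + [:\<Prod>v\<in>V. y - v:]"
  have N: "0 < ?N" using fin zero by (auto simp: card_gt_0_iff)
  have lc: "lead_coeff p = 1" "lead_coeff r = 1"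
    unfolding p_def r_def lead_coeff_prod by simp_all
  have deg: "degree p = ?N" "degree r = ?N"
    unfolding p_def r_def by (simp_all add: degree_prod_sum_eq)
  have s: "degree s \<le> ?N" "Polynomial.coeff s ?N = 1"
    using N deg lc unfolding s_def by (auto intro!: degree_add_le simp: coeff_pCons split: nat.split)
  have "poly p v = poly s v" if v: "v \<in> V" for v
  proof -
    have inj: "inj_on ((+) v) V" by simp
    have "(+) v ` V \<subseteq> V" using add v by auto
    then have bij: "bij_betw ((+) v) V V"
      unfolding bij_betw_def using endo_inj_surj[OF fin _ inj] inj by blast
    have "poly p v = (\<Prod>w\<in>V. y + v - w)" unfolding p_def by (simp add: poly_prod algebra_simps)
    also have "\<dots> = (\<Prod>w\<in>V. y - w)"
      using prod.reindex_bij_betw[OF bij, of "\<lambda>w. y + v - w"] by simp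
    also have "\<dots> = poly s v"
      using fin v by (auto simp: s_def r_def poly_prod intro: prod_zero)
    finally show ?thesis .
  qed
  then have "p = s"
    using deg lc s by (intro poly_eqI_degree_lead_coeff[where A = V and n = ?N]) auto
  then have "poly p x = poly s x" by simp
  then show ?thesis by (simp add: p_def s_def r_def poly_prod algebra_simps)
qed

section \<open>Polynomials over a finite field inside \<open>C\<close>\<close>

lemma poly_to_fls_pCons: "poly_to_fls (pCons c p) = fls_const c + fls_X_inv * poly_to_fls p"
  by (simp add: poly_to_fls_def map_poly_pCons)

lemma poly_to_fls_0 [simp]: "poly_to_fls 0 = 0"
  by (simp add: poly_to_fls_def)

lemma poly_to_fls_add: "poly_to_fls (p + r) = poly_to_fls p + poly_to_fls r"
proof (induction p r rule: poly_induct2)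
  case (pCons a p b r)
  then show ?case by (simp add: poly_to_fls_pCons fls_plus_const algebra_simps)
qed simp

lemma poly_to_fls_smult: "poly_to_fls (smult c p) = fls_const c * poly_to_fls p"
  by (induction p) (simp_all add: poly_to_fls_pCons algebra_simps)

lemma poly_to_fls_mult: "poly_to_fls (p * r) = poly_to_fls p * poly_to_fls r"
  by (induction p) (simp_all add: poly_to_fls_pCons poly_to_fls_add poly_to_fls_smult algebra_simps)

lemma poly_to_fls_nonzero_subdegree:
  "p \<noteq> 0 \<Longrightarrow> poly_to_fls p \<noteq> 0 \<and> fls_subdegree (poly_to_fls p) = - int (degree p)"
proof (induction p)
  case (pCons c p)
  show ?case
  proof (cases "p = 0")
    case True
    with pCons show ?thesis by (simp add: poly_to_fls_pCons fls_const_nonzero)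
  next
    case False
    let ?g = "fls_X_inv * poly_to_fls p"
    have g: "?g \<noteq> 0" "fls_subdegree ?g = - int (degree p) - 1"
      using pCons False by (simp_all add: fls_subdegree_mult_fls_X_inv)
    have "fls_subdegree (?g + fls_const c) = fls_subdegree ?g"
      using g by (intro fls_subdegree_add_eq1) auto
    then show ?thesis using g False
      by (auto simp: poly_to_fls_pCons add.commute)
  qed
qed simp

lemma finite_field_power_card: "c ^ CARD('q) = c" for c :: "'q::{field,finite}"
proof (cases "c = 0")
  case False
  let ?U = "UNIV - {0 :: 'q}"
  have "bij_betw ((*) c) ?U ?U"
    using False by (intro bij_betwI[where g = "(*) (inverse c)"]) auto
  then have "\<Prod>?U = (\<Prod>x\<in>?U. c * x)" by (rule prod.reindex_bij_betw[symmetric])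
  also have "\<dots> = c ^ (CARD('q) - 1) * \<Prod>?U" by (simp add: prod.distrib)
  finally have "c ^ (CARD('q) - 1) = 1" by simp
  then have "c * c ^ (CARD('q) - 1) = c" by simp
  then show ?thesis by (subst (asm) power_Suc[symmetric]) simp
qed simp

text \<open>
  Adding \<open>1\<close> permutes the field, so the sum of all elements equals itself plus \<open>CARD('q)\<close>.
\<close>

lemma of_nat_card_field_eq_0: "of_nat CARD('q) = (0 :: 'q::{field,finite})"
proof -
  have "bij_betw (\<lambda>x. x + 1) UNIV (UNIV :: 'q set)"
    by (intro bij_betwI[where g = "\<lambda>x. x - 1"]) auto
  then have "\<Sum>(UNIV :: 'q set) = (\<Sum>x\<in>(UNIV :: 'q set). x + 1)"
    by (rule sum.reindex_bij_betw[symmetric])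
  then show ?thesis by (simp add: sum.distrib)
qed

lemma finite_bounded_degree: "finite {Q :: 'q::{zero,finite} poly. degree Q \<le> d}"
proof (rule finite_subset)
  show "{Q :: 'q poly. degree Q \<le> d} \<subseteq> Poly ` {xs. set xs \<subseteq> UNIV \<and> length xs = Suc d}"
  proof
    fix Q :: "'q poly" assume "Q \<in> {Q. degree Q \<le> d}"
    then have "Q = Poly (map (Polynomial.coeff Q) [0..<Suc d])"
      by (intro poly_eqI) (auto simp: nth_default_def coeff_eq_0 simp del: upt_Suc)
    then show "Q \<in> Poly ` {xs. set xs \<subseteq> UNIV \<and> length xs = Suc d}" by (intro image_eqI) auto
  qed
qed (intro finite_imageI finite_lists_length_eq finite)

text \<open>
  For \<open>0 < degree P\<close> this is the standard system of representatives modulo \<open>P\<close>, including \<open>0\<close>.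
\<close>

definition residue_polys :: "'q::{field,finite} poly \<Rightarrow> 'q poly set" where
  "residue_polys P = {Q. degree Q < degree P}"

lemma finite_residue_polys [simp]: "finite (residue_polys P)"
  by (rule finite_subset[OF _ finite_bounded_degree[of "degree P"]]) (auto simp: residue_polys_def)

lemma card_degree_less:
  "0 < d \<Longrightarrow> card {Q :: 'q::{field,finite} poly. degree Q < d} = CARD('q) ^ d"
proof (induction d)
  case (Suc d)
  show ?case
  proof (cases "d = 0")
    case True
    have "{Q :: 'q poly. degree Q < Suc 0} = (\<lambda>c. [:c:]) ` UNIV"
      by (auto elim!: degree_eq_zeroE)
    then show ?thesis using True by (simp add: card_image inj_on_def)
  next
    case False
    have eq: "{Q :: 'q poly. degree Q < Suc d} = (\<lambda>(c, Q). pCons c Q) ` (UNIV \<times> {Q. degree Q < d})"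
    proof (intro equalityI subsetI)
      fix Q :: "'q poly" assume "Q \<in> {Q. degree Q < Suc d}"
      then show "Q \<in> (\<lambda>(c, Q). pCons c Q) ` (UNIV \<times> {Q. degree Q < d})"
        using False by (cases Q) (auto simp: image_iff split: if_splits)
    qed (use False in \<open>auto simp: degree_pCons_eq_if\<close>)
    have "inj_on (\<lambda>(c, Q). pCons c Q) (UNIV \<times> {Q :: 'q poly. degree Q < d})"
      by (auto simp: inj_on_def)
    then show ?thesis
      unfolding eq by (subst card_image) (use Suc False in \<open>auto simp: card_cartesian_product\<close>)
  qed
qed simp

lemma card_residue_polys: "0 < degree P \<Longrightarrow> card (residue_polys P) = CARD('q) ^ degree P"
  for P :: "'q::{field,finite} poly"
  unfolding residue_polys_def by (rule card_degree_less)

locale drinfeld =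
  fixes \<iota> :: "'q::{field,finite} fls \<Rightarrow> 'c::nonarch_complete_field"
  assumes completed: "completed_alg_closure \<iota>"
begin

abbreviation emb :: "'q poly \<Rightarrow> 'c" where "emb \<equiv> of_A \<iota>"

abbreviation imag_part :: "'c \<Rightarrow> real" where "imag_part z \<equiv> infdist z (range \<iota>)"

lemma iota_hom [simp]:
  "\<iota> 1 = 1" "\<iota> (x + y) = \<iota> x + \<iota> y" "\<iota> (x * y) = \<iota> x * \<iota> y"
  using completed by (auto simp: completed_alg_closure_def)

lemma iota_0 [simp]: "\<iota> 0 = 0"
proof -
  have "\<iota> 0 + \<iota> 0 = \<iota> 0 + 0" using iota_hom(2)[of 0 0] by (simp del: iota_hom)
  then show ?thesis by (simp only: add_left_cancel)
qed

lemma iota_minus [simp]: "\<iota> (- x) = - \<iota> x"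
  using iota_hom(2)[of x "- x"] by (simp add: eq_neg_iff_add_eq_0 add.commute)

lemma iota_diff [simp]: "\<iota> (x - y) = \<iota> x - \<iota> y"
  using iota_hom(2)[of x "- y"] by simp

lemma absval_iota: "x \<noteq> 0 \<Longrightarrow> absval (\<iota> x) = real CARD('q) powi (- fls_subdegree x)"
  using completed by (simp add: completed_alg_closure_def)

lemma card_gt_1: "1 < CARD('q)"
proof -
  have "card {0, 1 :: 'q} \<le> CARD('q)" by (rule card_mono) auto
  then show ?thesis by simp
qed

lemma iota_eq_0_iff [simp]: "\<iota> x = 0 \<longleftrightarrow> x = 0"
proof
  assume "\<iota> x = 0"
  show "x = 0"
  proof (rule ccontr)
    assume "x \<noteq> 0"
    then have "\<iota> x * \<iota> (inverse x) = 1" using iota_hom(3)[of x "inverse x"] by simp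
    with \<open>\<iota> x = 0\<close> show False by simp
  qed
qed simp

lemma iota_divide [simp]: "\<iota> (x / y) = \<iota> x / \<iota> y"
proof (cases "y = 0")
  case False
  then have "\<iota> (x / y) * \<iota> y = \<iota> x" using iota_hom(3)[of "x / y" y] by simp
  then show ?thesis using False by (simp add: eq_divide_eq)
qed simp

lemma emb_hom [simp]:
  "emb 0 = 0" "emb 1 = 1" "emb (a + b) = emb a + emb b" "emb (a * b) = emb a * emb b"
proof -
  have "poly_to_fls (1 :: 'q poly) = 1"
    unfolding one_pCons poly_to_fls_pCons by simp
  then show "emb 1 = 1" by (simp add: of_A_def)
qed (simp_all add: of_A_def poly_to_fls_add poly_to_fls_mult)

lemma emb_minus [simp]: "emb (- a) = - emb a"
  using emb_hom(3)[of a "- a"] by (simp del: emb_hom(3) add: eq_neg_iff_add_eq_0 add.commute)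

lemma emb_diff [simp]: "emb (a - b) = emb a - emb b"
  using emb_hom(3)[of a "- b"] by (simp del: emb_hom(3))

lemma emb_power [simp]: "emb (a ^ i) = emb a ^ i"
  by (induction i) simp_all

lemma absval_emb: "a \<noteq> 0 \<Longrightarrow> absval (emb a) = real CARD('q) ^ degree a"
  using poly_to_fls_nonzero_subdegree[of a] by (simp add: of_A_def absval_iota)

lemma absval_emb_ge_1: "a \<noteq> 0 \<Longrightarrow> 1 \<le> absval (emb a)"
  using card_gt_1 by (simp add: absval_emb one_le_power)

lemma emb_eq_0_iff [simp]: "emb a = 0 \<longleftrightarrow> a = 0"
  using absval_emb_ge_1[of a] by (cases "a = 0") auto

lemma emb_eq_iff [simp]: "emb a = emb b \<longleftrightarrow> a = b"
  using emb_eq_0_iff[of "a - b"] by (simp del: emb_eq_0_iff)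

lemma emb_in_range [simp]: "emb a \<in> range \<iota>"
  by (simp add: of_A_def)

lemma emb_divide_in_range [simp]: "emb a / emb b \<in> range \<iota>"
  by (auto simp: of_A_def simp flip: iota_divide)

lemma emb_const_power_card [simp]: "emb [:c:] ^ CARD('q) = emb [:c:]"
proof -
  have "[:c:] ^ CARD('q) = [:c:]"
    by (simp add: poly_const_pow finite_field_power_card)
  then show ?thesis unfolding emb_power[symmetric] by simp
qed

lemma of_nat_card_eq_0: "of_nat CARD('q) = (0 :: 'c)"
proof -
  have of_nat: "\<iota> (of_nat n) = of_nat n" for n by (induction n) auto
  have "of_nat CARD('q) = (0 :: 'q fls)"
    using of_nat_card_field_eq_0[where ?'q = 'q] by (simp add: fls_of_nat)
  then show ?thesis using of_nat[of "CARD('q)"] by simp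
qed

end

section \<open>The exponential function of the period lattice\<close>

locale carlitz = drinfeld \<iota> for \<iota> :: "'q::{field,finite} fls \<Rightarrow> 'c::nonarch_complete_field" +
  fixes \<pi> :: 'c
  assumes period: "carlitz_period \<iota> \<pi>"
begin

text \<open>
  In terms of this function the parameter at infinity is \<open>u(z) = 1 / scaled_exp z\<close>, and the period
  lattice becomes \<open>A\<close>.
\<close>

definition scaled_exp :: "'c \<Rightarrow> 'c" where
  "scaled_exp z = lattice_exp (period_lattice \<iota> \<pi>) (\<pi> * z)"

text \<open>
  The \<open>\<F>\<^sub>q\<close>-subspaces of \<open>A\<close> that exhaust it. Since \<open>degree 0 = 0\<close>, the zero polynomial is named
  separately, so that \<open>small_polys 0\<close> is the zero space.
\<close>

definition small_polys :: "nat \<Rightarrow> 'q poly set" where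
  "small_polys d = {a. a = 0 \<or> degree a < d}"

text \<open>
  The partial products of the lattice exponential along \<open>small_polys\<close>, evaluated at \<open>\<pi> z\<close>; the
  factors \<open>\<pi>\<close> in numerator and denominator of \<open>\<pi> z / (\<pi> a)\<close> cancel.
\<close>

definition partial_exp :: "nat \<Rightarrow> 'c \<Rightarrow> 'c" where
  "partial_exp d z = \<pi> * z * (\<Prod>a\<in>small_polys d - {0}. 1 - z / emb a)"

lemma period_nonzero [simp]: "\<pi> \<noteq> 0"
  using period by (simp add: carlitz_period_def)

lemma finite_small_polys [simp]: "finite (small_polys d)"
  by (rule finite_subset[OF _ finite_bounded_degree[of d]]) (auto simp: small_polys_def)

lemma small_polys_mono: "d \<le> d' \<Longrightarrow> small_polys d \<subseteq> small_polys d'"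
  by (auto simp: small_polys_def)

lemma zero_small_polys [simp]: "0 \<in> small_polys d"
  by (simp add: small_polys_def)

lemma small_polys_add: "a \<in> small_polys d \<Longrightarrow> b \<in> small_polys d \<Longrightarrow> a + b \<in> small_polys d"
  by (auto simp: small_polys_def intro: degree_add_less)

lemma absval_emb_large:
  assumes "a \<notin> small_polys d" shows "real CARD('q) ^ d \<le> absval (emb a)"
proof -
  have "a \<noteq> 0" "d \<le> degree a" using assms by (auto simp: small_polys_def)
  then show ?thesis using card_gt_1 by (simp add: absval_emb power_increasing)
qed

lemma ex_card_power_gt: "\<exists>d. x < real CARD('q) ^ d"
  using card_gt_1 by (intro real_arch_pow) simp

text \<open>
  The unordered product converges, and it may be computed along the subspaces \<open>small_polys d\<close>.
  A finite set of further lattice points beyond degree \<open>d\<close> changes a partial product by a relative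
  error of at most \<open>\<bar>z\<bar> / q ^ d\<close>, whatever the set is. Additivity and \<open>\<F>\<^sub>q\<close>-linearity of the
  exponential can then be checked on \<open>partial_exp\<close>.
\<close>

lemma partial_exp_tendsto: "(\<lambda>d. partial_exp d z) \<longlonglongrightarrow> scaled_exp z"
proof -
  let ?L = "period_lattice \<iota> \<pi> - {0}"
  define p where "p F = (\<Prod>w\<in>F. 1 - \<pi> * z / w)" for F
  define W where "W d = (\<lambda>a. \<pi> * emb a) ` (small_polys d - {0})" for d
  have inj: "inj_on (\<lambda>a. \<pi> * emb a) S" for S by (auto simp: inj_on_def)
  have pW: "p (W d) = (\<Prod>a\<in>small_polys d - {0}. 1 - z / emb a)" for d
    unfolding p_def W_def by (subst prod.reindex[OF inj]) simp
  have W: "finite (W d)" "W d \<subseteq> ?L" for d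
    by (auto simp: W_def period_lattice_def)
  obtain D where D: "absval z < real CARD('q) ^ D" using ex_card_power_gt by blast
  define \<delta> where "\<delta> d = absval z / real CARD('q) ^ d" for d
  have q1: "1 \<le> real CARD('q)" using card_gt_1 by simp
  have q0: "0 < real CARD('q) ^ d" for d using card_gt_1 by simp
  have \<delta>: "0 \<le> \<delta> d" "D \<le> d \<Longrightarrow> \<delta> d < 1" for d
  proof -
    show "0 \<le> \<delta> d" by (simp add: \<delta>_def)
    assume "D \<le> d"
    then have "real CARD('q) ^ D \<le> real CARD('q) ^ d" using q1 by (rule power_increasing)
    then show "\<delta> d < 1" using D q0[of d] by (simp add: \<delta>_def)
  qed
  have far: "absval (\<pi> * z / w) \<le> \<delta> d" if "w \<in> ?L" "w \<notin> W d" for w d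
  proof -
    have "w \<in> range (\<lambda>a. \<pi> * emb a)" using that by (simp add: period_lattice_def)
    then obtain a where w: "w = \<pi> * emb a" by blast
    then have a: "w = \<pi> * emb a" "a \<noteq> 0" "a \<notin> small_polys d"
      using that unfolding W_def by auto
    have "\<pi> * z / w = z / emb a" using a by simp
    then show ?thesis
      using absval_emb_large[OF a(3)] q0[of d] a(2)
      by (auto simp: absval_divide \<delta>_def intro!: divide_left_mono mult_pos_pos)
  qed
  have near: "absval (p F - p (W d)) \<le> absval (p (W d)) * \<delta> d"
    if "D \<le> d" "finite F" "W d \<subseteq> F" "F \<subseteq> ?L" for F d
  proof -
    have "p F = p (W d) * p (F - W d)"
      unfolding p_def using prod.subset_diff[of "W d" F] that by (simp add: mult.commute)
    then have "p F - p (W d) = p (W d) * (p (F - W d) - 1)" by (simp add: algebra_simps)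
    moreover have "absval (p (F - W d) - 1) \<le> \<delta> d"
      unfolding p_def using far that \<delta>[of d] by (intro absval_prod_one_minus) auto
    ultimately show ?thesis by (simp add: absval_mult mult_left_mono)
  qed
  have WD: "W D \<subseteq> W d" if "D \<le> d" for d
    using small_polys_mono[OF that] by (auto simp: W_def)
  have size: "absval (p (W d)) \<le> absval (p (W D))" if "D \<le> d" for d
  proof -
    have "absval (p (W d)) \<le> max (absval (p (W d) - p (W D))) (absval (p (W D)))"
      using absval_add[of "p (W d) - p (W D)" "p (W D)"] by simp
    moreover have "absval (p (W d) - p (W D)) \<le> absval (p (W D)) * 1"
      using near[of D "W d"] W WD[OF that] \<delta>[of D]
      by (meson less_imp_le mult_left_mono order_refl order_trans zero_le_dist)
    ultimately show ?thesis by simp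
  qed
  define B where "B = absval (p (W D))"
  have near': "absval (p F - p (W d)) \<le> B * \<delta> d"
    if "D \<le> d" "finite F" "W d \<subseteq> F" "F \<subseteq> ?L" for F d
    using near[OF that] mult_right_mono[OF size[OF that(1)] \<delta>(1)[of d]] unfolding B_def by linarith
  have small: "(\<lambda>d. B * \<delta> d) \<longlonglongrightarrow> 0"
  proof -
    have "(\<lambda>d. B * absval z * inverse (real CARD('q)) ^ d) \<longlonglongrightarrow> 0"
      using card_gt_1 by (intro tendsto_mult_right_zero LIMSEQ_power_zero) (simp add: inverse_less_1_iff)
    then show ?thesis by (simp add: \<delta>_def divide_inverse power_inverse mult.assoc)
  qed
  have ex: "\<exists>d\<ge>D. B * \<delta> d < e" if "0 < e" for e
  proof -
    have "\<forall>\<^sub>F d in sequentially. B * \<delta> d < e" using order_tendstoD(2)[OF small that] .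
    then obtain N where "\<And>d. N \<le> d \<Longrightarrow> B * \<delta> d < e" by (auto simp: eventually_sequentially)
    then have "B * \<delta> (max N D) < e" by simp
    then show ?thesis by (intro exI[of _ "max N D"]) auto
  qed
  have "Cauchy (\<lambda>d. p (W d))"
  proof (rule metric_CauchyI)
    fix e :: real assume "0 < e"
    then obtain d where d: "D \<le> d" "B * \<delta> d < e" using ex by blast
    have "dist (p (W i)) (p (W d)) < e" if "d \<le> i" for i
      using near'[OF d(1) W(1)[of i] _ W(2)[of i]] small_polys_mono[OF that] d(2)
      unfolding nonarch_dist[of "p (W i)" "p (W d)"] by (force simp: W_def)
    moreover have "dist x y < e" if "dist x (p (W d)) < e" "dist y (p (W d)) < e" for x y :: 'c
    proof -
      have "dist x y = absval ((x - p (W d)) - (y - p (W d)))"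
        unfolding nonarch_dist[of x y] by simp
      also have "\<dots> < e"
        using absval_diff[of "x - p (W d)" "y - p (W d)"] that
        unfolding nonarch_dist[of x "p (W d)"] nonarch_dist[of y "p (W d)"] by linarith
      finally show ?thesis .
    qed
    ultimately show "\<exists>M. \<forall>m\<ge>M. \<forall>n\<ge>M. dist (p (W m)) (p (W n)) < e" by blast
  qed
  then obtain l where l: "(\<lambda>d. p (W d)) \<longlonglongrightarrow> l"
    by (auto simp: Cauchy_convergent_iff convergent_def)
  have "(p \<longlongrightarrow> l) (finite_subsets_at_top ?L)"
  proof (rule tendstoI)
    fix e :: real assume "0 < e"
    then have e2: "0 < e / 2" by simp
    obtain d where d: "D \<le> d" "B * \<delta> d < e / 2" using ex[OF e2] by blast
    have near_l: "absval (p (W d) - l) \<le> B * \<delta> d"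
    proof (rule tendsto_upperbound)
      show "(\<lambda>i. absval (p (W d) - p (W i))) \<longlonglongrightarrow> absval (p (W d) - l)"
        by (intro nonarch_tendsto_absval tendsto_diff tendsto_const l)
      have "absval (p (W d) - p (W i)) \<le> B * \<delta> d" if "d \<le> i" for i
        using near'[OF d(1) W(1)[of i] _ W(2)[of i]] small_polys_mono[OF that]
        by (metis (no_types, lifting) Diff_mono W_def absval_minus image_mono minus_diff_eq order_refl)
      then show "\<forall>\<^sub>F i in sequentially. absval (p (W d) - p (W i)) \<le> B * \<delta> d"
        by (rule eventually_sequentiallyI)
    qed simp
    have "dist (p F) l < e" if "finite F" "W d \<subseteq> F" "F \<subseteq> ?L" for F
      using absval_add[of "p F - p (W d)" "p (W d) - l"] near'[OF d(1) that] near_l d(2) e2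
      unfolding nonarch_dist[of "p F" l] by simp
    then show "\<forall>\<^sub>F F in finite_subsets_at_top ?L. dist (p F) l < e"
      unfolding eventually_finite_subsets_at_top using W by (intro exI[of _ "W d"]) auto
  qed
  then have "Lim (finite_subsets_at_top ?L) p = l"
    by (intro tendsto_Lim) auto
  then have "scaled_exp z = \<pi> * z * l"
    by (simp add: scaled_exp_def lattice_exp_def p_def[abs_def])
  moreover have "(\<lambda>d. \<pi> * z * p (W d)) \<longlonglongrightarrow> \<pi> * z * l"
    by (rule nonarch_tendsto_mult_left[OF l])
  ultimately show ?thesis by (simp add: partial_exp_def pW)
qed

lemma partial_exp_add: "partial_exp d (x + y) = partial_exp d x + partial_exp d y"
proof -
  let ?V = "emb ` small_polys d"
  have inj: "inj_on emb S" for S by (auto simp: inj_on_def)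
  have eq: "partial_exp d z = \<pi> * (\<Prod>a\<in>small_polys d - {0}. - 1 / emb a) * (\<Prod>v\<in>?V. z - v)" for z
  proof -
    have "(\<Prod>v\<in>?V. z - v) = (\<Prod>a\<in>small_polys d. z - emb a)"
      by (simp add: prod.reindex[OF inj])
    also have "\<dots> = z * (\<Prod>a\<in>small_polys d - {0}. z - emb a)"
      by (subst prod.remove[of _ 0]) auto
    finally have 1: "(\<Prod>v\<in>?V. z - v) = z * (\<Prod>a\<in>small_polys d - {0}. z - emb a)" .
    have "(\<Prod>a\<in>small_polys d - {0}. 1 - z / emb a) =
      (\<Prod>a\<in>small_polys d - {0}. - 1 / emb a * (z - emb a))"
      by (intro prod.cong) (auto simp: field_simps)
    then have 2: "(\<Prod>a\<in>small_polys d - {0}. 1 - z / emb a) =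
      (\<Prod>a\<in>small_polys d - {0}. - 1 / emb a) * (\<Prod>a\<in>small_polys d - {0}. z - emb a)"
      by (simp only: prod.distrib)
    show ?thesis unfolding partial_exp_def 1 2 by (simp only: mult_ac)
  qed
  have "(\<Prod>v\<in>?V. x + y - v) = (\<Prod>v\<in>?V. x - v) + (\<Prod>v\<in>?V. y - v)"
  proof (rule prod_diff_additive_subgroup)
    show "0 \<in> ?V" by (rule image_eqI[of _ _ 0]) auto
    show "v + w \<in> ?V" if "v \<in> ?V" "w \<in> ?V" for v w
      using that small_polys_add by (auto simp flip: emb_hom(3))
  qed simp
  then show ?thesis by (simp add: eq algebra_simps)
qed

lemma scaled_exp_add: "scaled_exp (x + y) = scaled_exp x + scaled_exp y"
proof (rule LIMSEQ_unique[OF partial_exp_tendsto])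
  show "(\<lambda>d. partial_exp d (x + y)) \<longlonglongrightarrow> scaled_exp x + scaled_exp y"
    unfolding partial_exp_add by (intro tendsto_add partial_exp_tendsto)
qed

lemma scaled_exp_0 [simp]: "scaled_exp 0 = 0"
  using partial_exp_tendsto[of 0] by (simp add: partial_exp_def LIMSEQ_const_iff)

lemma scaled_exp_minus: "scaled_exp (- x) = - scaled_exp x"
  using scaled_exp_add[of x "- x"] by (simp add: eq_neg_iff_add_eq_0 add.commute)

lemma scaled_exp_diff: "scaled_exp (x - y) = scaled_exp x - scaled_exp y"
  using scaled_exp_add[of x "- y"] by (simp add: scaled_exp_minus)

lemma scaled_exp_emb [simp]: "scaled_exp (emb a) = 0"
proof (cases "a = 0")
  case False
  have "partial_exp d (emb a) = 0" if "Suc (degree a) \<le> d" for d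
  proof -
    have "a \<in> small_polys d - {0}" using False that by (auto simp: small_polys_def)
    then have "(\<Prod>b\<in>small_polys d - {0}. 1 - emb a / emb b) = 0"
      by (intro prod_zero) (auto intro: bexI[of _ a])
    then show ?thesis by (simp add: partial_exp_def)
  qed
  then have "\<forall>\<^sub>F d in sequentially. partial_exp d (emb a) = 0"
    by (rule eventually_sequentiallyI)
  then have "(\<lambda>d. partial_exp d (emb a)) \<longlonglongrightarrow> 0" by (rule tendsto_eventually)
  then show ?thesis by (rule LIMSEQ_unique[OF partial_exp_tendsto])
qed simp

text \<open>
  Multiplication by a nonzero constant permutes the nonzero elements of \<open>small_polys d\<close>.
\<close>

lemma scaled_exp_const_mult: "scaled_exp (emb [:c:] * z) = emb [:c:] * scaled_exp z"
proof (cases "c = 0")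
  case False
  have "partial_exp d (emb [:c:] * z) = emb [:c:] * partial_exp d z" for d
  proof -
    have "bij_betw ((*) [:inverse c:]) (small_polys d - {0}) (small_polys d - {0})"
      using False
      by (intro bij_betwI[where g = "(*) [:c:]"]) (auto simp: small_polys_def)
    then have "(\<Prod>a\<in>small_polys d - {0}. 1 - z / emb a) =
        (\<Prod>a\<in>small_polys d - {0}. 1 - z / emb ([:inverse c:] * a))"
      by (rule prod.reindex_bij_betw[symmetric])
    moreover have "1 - z / emb ([:inverse c:] * a) = 1 - emb [:c:] * z / emb a" for a
    proof -
      have "emb [:c:] * emb [:inverse c:] = 1"
        unfolding emb_hom(4)[symmetric] using False by (simp flip: one_pCons)
      then have "emb [:inverse c:] = inverse (emb [:c:])" by (metis inverse_unique)
      then show ?thesis unfolding emb_hom(4) by (simp add: field_simps)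
    qed
    ultimately show ?thesis by (simp add: partial_exp_def del: emb_hom(4))
  qed
  then have "(\<lambda>d. partial_exp d (emb [:c:] * z)) \<longlonglongrightarrow> emb [:c:] * scaled_exp z"
    by (simp add: nonarch_tendsto_mult_left partial_exp_tendsto)
  then show ?thesis by (rule LIMSEQ_unique[OF partial_exp_tendsto])
qed simp

lemma scaled_exp_T_mult:
  "scaled_exp (emb [:0, 1:] * z) = emb [:0, 1:] * scaled_exp z + scaled_exp z ^ CARD('q)"
  using period unfolding carlitz_period_def scaled_exp_def
  by (metis mult.left_commute)

text \<open>
  A polynomial larger than \<open>z\<close> is farther from \<open>z\<close> than \<open>0\<close> is, so finitely many candidates remain.
\<close>

lemma ex_nearest_poly: "\<exists>a. \<forall>b. absval (z - emb a) \<le> absval (z - emb b)"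
proof -
  obtain d where d: "absval z < real CARD('q) ^ d" using ex_card_power_gt by blast
  have "\<exists>a\<in>small_polys d. \<forall>b\<in>small_polys d. absval (z - emb a) \<le> absval (z - emb b)"
    by (rule ex_min_if_finite[of "(\<lambda>a. absval (z - emb a)) ` small_polys d", simplified, THEN bexE])
      (auto simp: image_iff not_less intro: zero_small_polys)
  then obtain a where a: "a \<in> small_polys d" "\<And>b. b \<in> small_polys d \<Longrightarrow> absval (z - emb a) \<le> absval (z - emb b)"
    by blast
  have "absval (z - emb a) \<le> absval (z - emb b)" for b
  proof (cases "b \<in> small_polys d")
    case False
    then have lt: "absval z < absval (emb b)" using absval_emb_large d by fastforce
    then have "absval (- emb b + z) = absval (- emb b)" by (intro absval_add_eq_left) simp
    then have "absval (z - emb b) = absval (emb b)" by simp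
    moreover have "absval (z - emb a) \<le> absval z" using a(2)[of 0] by simp
    ultimately show ?thesis using lt by simp
  qed (use a in auto)
  then show ?thesis by blast
qed

text \<open>
  Modulo periods \<open>z\<close> may be replaced by \<open>y = z - a\<close>, where \<open>a\<close> is a polynomial nearest to \<open>z\<close>.
  Then \<open>\<bar>y\<bar> \<le> \<bar>y - b\<bar>\<close> for all \<open>b\<close>, and hence no factor \<open>1 - y / b\<close> of the product is smaller than
  \<open>1\<close>. This single estimate yields both that the exponential vanishes only on \<open>A\<close> and that it is
  large where the imaginary part is large.
\<close>

lemma absval_scaled_exp_ge: "\<exists>a. absval \<pi> * absval (z - emb a) \<le> absval (scaled_exp z)"
proof -
  obtain a where a: "\<And>b. absval (z - emb a) \<le> absval (z - emb b)" using ex_nearest_poly by blast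
  define y where "y = z - emb a"
  have y: "absval y \<le> absval (y - emb b)" for b
    using a[of "a + b"] by (simp add: y_def algebra_simps)
  have ge1: "1 \<le> absval (1 - y / emb b)" if "b \<noteq> 0" for b
  proof (cases "absval y < absval (emb b)")
    case True
    then have "absval (- (y / emb b)) < absval (1 :: 'c)" using that by (simp add: absval_divide)
    then have "absval (1 + - (y / emb b)) = absval (1 :: 'c)" by (rule absval_add_eq_left)
    then show ?thesis by simp
  next
    case False
    have "1 - y / emb b = - (y - emb b) / emb b" using that by (simp add: field_simps)
    then have "absval (1 - y / emb b) = absval (y - emb b) / absval (emb b)"
      by (simp only: absval_divide absval_minus)
    moreover have "absval (emb b) \<le> absval (y - emb b)" using False y[of b] by linarith
    moreover have "0 < absval (emb b)" using that by simp
    ultimately show ?thesis by simp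
  qed
  have "absval \<pi> * absval y \<le> absval (partial_exp d y)" for d
  proof -
    have "1 \<le> (\<Prod>b\<in>small_polys d - {0}. absval (1 - y / emb b))"
      using ge1 by (intro prod_ge_1) auto
    then have "absval \<pi> * absval y * 1 \<le> absval \<pi> * absval y * (\<Prod>b\<in>small_polys d - {0}. absval (1 - y / emb b))"
      by (intro mult_left_mono) auto
    then show ?thesis by (simp add: partial_exp_def absval_mult absval_prod)
  qed
  then have "absval \<pi> * absval y \<le> absval (scaled_exp y)"
    by (intro tendsto_lowerbound[OF nonarch_tendsto_absval[OF partial_exp_tendsto]] always_eventually) auto
  then show ?thesis by (auto simp: y_def scaled_exp_diff)
qed

lemma absval_scaled_exp_ge_imag: "absval \<pi> * imag_part z \<le> absval (scaled_exp z)"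
proof -
  obtain a where a: "absval \<pi> * absval (z - emb a) \<le> absval (scaled_exp z)"
    using absval_scaled_exp_ge by blast
  have "imag_part z \<le> dist z (emb a)" by (rule infdist_le) simp
  then have "absval \<pi> * imag_part z \<le> absval \<pi> * absval (z - emb a)"
    by (intro mult_left_mono) (auto simp: nonarch_dist[of z "emb a"])
  with a show ?thesis by linarith
qed

lemma scaled_exp_eq_0_imp: "scaled_exp z = 0 \<Longrightarrow> z \<in> range emb"
  using absval_scaled_exp_ge[of z] by (auto simp: mult_le_0_iff)

text \<open>
  The exponential turns multiplication by \<open>P\<close> into the polynomial \<open>\<rho>\<^sub>P\<close> of the Carlitz module. The
  decomposition \<open>P = c + T P'\<close> gives the recursion \<open>c X + T \<rho>' + \<rho>' ^ q\<close>, where \<open>\<rho>'\<close> belongs to \<open>P'\<close>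
  and the \<open>q\<close>-th power carries the leading term.
\<close>

lemma ex_carlitz_poly:
  "P \<noteq> 0 \<Longrightarrow> \<exists>\<rho>. degree \<rho> = CARD('q) ^ degree P \<and> Polynomial.coeff \<rho> 0 = 0 \<and>
     lead_coeff \<rho> = emb [:lead_coeff P:] \<and> (\<forall>z. scaled_exp (emb P * z) = poly \<rho> (scaled_exp z))"
proof (induction P)
  case (pCons c P)
  show ?case
  proof (cases "P = 0")
    case True
    then show ?thesis using pCons.hyps
      by (intro exI[of _ "[:0, emb [:c:]:]"]) (auto simp: scaled_exp_const_mult intro: mult.commute)
  next
    case False
    then obtain \<rho> where \<rho>: "degree \<rho> = CARD('q) ^ degree P" "Polynomial.coeff \<rho> 0 = 0"
      "lead_coeff \<rho> = emb [:lead_coeff P:]" "\<And>z. scaled_exp (emb P * z) = poly \<rho> (scaled_exp z)"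
      using pCons by blast
    let ?q = "CARD('q)"
    define \<sigma> where "\<sigma> = \<rho> ^ ?q + (smult (emb [:0, 1:]) \<rho> + [:0, emb [:c:]:])"
    have \<rho>0: "\<rho> \<noteq> 0" using \<rho>(1) by auto
    have pos: "1 \<le> ?q ^ degree P" using card_gt_1 by simp
    have degq: "degree (\<rho> ^ ?q) = ?q ^ Suc (degree P)" using \<rho>0 \<rho>(1) by (simp add: degree_power_eq)
    have "degree (smult (emb [:0, 1:]) \<rho> + [:0, emb [:c:]:]) \<le> ?q ^ degree P"
      using \<rho>(1) pos by (intro degree_add_le) auto
    also have less: "\<dots> < degree (\<rho> ^ ?q)" unfolding degq using card_gt_1 by simp
    finally have lt: "degree (smult (emb [:0, 1:]) \<rho> + [:0, emb [:c:]:]) < degree (\<rho> ^ ?q)" .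
    have deg: "degree \<sigma> = degree (\<rho> ^ ?q)"
      unfolding \<sigma>_def by (rule degree_add_eq_left[OF lt])
    then have "degree \<sigma> = ?q ^ Suc (degree P)" by (simp only: degq)
    moreover have "lead_coeff \<sigma> = emb [:lead_coeff P:]"
    proof -
      have "lead_coeff \<sigma> = lead_coeff (\<rho> ^ ?q)"
        unfolding deg using coeff_eq_0[OF lt] by (simp add: \<sigma>_def)
      then show ?thesis by (simp add: lead_coeff_power \<rho>(3))
    qed
    moreover have "Polynomial.coeff \<sigma> 0 = 0"
      using \<rho>(2) card_gt_1 by (simp add: \<sigma>_def coeff_0_power)
    moreover have "scaled_exp (emb (pCons c P) * z) = poly \<sigma> (scaled_exp z)" for z
    proof -
      have "pCons c P = [:c:] + [:0, 1:] * P" by simp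
      then have "emb (pCons c P) * z = emb [:c:] * z + emb [:0, 1:] * (emb P * z)"
        by (simp only: emb_hom algebra_simps)
      then have "scaled_exp (emb (pCons c P) * z) = emb [:c:] * scaled_exp z +
          (emb [:0, 1:] * poly \<rho> (scaled_exp z) + poly \<rho> (scaled_exp z) ^ ?q)"
        by (simp only: scaled_exp_add scaled_exp_const_mult scaled_exp_T_mult \<rho>(4))
      then show ?thesis by (simp add: \<sigma>_def poly_power)
    qed
    ultimately show ?thesis using False by (intro exI[of _ \<sigma>]) simp
  qed
qed simp

end

section \<open>Power series: substitution and descent\<close>

text \<open>
  The Gauss norm of radius \<open>r\<close> of the power series with coefficients \<open>a\<close> is at most \<open>M\<close>.
\<close>

definition gauss_bounded :: "real \<Rightarrow> (nat \<Rightarrow> 'c::nonarch_complete_field) \<Rightarrow> real \<Rightarrow> bool" where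
  "gauss_bounded r a M \<longleftrightarrow> (\<forall>i. absval (a i) * r ^ i \<le> M)"

lemma gauss_bounded_nonneg: "gauss_bounded r a M \<Longrightarrow> 0 \<le> M"
  unfolding gauss_bounded_def using order_trans[OF zero_le_dist] by (metis mult.right_neutral power_0)

lemma gauss_bounded_antimono:
  assumes "gauss_bounded r a M" "0 \<le> r'" "r' \<le> r" shows "gauss_bounded r' a M"
  unfolding gauss_bounded_def
proof
  fix i
  have "absval (a i) * r' ^ i \<le> absval (a i) * r ^ i"
    using assms by (intro mult_left_mono power_mono) auto
  then show "absval (a i) * r' ^ i \<le> M" using assms by (auto simp: gauss_bounded_def intro: order_trans)
qed

lemma gauss_bounded_term:
  assumes "gauss_bounded r a M" "0 < r"
  shows "absval (a i * t ^ i) \<le> M * (absval t / r) ^ i"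
proof -
  have "absval (a i * t ^ i) = absval (a i) * r ^ i * (absval t / r) ^ i"
    using assms by (simp add: absval_mult absval_power power_divide)
  also have "\<dots> \<le> M * (absval t / r) ^ i"
    using assms by (intro mult_right_mono) (auto simp: gauss_bounded_def)
  finally show ?thesis .
qed

lemma nonarch_summable_comparison:
  fixes f :: "nat \<Rightarrow> 'c::nonarch_complete_field"
  assumes "\<And>i. absval (f i) \<le> g i" "g \<longlonglongrightarrow> 0" shows "summable f"
proof (rule nonarch_summable)
  have "(\<lambda>i. absval (f i)) \<longlonglongrightarrow> 0"
    by (rule tendsto_sandwich[OF _ _ tendsto_const assms(2)]; rule always_eventually; intro allI zero_le_dist assms)
  then show "f \<longlonglongrightarrow> 0" by (simp add: tendsto_absval_0_iff)
qed

lemma gauss_bounded_summable: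
  assumes "gauss_bounded r a M" "0 < r" "absval t < r"
  shows "summable (\<lambda>i. a i * t ^ i)"
  using assms by (intro nonarch_summable_comparison[OF gauss_bounded_term[OF assms(1,2)]]
      tendsto_mult_right_zero LIMSEQ_power_zero) auto

text \<open>
  The Gauss norm is submultiplicative by the ultrametric inequality.
\<close>

lemma gauss_bounded_mult:
  fixes f g :: "'c::nonarch_complete_field fps"
  assumes f: "gauss_bounded r (fps_nth f) M" and g: "gauss_bounded r (fps_nth g) M'" and "0 \<le> r"
  shows "gauss_bounded r (fps_nth (f * g)) (M * M')"
  unfolding gauss_bounded_def
proof
  fix n
  have MM: "0 \<le> M" "0 \<le> M'" using f g by (auto intro: gauss_bounded_nonneg)
  show "absval ((f * g) $ n) * r ^ n \<le> M * M'"
  proof (cases "r ^ n = 0")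
    case False
    then have pos: "0 < r ^ n" using zero_le_power[OF \<open>0 \<le> r\<close>, of n] by linarith
    have "absval (f $ i * g $ (n - i)) \<le> M * M' / r ^ n" if "i \<le> n" for i
    proof -
      have "absval (f $ i * g $ (n - i)) * r ^ n = (absval (f $ i) * r ^ i) * (absval (g $ (n - i)) * r ^ (n - i))"
        using that by (simp add: absval_mult mult_ac flip: power_add)
      also have "\<dots> \<le> M * M'"
        using f g \<open>0 \<le> r\<close> MM by (intro mult_mono) (auto simp: gauss_bounded_def)
      finally show ?thesis using pos by (simp add: pos_le_divide_eq)
    qed
    then have "absval ((f * g) $ n) \<le> M * M' / r ^ n"
      unfolding fps_mult_nth using MM pos by (intro absval_sum_le) auto
    then show ?thesis using pos by (simp add: pos_le_divide_eq)
  qed (use MM in \<open>simp del: power_eq_0_iff\<close>)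
qed

lemma gauss_bounded_power:
  fixes f :: "'c::nonarch_complete_field fps"
  assumes "gauss_bounded r (fps_nth f) M" "0 \<le> r"
  shows "gauss_bounded r (fps_nth (f ^ i)) (M ^ i)"
proof (induction i)
  case (Suc i)
  then show ?case using gauss_bounded_mult[OF assms(1) Suc assms(2)] by simp
qed (auto simp: gauss_bounded_def)

text \<open>
  Needed to write a Cauchy product as a double series of the shape treated by \<open>nonarch_sums_swap\<close>.
\<close>

lemma sums_delay:
  fixes f :: "nat \<Rightarrow> 'c::nonarch_complete_field"
  assumes "f sums s" shows "(\<lambda>m. if m < i then 0 else f (m - i)) sums s"
proof (induction i)
  case (Suc i)
  let ?g = "\<lambda>m. if m < Suc i then 0 else f (m - Suc i)"
  have "(\<lambda>m. ?g (Suc m)) sums s" using Suc by (simp cong: if_cong)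
  then show ?case using sums_Suc[of ?g s] by simp
qed (use assms in simp)

lemma sums_poly: "(\<lambda>m. Polynomial.coeff p m * x ^ m) sums poly p x"
  for x :: "'c::nonarch_complete_field"
proof -
  have "(\<lambda>m. Polynomial.coeff p m * x ^ m) sums (\<Sum>m\<le>degree p. Polynomial.coeff p m * x ^ m)"
    by (rule sums_finite) (auto simp: coeff_eq_0)
  then show ?thesis by (simp add: poly_altdef)
qed

lemma fps_mult_sums:
  fixes f g :: "'c::nonarch_complete_field fps"
  assumes f: "gauss_bounded r (fps_nth f) M" and g: "gauss_bounded r (fps_nth g) M'"
    and t: "0 < r" "absval t < r"
    and sums: "(\<lambda>i. f $ i * t ^ i) sums y" "(\<lambda>i. g $ i * t ^ i) sums z"
  shows "(\<lambda>i. (f * g) $ i * t ^ i) sums (y * z)"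
proof -
  define x where "x i m = f $ i * t ^ i * (if m < i then 0 else g $ (m - i) * t ^ (m - i))" for i m
  have MM: "0 \<le> M" "0 \<le> M'" using f g by (auto intro: gauss_bounded_nonneg)
  have "(\<lambda>m. \<Sum>i\<le>1 * m. x i m) sums (y * z)"
  proof (rule nonarch_sums_swap)
    show "absval (x i m) \<le> (M * M') * (absval t / r) ^ m" for i m
    proof (cases "m < i")
      case False
      have "absval (x i m) = absval (f $ i * t ^ i) * absval (g $ (m - i) * t ^ (m - i))"
        using False by (simp add: x_def absval_mult)
      also have "\<dots> \<le> (M * (absval t / r) ^ i) * (M' * (absval t / r) ^ (m - i))"
        using MM t by (intro mult_mono gauss_bounded_term f g) auto
      also have "\<dots> = (M * M') * (absval t / r) ^ m"
        using False by (simp add: mult_ac flip: power_add)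
      finally show ?thesis .
    qed (use MM t in \<open>simp add: x_def\<close>)
    show "x i sums (f $ i * t ^ i * z)" for i
      unfolding x_def[abs_def] by (intro nonarch_sums_mult sums_delay sums)
    show "(\<lambda>i. f $ i * t ^ i * z) sums (y * z)"
      using nonarch_sums_mult[OF sums(1), of z] by (simp add: mult.commute)
  qed (use t in \<open>auto simp: x_def\<close>)
  moreover have "(\<Sum>i\<le>m. x i m) = (f * g) $ m * t ^ m" for m
    unfolding fps_mult_nth sum_distrib_right atMost_atLeast0
    by (intro sum.cong) (auto simp: x_def mult_ac simp flip: power_add)
  ultimately show ?thesis by simp
qed

lemma sums_fps_1: "(\<lambda>i. (1 :: 'c::nonarch_complete_field fps) $ i * t ^ i) sums 1"
  using sums_poly[of 1 t] by (simp add: coeff_1 of_bool_def)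

text \<open>
  On a small disc the nonconstant terms of \<open>f\<close> are dominated by \<open>f $ 0\<close>, and the recursion for the
  coefficients of the inverse preserves the bound.
\<close>

lemma ex_gauss_bounded_inverse:
  fixes f :: "'c::nonarch_complete_field fps"
  assumes f0: "f $ 0 \<noteq> 0" and f: "gauss_bounded r (fps_nth f) M" "0 < r"
  obtains s where "0 < s" "s \<le> r" "gauss_bounded s (fps_nth (inverse f)) (1 / absval (f $ 0))"
proof -
  let ?A = "absval (f $ 0)"
  have A: "0 < ?A" using f0 by simp
  have MA: "?A \<le> M" using f(1)[unfolded gauss_bounded_def, rule_format, of 0] by simp
  then have M: "0 < M" using A by linarith
  define s where "s = r * (?A / M)"
  have s: "0 < s" "s \<le> r" using A M f MA by (auto simp: s_def field_simps)
  have coeff: "absval (f $ i) * s ^ i \<le> ?A" for i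
  proof (cases i)
    case (Suc j)
    have "absval (f $ i) * s ^ i = absval (f $ i) * r ^ i * (?A / M) ^ i"
      unfolding s_def power_mult_distrib by (simp only: mult.assoc)
    also have "\<dots> \<le> M * (?A / M) ^ 1"
    proof (intro mult_mono power_decreasing)
      show "absval (f $ i) * r ^ i \<le> M" using f by (simp add: gauss_bounded_def)
    qed (use A M MA Suc in auto)
    finally show ?thesis using M by simp
  qed simp
  have "absval (inverse f $ n) * s ^ n \<le> 1 / ?A" for n
  proof (induction n rule: less_induct)
    case (less n)
    show ?case
    proof (cases n)
      case 0
      then show ?thesis by (simp add: absval_inverse divide_inverse)
    next
      case (Suc m)
      have "0 = (\<Sum>i=0..n. f $ i * inverse f $ (n - i))"
        using arg_cong[OF inverse_mult_eq_1[OF f0], of "\<lambda>g. g $ n"] Suc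
        by (simp add: mult.commute[of "inverse f"] fps_mult_nth)
      also have "\<dots> = f $ 0 * inverse f $ n + (\<Sum>i=1..n. f $ i * inverse f $ (n - i))"
        by (subst sum.atLeast_Suc_atMost) auto
      finally have "f $ 0 * inverse f $ n = - (\<Sum>i=1..n. f $ i * inverse f $ (n - i))"
        by (simp add: eq_neg_iff_add_eq_0)
      then have "?A * absval (inverse f $ n) = absval (\<Sum>i=1..n. f $ i * inverse f $ (n - i))"
        by (metis absval_minus absval_mult)
      also have "\<dots> \<le> 1 / s ^ n"
      proof (rule absval_sum_le)
        fix i assume i: "i \<in> {1..n}"
        have "absval (f $ i * inverse f $ (n - i)) * s ^ n =
            (absval (f $ i) * s ^ i) * (absval (inverse f $ (n - i)) * s ^ (n - i))"
          using i by (simp add: absval_mult mult_ac flip: power_add)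
        also have "\<dots> \<le> ?A * (1 / ?A)"
          using i s less.IH[of "n - i"] coeff[of i] by (intro mult_mono) auto
        finally show "absval (f $ i * inverse f $ (n - i)) \<le> 1 / s ^ n"
          using A s by (simp add: pos_le_divide_eq)
      qed (use s in simp)
      finally show ?thesis using A s by (simp add: field_simps)
    qed
  qed
  then show ?thesis using that[OF s] by (simp add: gauss_bounded_def)
qed

lemma fps_of_poly_bounded: "\<exists>M. gauss_bounded 1 (fps_nth (fps_of_poly p)) M"
  for p :: "'c::nonarch_complete_field poly"
proof -
  let ?M = "\<Sum>i\<le>degree p. absval (Polynomial.coeff p i)"
  have "absval (Polynomial.coeff p i) \<le> ?M" for i
  proof (cases "i \<le> degree p")
    case True
    then show ?thesis by (intro member_le_sum) auto
  qed (simp add: coeff_eq_0 sum_nonneg)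
  then show ?thesis by (auto simp: gauss_bounded_def)
qed

text \<open>
  The function \<open>w(t) = 1 / G(1 / t)\<close> is a power series in \<open>t\<close> without constant term: with
  \<open>D = degree G\<close> and the reflected polynomial \<open>F(t) = t ^ D G(1 / t)\<close> it is \<open>t ^ D / F(t)\<close>, and
  \<open>F(0) \<noteq> 0\<close>. Hence a power series in \<open>w\<close> is a power series in \<open>t\<close>. It is applied to
  \<open>w = u(\<alpha> z + \<beta>)\<close> and \<open>t = u(z)\<close>, where \<open>1 / w\<close> is a polynomial in \<open>1 / t\<close> by \<open>ex_carlitz_poly\<close>.
\<close>

lemma power_series_substitution:
  fixes a :: "nat \<Rightarrow> 'c::nonarch_complete_field"
  assumes a: "a 0 = 0" "gauss_bounded r a M" "0 < r" and G: "0 < degree G"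
  obtains b r' where "b 0 = 0" "0 < r'" "gauss_bounded r' b M"
    "\<And>t Y. t \<noteq> 0 \<Longrightarrow> absval t < r' \<Longrightarrow> (\<lambda>i. a i * (1 / poly G (1 / t)) ^ i) sums Y \<Longrightarrow>
       (\<lambda>i. b i * t ^ i) sums Y"
proof -
  define D where "D = degree G"
  define F where "F = fps_of_poly (reflect_poly G)"
  define w where "w = fps_X ^ D * inverse F"
  have F0: "F $ 0 \<noteq> 0" using G by (auto simp: F_def)
  obtain M1 where M1: "gauss_bounded 1 (fps_nth F) M1"
    using fps_of_poly_bounded unfolding F_def by blast
  obtain s where s: "0 < s" "s \<le> 1" "gauss_bounded s (fps_nth (inverse F)) (1 / absval (F $ 0))"
    using ex_gauss_bounded_inverse[OF F0 M1] by auto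
  define C where "C = 1 / absval (F $ 0)"
  have C: "0 < C" using F0 by (simp add: C_def)
  have w_nth: "w $ m = (if m < D then 0 else inverse F $ (m - D))" for m
    by (simp add: w_def fps_X_power_mult_nth)
  have w0: "w $ 0 = 0" using G by (simp add: w_nth D_def)
  have w_bound: "gauss_bounded s (fps_nth w) C"
    unfolding gauss_bounded_def
  proof
    fix m
    show "absval (w $ m) * s ^ m \<le> C"
    proof (cases "m < D")
      case False
      have "absval (inverse F $ (m - D)) * s ^ m \<le> absval (inverse F $ (m - D)) * s ^ (m - D)"
        using s by (intro mult_left_mono power_decreasing) auto
      then show ?thesis using False s(3)
        by (auto simp: w_nth gauss_bounded_def C_def intro: order_trans)
    qed (use C in \<open>simp add: w_nth\<close>)
  qed
  \<comment> \<open>Every coefficient of positive index shrinks by at least \<open>min 1 (r / C)\<close>, which brings the Gauss norm of \<open>w\<close> from \<open>C\<close> down to \<open>r\<close>.\<close>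
  define r' where "r' = s * min 1 (r / C)"
  have r': "0 < r'" "r' \<le> s" using s C a by (auto simp: r'_def)
  have w_small: "gauss_bounded r' (fps_nth w) r"
    unfolding gauss_bounded_def
  proof
    fix m
    show "absval (w $ m) * r' ^ m \<le> r"
    proof (cases m)
      case (Suc j)
      have "absval (w $ m) * r' ^ m = absval (w $ m) * s ^ m * min 1 (r / C) ^ m"
        unfolding r'_def power_mult_distrib by (simp only: mult.assoc)
      also have "\<dots> \<le> C * min 1 (r / C) ^ 1"
      proof (intro mult_mono power_decreasing)
        show "absval (w $ m) * s ^ m \<le> C" using w_bound by (simp add: gauss_bounded_def)
      qed (use a C Suc in auto)
      also have "\<dots> \<le> C * (r / C)" using C by (intro mult_left_mono) auto
      finally show ?thesis using C by simp
    qed (use w0 a in simp)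
  qed
  have w_power_small: "gauss_bounded r' (fps_nth (w ^ i)) (r ^ i)" for i
    using gauss_bounded_power[OF w_small] r' by simp
  have w_power_0: "(w ^ i) $ m = 0" if "m < i" for i m
    using startsby_zero_power_prefix[OF w0] that by blast
  have aw: "absval (a i * (w ^ i) $ m) * r' ^ m \<le> M" for i m
  proof -
    have "absval (a i * (w ^ i) $ m) * r' ^ m = absval (a i) * (absval ((w ^ i) $ m) * r' ^ m)"
      by (simp add: absval_mult)
    also have "\<dots> \<le> absval (a i) * r ^ i"
      using w_power_small by (intro mult_left_mono) (auto simp: gauss_bounded_def)
    also have "\<dots> \<le> M" using a by (simp add: gauss_bounded_def)
    finally show ?thesis .
  qed
  have M0: "0 \<le> M" using a gauss_bounded_nonneg by blast
  define b where "b m = (\<Sum>i\<le>m. a i * (w ^ i) $ m)" for m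
  show ?thesis
  proof
    show "b 0 = 0" using a by (simp add: b_def)
    show "0 < r'" by fact
    show "gauss_bounded r' b M"
      unfolding gauss_bounded_def
    proof
      fix m
      have "absval (b m) \<le> M / r' ^ m"
        unfolding b_def using aw r' M0 by (intro absval_sum_le) (auto simp: pos_le_divide_eq)
      then show "absval (b m) * r' ^ m \<le> M" using r' by (simp add: pos_le_divide_eq)
    qed
    fix t Y assume t: "t \<noteq> 0" "absval t < r'" and Y: "(\<lambda>i. a i * (1 / poly G (1 / t)) ^ i) sums Y"
    have ts: "absval t < s" using t r' by simp
    have F_sums: "(\<lambda>i. F $ i * t ^ i) sums poly (reflect_poly G) t"
      unfolding F_def using sums_poly by simp
    obtain V where V: "(\<lambda>i. inverse F $ i * t ^ i) sums V"
      using gauss_bounded_summable[OF s(3) s(1) ts] by (auto simp: summable_def)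
    have "(\<lambda>i. (inverse F * F) $ i * t ^ i) sums (V * poly (reflect_poly G) t)"
      by (rule fps_mult_sums[OF s(3) gauss_bounded_antimono[OF M1] s(1) ts V F_sums]) (use s in auto)
    then have "V * poly (reflect_poly G) t = 1"
      using sums_fps_1[of t] by (metis F0 inverse_mult_eq_1 sums_unique2)
    then have V1: "t ^ D * V * poly G (1 / t) = 1"
      using t by (simp add: poly_reflect_poly_nz D_def inverse_eq_divide mult_ac)
    then have "poly G (1 / t) \<noteq> 0" by auto
    then have V': "t ^ D * V = 1 / poly G (1 / t)" using V1 by (rule eq_divide_imp)
    have w_sums: "(\<lambda>i. w $ i * t ^ i) sums (t ^ D * V)"
    proof -
      have "(\<lambda>i. if i < D then 0 else t ^ D * (inverse F $ (i - D) * t ^ (i - D))) sums (t ^ D * V)"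
        by (intro sums_delay nonarch_sums_mult V)
      moreover have "(if i < D then 0 else t ^ D * (inverse F $ (i - D) * t ^ (i - D))) = w $ i * t ^ i" for i
        by (simp add: w_nth mult_ac flip: power_add)
      ultimately show ?thesis by simp
    qed
    have w_power_sums: "(\<lambda>m. (w ^ i) $ m * t ^ m) sums ((t ^ D * V) ^ i)" for i
    proof (induction i)
      case (Suc i)
      show ?case unfolding power_Suc
        by (rule fps_mult_sums[OF w_small w_power_small r'(1) t(2) w_sums Suc])
    qed (use sums_fps_1 in simp)
    have "(\<lambda>m. \<Sum>i\<le>1 * m. a i * ((w ^ i) $ m * t ^ m)) sums Y"
    proof (rule nonarch_sums_swap)
      show "absval (a i * ((w ^ i) $ m * t ^ m)) \<le> M * (absval t / r') ^ m" for i m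
        using gauss_bounded_term[of r' "\<lambda>m. a i * (w ^ i) $ m" M m t] aw r'
        by (simp add: gauss_bounded_def mult.assoc)
      show "(\<lambda>m. a i * ((w ^ i) $ m * t ^ m)) sums (a i * (1 / poly G (1 / t)) ^ i)" for i
        using w_power_sums[of i] unfolding V' by (rule nonarch_sums_mult)
    qed (use t r' Y w_power_0 in auto)
    then show "(\<lambda>i. b i * t ^ i) sums Y"
      by (simp add: b_def sum_distrib_right mult.assoc)
  qed
qed

text \<open>
  Let \<open>e\<close> satisfy \<open>\<rho>(e) = 1 / s\<close>, where \<open>\<rho>\<close> has no constant term. Then \<open>1 / e\<close> equals \<open>s\<close> times the sum
  of \<open>\<rho>\<^sub>j\<^sub>+\<^sub>1 e ^ j\<close>, and repeated multiplication by \<open>1 / e\<close> writes \<open>(1 / e) ^ i\<close> as a combination of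
  \<open>e ^ j\<close>, \<open>j < degree \<rho>\<close>, whose coefficients are polynomials in \<open>s\<close>. They are the values
  \<open>descent_poly \<rho> i j\<close>.
\<close>

fun descent_poly :: "'c::comm_ring_1 poly \<Rightarrow> nat \<Rightarrow> nat \<Rightarrow> 'c poly" where
  "descent_poly \<rho> 0 j = (if j = 0 then 1 else 0)"
| "descent_poly \<rho> (Suc i) j =
     [:0, Polynomial.coeff \<rho> (Suc j):] * descent_poly \<rho> i 0 + descent_poly \<rho> i (Suc j)"

lemma descent_poly_high: "0 < degree \<rho> \<Longrightarrow> degree \<rho> \<le> j \<Longrightarrow> descent_poly \<rho> i j = 0"
  by (induction i arbitrary: j) (auto simp: coeff_eq_0)

text \<open>
  If \<open>1 / e\<close> is given weight \<open>1\<close>, then \<open>s\<close> has weight \<open>degree \<rho>\<close>, and all terms of \<open>(1 / e) ^ i\<close> have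
  weight at least \<open>i\<close>. For \<open>i > 0\<close> the polynomials thus have no constant term, and only finitely
  many \<open>i\<close> contribute to a given power of \<open>s\<close>.
\<close>

lemma coeff_descent_poly_0: "Polynomial.coeff (descent_poly \<rho> i j) m \<noteq> 0 \<Longrightarrow> 0 < degree \<rho> \<Longrightarrow> i + j \<le> degree \<rho> * m"
proof (induction i arbitrary: j m)
  case 0
  then show ?case by (auto split: if_splits)
next
  case (Suc i)
  show ?case
  proof (cases "Polynomial.coeff (descent_poly \<rho> i (Suc j)) m = 0")
    case False
    then show ?thesis using Suc.IH[of "Suc j" m] Suc.prems by simp
  next
    case True
    then have "Polynomial.coeff ([:0, Polynomial.coeff \<rho> (Suc j):] * descent_poly \<rho> i 0) m \<noteq> 0"
      using Suc.prems by simp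
    then obtain m' where m: "m = Suc m'" and
      "Polynomial.coeff \<rho> (Suc j) * Polynomial.coeff (descent_poly \<rho> i 0) m' \<noteq> 0"
      by (cases m) auto
    then have "Polynomial.coeff \<rho> (Suc j) \<noteq> 0" "Polynomial.coeff (descent_poly \<rho> i 0) m' \<noteq> 0"
      by auto
    then have "Suc j \<le> degree \<rho>" "i \<le> degree \<rho> * m'"
      using Suc.IH[of 0 m'] Suc.prems by (auto intro: le_degree)
    then show ?thesis using m by simp
  qed
qed

lemma absval_coeff_descent_poly:
  fixes \<rho> :: "'c::nonarch_complete_field poly"
  assumes "\<And>i. absval (Polynomial.coeff \<rho> i) \<le> C" "1 \<le> C"
  shows "absval (Polynomial.coeff (descent_poly \<rho> i j) m) \<le> C ^ m"
proof (induction i arbitrary: j m)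
  case 0
  then show ?case using assms by (simp add: coeff_1)
next
  case (Suc i)
  have "absval (Polynomial.coeff ([:0, Polynomial.coeff \<rho> (Suc j):] * descent_poly \<rho> i 0) m) \<le> C ^ m"
    using assms by (cases m) (auto simp: absval_mult intro!: mult_mono Suc)
  then show ?case
    using Suc[of "Suc j" m] absval_add[of "Polynomial.coeff ([:0, Polynomial.coeff \<rho> (Suc j):] * descent_poly \<rho> i 0) m"
        "Polynomial.coeff (descent_poly \<rho> i (Suc j)) m"]
    by (simp only: descent_poly.simps coeff_add)
qed

lemma inverse_power_descent_poly:
  fixes e :: "'c::field"
  assumes "Polynomial.coeff \<rho> 0 = 0" "0 < degree \<rho>" "poly \<rho> e \<noteq> 0"
  shows "(1 / e) ^ i = (\<Sum>j<degree \<rho>. poly (descent_poly \<rho> i j) (1 / poly \<rho> e) * e ^ j)"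
proof (induction i)
  case 0
  have "(\<Sum>j<degree \<rho>. poly (descent_poly \<rho> 0 j) (1 / poly \<rho> e) * e ^ j) = (\<Sum>j<degree \<rho>. if j = 0 then 1 else 0)"
    by (intro sum.cong) auto
  then show ?case using assms by simp
next
  case (Suc i)
  let ?N = "degree \<rho>" and ?s = "1 / poly \<rho> e"
  define h where "h i j = poly (descent_poly \<rho> i j) ?s" for i j
  have e: "e \<noteq> 0" using assms by (auto simp: poly_0_coeff_0)
  obtain n where n: "?N = Suc n" using assms by (cases ?N) auto
  define B where "B = (\<Sum>j<?N. Polynomial.coeff \<rho> (Suc j) * e ^ j)"
  have eB: "poly \<rho> e = e * B"
    unfolding B_def using assms(1) by (simp add: poly_altdef lessThan_Suc_atMost[symmetric] sum.lessThan_Suc_shift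
        sum_distrib_left mult_ac del: sum.lessThan_Suc)
  have inv: "1 / e = (\<Sum>j<?N. ?s * Polynomial.coeff \<rho> (Suc j) * e ^ j)"
  proof -
    have "1 / e = ?s * B" using e assms(3) eB by simp
    then show ?thesis unfolding B_def sum_distrib_left by (simp only: mult.assoc)
  qed
  have "(1 / e) ^ Suc i = 1 / e * (\<Sum>j<?N. h i j * e ^ j)" using Suc by (simp add: h_def)
  also have "(\<Sum>j<?N. h i j * e ^ j) = h i 0 + e * (\<Sum>j<n. h i (Suc j) * e ^ j)"
    unfolding n by (subst sum.lessThan_Suc_shift) (simp add: sum_distrib_left mult_ac)
  also have "(\<Sum>j<n. h i (Suc j) * e ^ j) = (\<Sum>j<?N. h i (Suc j) * e ^ j)"
    using descent_poly_high[of \<rho> "Suc n" i] n by (simp add: h_def)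
  also have "1 / e * (h i 0 + e * (\<Sum>j<?N. h i (Suc j) * e ^ j)) = h i 0 * (1 / e) + (\<Sum>j<?N. h i (Suc j) * e ^ j)"
    using e by (simp add: field_simps)
  also have "\<dots> = (\<Sum>j<?N. h (Suc i) j * e ^ j)"
    unfolding inv sum_distrib_left sum.distrib[symmetric]
    by (intro sum.cong) (auto simp: h_def algebra_simps)
  finally show ?case by (simp add: h_def)
qed

lemma tendsto_power_div:
  fixes \<theta> :: real
  assumes "0 \<le> \<theta>" "\<theta> < 1" "0 < N" shows "(\<lambda>i. \<theta> ^ (i div N)) \<longlonglongrightarrow> 0"
proof -
  have "filterlim (\<lambda>i. i div N) at_top sequentially"
    unfolding filterlim_at_top
  proof
    fix Z
    show "\<forall>\<^sub>F i in sequentially. Z \<le> i div N"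
      using assms(3) by (intro eventually_sequentiallyI[of "Z * N"]) (auto simp: less_eq_div_iff_mult_less_eq)
  qed
  with LIMSEQ_power_zero[of \<theta>] assms show ?thesis
    by (auto intro: filterlim_compose[of "\<lambda>i. \<theta> ^ i"])
qed

text \<open>
  If a power series in \<open>1 / e\<close> has the same value \<open>Y\<close> at \<open>degree \<rho>\<close> many solutions \<open>e\<close> of
  \<open>\<rho>(e) = E\<close>, then \<open>Y\<close> is a power series in \<open>s = 1 / E\<close>. Expanding the powers of \<open>1 / e\<close> by
  \<open>inverse_power_descent_poly\<close> turns the series into a polynomial in \<open>e\<close> of degree less than
  \<open>degree \<rho>\<close> with coefficients \<open>H j\<close> that depend on \<open>E\<close> only. It takes the value \<open>Y\<close> too often not
  to be constant, so \<open>Y = H 0\<close>. The coefficients \<open>b\<close> are independent of \<open>E\<close>, \<open>S\<close> and \<open>Y\<close>.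
\<close>

lemma power_series_descent:
  fixes a :: "nat \<Rightarrow> 'c::nonarch_complete_field"
  assumes a: "a 0 = 0" "gauss_bounded r a M" "0 < r"
    and \<rho>: "Polynomial.coeff \<rho> 0 = 0" "0 < degree \<rho>"
  obtains b s where "b 0 = 0" "0 < s" "gauss_bounded s b M"
    "\<And>E S Y. E \<noteq> 0 \<Longrightarrow> absval (1 / E) < s \<Longrightarrow> finite S \<Longrightarrow> degree \<rho> \<le> card S \<Longrightarrow>
       (\<And>e. e \<in> S \<Longrightarrow> poly \<rho> e = E \<and> (\<lambda>i. a i * (1 / e) ^ i) sums Y) \<Longrightarrow>
       (\<lambda>i. b i * (1 / E) ^ i) sums Y"
proof -
  let ?N = "degree \<rho>"
  define r1 where "r1 = min r 1"
  have r1: "0 < r1" "r1 \<le> 1" "gauss_bounded r1 a M"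
    using a by (auto simp: r1_def intro: gauss_bounded_antimono)
  have M0: "0 \<le> M" using a gauss_bounded_nonneg by blast
  define C where "C = max 1 (\<Sum>i\<le>?N. absval (Polynomial.coeff \<rho> i))"
  have C: "1 \<le> C" "absval (Polynomial.coeff \<rho> i) \<le> C" for i
  proof -
    show "absval (Polynomial.coeff \<rho> i) \<le> C"
    proof (cases "i \<le> ?N")
      case True
      then have "absval (Polynomial.coeff \<rho> i) \<le> (\<Sum>i\<le>?N. absval (Polynomial.coeff \<rho> i))"
        by (intro member_le_sum) auto
      then show ?thesis by (simp add: C_def)
    qed (simp add: coeff_eq_0 C_def)
  qed (simp add: C_def)
  \<comment> \<open>The coefficient of \<open>s ^ m\<close> in the \<open>i\<close>-th polynomial is at most \<open>C ^ m\<close> and vanishes unless \<open>i \<le> ?N * m\<close>, where \<open>\<bar>a i\<bar> \<le> M / r1 ^ (?N * m)\<close> as \<open>r1 \<le> 1\<close>.\<close>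
  define s where "s = r1 ^ ?N / C"
  have s: "0 < s" using r1 C by (simp add: s_def)
  let ?h = "\<lambda>i j. descent_poly \<rho> i j"
  have bound: "absval (a i * Polynomial.coeff (?h i j) m) * s ^ m \<le> M" for i j m
  proof (cases "Polynomial.coeff (?h i j) m = 0")
    case False
    then have im: "i \<le> ?N * m" using coeff_descent_poly_0[OF _ \<rho>(2)] by fastforce
    have "absval (a i * Polynomial.coeff (?h i j) m) * s ^ m
        = absval (a i) * (absval (Polynomial.coeff (?h i j) m) / C ^ m) * r1 ^ (?N * m)"
      by (simp add: absval_mult s_def power_divide power_mult)
    also have "\<dots> \<le> absval (a i) * 1 * r1 ^ i"
      using absval_coeff_descent_poly[of \<rho> C i j m] C r1 im
      by (intro mult_mono power_decreasing) (auto simp: divide_le_eq_1 zero_less_power)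
    also have "\<dots> \<le> M" using r1 by (simp add: gauss_bounded_def)
    finally show ?thesis .
  qed (use M0 in simp)
  define b where "b m = (\<Sum>i\<le>?N * m. a i * Polynomial.coeff (?h i 0) m)" for m
  show ?thesis
  proof
    show "b 0 = 0" using a by (simp add: b_def)
    show "0 < s" by fact
    show "gauss_bounded s b M"
      unfolding gauss_bounded_def
    proof
      fix m
      have "absval (b m) \<le> M / s ^ m"
        unfolding b_def using bound s M0 by (intro absval_sum_le) (auto simp: pos_le_divide_eq)
      then show "absval (b m) * s ^ m \<le> M" using s by (simp add: pos_le_divide_eq)
    qed
    fix E Y :: 'c and S
    assume E: "E \<noteq> 0" "absval (1 / E) < s" and S: "finite S" "?N \<le> card S"
      "\<And>e. e \<in> S \<Longrightarrow> poly \<rho> e = E \<and> (\<lambda>i. a i * (1 / e) ^ i) sums Y"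
    define \<theta> where "\<theta> = absval (1 / E) / s"
    have \<theta>: "0 \<le> \<theta>" "\<theta> < 1" using E s by (auto simp: \<theta>_def)
    have term_le: "absval (a i * Polynomial.coeff (?h i j) m * (1 / E) ^ m) \<le> M * \<theta> ^ m" for i j m
      unfolding \<theta>_def using bound s
      by (intro gauss_bounded_term[of s "\<lambda>m. a i * Polynomial.coeff (?h i j) m" for i j])
        (auto simp: gauss_bounded_def)
    have "summable (\<lambda>i. a i * poly (?h i j) (1 / E))" for j
    proof (rule nonarch_summable_comparison)
      show "(\<lambda>i. M * \<theta> ^ (i div ?N)) \<longlonglongrightarrow> 0"
        by (intro tendsto_mult_right_zero tendsto_power_div \<theta> \<rho>)
      fix i
      have "a i * poly (?h i j) (1 / E) = (\<Sum>m\<le>degree (?h i j). a i * Polynomial.coeff (?h i j) m * (1 / E) ^ m)"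
        by (simp add: poly_altdef sum_distrib_left mult.assoc)
      also have "absval \<dots> \<le> M * \<theta> ^ (i div ?N)"
      proof (rule absval_sum_le)
        fix m
        show "absval (a i * Polynomial.coeff (?h i j) m * (1 / E) ^ m) \<le> M * \<theta> ^ (i div ?N)"
        proof (cases "Polynomial.coeff (?h i j) m = 0")
          case False
          then have "i \<le> ?N * m" using coeff_descent_poly_0[OF _ \<rho>(2)] by fastforce
          then have "i div ?N \<le> m" using \<rho>(2) by (metis div_le_mono nonzero_mult_div_cancel_left less_irrefl)
          then have "\<theta> ^ m \<le> \<theta> ^ (i div ?N)" using \<theta> by (intro power_decreasing) auto
          then have "M * \<theta> ^ m \<le> M * \<theta> ^ (i div ?N)" using M0 by (rule mult_left_mono)
          then show ?thesis using term_le[of i j m] by linarith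
        qed (use M0 \<theta> in simp)
      qed (use M0 \<theta> in simp)
      finally show "absval (a i * poly (?h i j) (1 / E)) \<le> M * \<theta> ^ (i div ?N)" .
    qed
    then obtain H where H: "\<And>j. (\<lambda>i. a i * poly (?h i j) (1 / E)) sums H j"
      unfolding summable_def by metis
    define Q where "Q = (\<Sum>j<?N. monom (H j) j) - [:Y:]"
    have "poly Q e = 0" if "e \<in> S" for e
    proof -
      have e: "poly \<rho> e = E" "(\<lambda>i. a i * (1 / e) ^ i) sums Y" using S that by auto
      have "(\<lambda>i. \<Sum>j<?N. e ^ j * (a i * poly (?h i j) (1 / E))) sums (\<Sum>j<?N. e ^ j * H j)"
        by (intro sums_sum nonarch_sums_mult H)
      moreover have "(\<Sum>j<?N. e ^ j * (a i * poly (?h i j) (1 / E))) = a i * (1 / e) ^ i" for i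
        using inverse_power_descent_poly[OF \<rho>, of e i] E(1) unfolding e(1)
        by (simp add: sum_distrib_left mult_ac)
      ultimately have "(\<Sum>j<?N. e ^ j * H j) = Y" using e(2) by (simp add: sums_unique2)
      then show ?thesis by (simp add: Q_def poly_sum poly_monom mult.commute)
    qed
    moreover have "degree Q < ?N"
      unfolding Q_def using \<rho>(2)
      by (intro degree_diff_less degree_sum_less) (auto intro: le_less_trans[OF degree_monom_le])
    ultimately have "Q = 0"
      using S(1,2) by (intro poly_eqI_degree[of S Q 0]) auto
    then have "Polynomial.coeff Q 0 = 0" by simp
    then have "H 0 = Y"
      using \<rho>(2) by (simp add: Q_def coeff_sum sum.delta)
    have "(\<lambda>m. \<Sum>i\<le>?N * m. a i * Polynomial.coeff (?h i 0) m * (1 / E) ^ m) sums Y"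
    proof (rule nonarch_sums_swap)
      show "a i * Polynomial.coeff (?h i 0) m * (1 / E) ^ m = 0" if "?N * m < i" for i m
        using coeff_descent_poly_0[of \<rho> i 0 m] \<rho>(2) that by fastforce
      show "(\<lambda>m. a i * Polynomial.coeff (?h i 0) m * (1 / E) ^ m) sums (a i * poly (?h i 0) (1 / E))" for i
        using nonarch_sums_mult[OF sums_poly[of "?h i 0" "1 / E"], of "a i"] by (simp only: mult.assoc)
      show "(\<lambda>i. a i * poly (?h i 0) (1 / E)) sums Y" using H[of 0] \<open>H 0 = Y\<close> by simp
    qed (use term_le \<theta> \<rho> in auto)
    then show "(\<lambda>i. b i * (1 / E) ^ i) sums Y"
      by (simp add: b_def sum_distrib_right)
  qed
qed

section \<open>Imaginary part and rigid holomorphic functions\<close>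

context drinfeld
begin

lemma imag_part_affine_ge:
  assumes "\<alpha> \<in> range \<iota>" "\<beta> \<in> range \<iota>" "\<alpha> \<noteq> 0"
  shows "absval \<alpha> * imag_part z \<le> imag_part (\<alpha> * z + \<beta>)"
proof -
  obtain a b where ab: "\<alpha> = \<iota> a" "\<beta> = \<iota> b" using assms by blast
  have "absval \<alpha> * imag_part z \<le> dist (\<alpha> * z + \<beta>) (\<iota> x)" for x
  proof -
    have "\<alpha> * z + \<beta> - \<iota> x = \<alpha> * (z - \<iota> ((x - b) / a))"
      using assms(3) ab by (simp add: field_simps)
    then have "dist (\<alpha> * z + \<beta>) (\<iota> x) = absval \<alpha> * dist z (\<iota> ((x - b) / a))"
      by (simp only: nonarch_dist[of "\<alpha> * z + \<beta>"] nonarch_dist[of z "\<iota> ((x - b) / a)"] absval_mult)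
    moreover have "imag_part z \<le> dist z (\<iota> ((x - b) / a))" by (rule infdist_le) (rule rangeI)
    ultimately show ?thesis by (simp add: mult_left_mono)
  qed
  then show ?thesis
    unfolding infdist_def[of "\<alpha> * z + \<beta>"] by (auto intro!: cINF_greatest)
qed

lemma imag_part_affine:
  assumes "\<alpha> \<in> range \<iota>" "\<beta> \<in> range \<iota>" "\<alpha> \<noteq> 0"
  shows "imag_part (\<alpha> * z + \<beta>) = absval \<alpha> * imag_part z"
proof (rule antisym)
  obtain a b where ab: "\<alpha> = \<iota> a" "\<beta> = \<iota> b" using assms by blast
  have "absval (inverse \<alpha>) * imag_part (\<alpha> * z + \<beta>)
      \<le> imag_part (inverse \<alpha> * (\<alpha> * z + \<beta>) + (- \<beta> / \<alpha>))"
  proof (rule imag_part_affine_ge)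
    show "inverse \<alpha> \<in> range \<iota>" "- \<beta> / \<alpha> \<in> range \<iota>"
      unfolding ab by (simp_all add: inverse_eq_divide flip: iota_hom(1) iota_divide iota_minus)
  qed (use assms in simp)
  also have "inverse \<alpha> * (\<alpha> * z + \<beta>) + (- \<beta> / \<alpha>) = z" using assms(3) by (simp add: field_simps)
  finally have "absval \<alpha> * (absval (inverse \<alpha>) * imag_part (\<alpha> * z + \<beta>)) \<le> absval \<alpha> * imag_part z"
    by (rule mult_left_mono) simp
  then show "imag_part (\<alpha> * z + \<beta>) \<le> absval \<alpha> * imag_part z"
    using assms(3) unfolding absval_inverse mult.assoc[symmetric] by simp
qed (rule imag_part_affine_ge[OF assms])

lemma imag_part_divide: "N \<noteq> 0 \<Longrightarrow> imag_part (z / emb N) = imag_part z / absval (emb N)"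
  using imag_part_affine[of "1 / emb N" 0 z] emb_divide_in_range[of 1 N] emb_in_range[of 0]
  by (simp add: absval_divide del: emb_divide_in_range emb_in_range)

lemma emb_mult_in_range: "emb a * emb b \<in> range \<iota>"
  unfolding emb_hom(4)[symmetric] by (rule emb_in_range)

lemma imag_part_pos_Omega: "0 < imag_part z \<Longrightarrow> z \<in> Omega \<iota>"
  by (auto simp: Omega_def)

lemma uniform_limit_nonarch_add:
  fixes f g :: "nat \<Rightarrow> 'a \<Rightarrow> 'c"
  assumes "uniform_limit S f l sequentially" "uniform_limit S g m sequentially"
  shows "uniform_limit S (\<lambda>n x. f n x + g n x) (\<lambda>x. l x + m x) sequentially"
proof (rule uniform_limitI)
  fix e :: real assume "0 < e"
  have "\<forall>\<^sub>F n in sequentially. \<forall>x\<in>S. dist (f n x) (l x) < e"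
    "\<forall>\<^sub>F n in sequentially. \<forall>x\<in>S. dist (g n x) (m x) < e"
    using assms \<open>0 < e\<close> by (auto dest: uniform_limitD)
  then show "\<forall>\<^sub>F n in sequentially. \<forall>x\<in>S. dist (f n x + g n x) (l x + m x) < e"
  proof eventually_elim
    case (elim n)
    show ?case
    proof
      fix x assume x: "x \<in> S"
      have "dist (f n x + g n x) (l x + m x) = absval ((f n x - l x) + (g n x - m x))"
        unfolding nonarch_dist[of "f n x + g n x"] by (simp add: algebra_simps)
      moreover have "absval (f n x - l x) < e" "absval (g n x - m x) < e"
        using elim x by (auto simp flip: nonarch_dist)
      ultimately show "dist (f n x + g n x) (l x + m x) < e"
        using absval_add[of "f n x - l x" "g n x - m x"] by simp
    qed
  qed
qed

lemma rigid_holomorphic_add: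
  assumes "rigid_holomorphic \<iota> f" "rigid_holomorphic \<iota> g"
  shows "rigid_holomorphic \<iota> (\<lambda>z. f z + g z)"
  unfolding rigid_holomorphic_def
proof
  fix m
  let ?S = "Omega_affinoid \<iota> m"
  obtain p r p' r' :: "nat \<Rightarrow> 'c poly" where
    f: "\<And>i z. z \<in> ?S \<Longrightarrow> poly (r i) z \<noteq> 0" "uniform_limit ?S (\<lambda>i z. poly (p i) z / poly (r i) z) f sequentially" and
    g: "\<And>i z. z \<in> ?S \<Longrightarrow> poly (r' i) z \<noteq> 0" "uniform_limit ?S (\<lambda>i z. poly (p' i) z / poly (r' i) z) g sequentially"
    using assms unfolding rigid_holomorphic_def by meson
  have "uniform_limit ?S (\<lambda>i z. poly (p i * r' i + p' i * r i) z / poly (r i * r' i) z) (\<lambda>z. f z + g z) sequentially"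
    by (rule uniform_limit_cong'[THEN iffD1, OF _ _ uniform_limit_nonarch_add[OF f(2) g(2)]])
      (use f(1) g(1) in \<open>auto simp: add_frac_eq\<close>)
  then show "\<exists>p r. (\<forall>i. \<forall>z\<in>?S. poly (r i) z \<noteq> 0) \<and>
      uniform_limit ?S (\<lambda>i z. poly (p i) z / poly (r i) z) (\<lambda>z. f z + g z) sequentially"
    using f(1) g(1) by (intro exI[of _ "\<lambda>i. p i * r' i + p' i * r i"] exI[of _ "\<lambda>i. r i * r' i"]) auto
qed

lemma Omega_affinoid_subset_Omega: "Omega_affinoid \<iota> m \<subseteq> Omega \<iota>"
proof
  fix z assume "z \<in> Omega_affinoid \<iota> m"
  then have "1 / real CARD('q) ^ m \<le> imag_part z" by (simp add: Omega_affinoid_def)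
  moreover have "0 < 1 / real CARD('q) ^ m" using card_gt_1 by simp
  ultimately show "z \<in> Omega \<iota>" by (intro imag_part_pos_Omega) linarith
qed

text \<open>
  Affine substitutions over \<open>K\<^sub>\<infinity>\<close> scale the imaginary part, so they map each affinoid of the
  exhaustion into a later one.
\<close>

lemma Omega_affinoid_affine:
  assumes "\<alpha> \<in> range \<iota>" "\<beta> \<in> range \<iota>" "\<alpha> \<noteq> 0"
  obtains m' where "\<And>z. z \<in> Omega_affinoid \<iota> m \<Longrightarrow> \<alpha> * z + \<beta> \<in> Omega_affinoid \<iota> m'"
proof -
  let ?q = "real CARD('q)"
  have q: "1 < ?q" "0 < ?q ^ i" for i using card_gt_1 by simp_all
  obtain m' where m': "max (absval \<alpha> * ?q ^ m) (max (absval \<beta>) (?q ^ m / absval \<alpha>)) < ?q ^ m'"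
    using real_arch_pow[OF q(1)] by blast
  have "\<alpha> * z + \<beta> \<in> Omega_affinoid \<iota> m'" if z: "z \<in> Omega_affinoid \<iota> m" for z
  proof -
    have z1: "absval z \<le> ?q ^ m" and z2: "1 / ?q ^ m \<le> imag_part z"
      using z by (auto simp: Omega_affinoid_def)
    have "absval (\<alpha> * z) \<le> absval \<alpha> * ?q ^ m" using z1 by (simp add: absval_mult mult_left_mono)
    then have "absval (\<alpha> * z + \<beta>) \<le> ?q ^ m'" using absval_add[of "\<alpha> * z" \<beta>] m' by linarith
    moreover have "1 / ?q ^ m' \<le> absval \<alpha> * (1 / ?q ^ m)"
      using m' assms(3) q by (simp add: field_simps)
    then have "1 / ?q ^ m' \<le> absval \<alpha> * imag_part z"
      using z2 mult_left_mono[of "1 / ?q ^ m" "imag_part z" "absval \<alpha>"] by simp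
    ultimately show ?thesis by (simp add: Omega_affinoid_def imag_part_affine assms)
  qed
  then show ?thesis using that by blast
qed

lemma rigid_holomorphic_affine:
  assumes f: "rigid_holomorphic \<iota> f" and \<alpha>: "\<alpha> \<in> range \<iota>" "\<beta> \<in> range \<iota>" "\<alpha> \<noteq> 0"
    and g: "\<And>z. z \<in> Omega \<iota> \<Longrightarrow> g z = \<kappa> * f (\<alpha> * z + \<beta>)"
  shows "rigid_holomorphic \<iota> g"
  unfolding rigid_holomorphic_def
proof
  fix m
  let ?S = "Omega_affinoid \<iota> m"
  obtain m' where m': "\<And>z. z \<in> ?S \<Longrightarrow> \<alpha> * z + \<beta> \<in> Omega_affinoid \<iota> m'"
    using Omega_affinoid_affine[OF \<alpha>] by blast
  obtain p r :: "nat \<Rightarrow> 'c poly" where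
    pr: "\<And>i z. z \<in> Omega_affinoid \<iota> m' \<Longrightarrow> poly (r i) z \<noteq> 0"
      "uniform_limit (Omega_affinoid \<iota> m') (\<lambda>i z. poly (p i) z / poly (r i) z) f sequentially"
    using f unfolding rigid_holomorphic_def by meson
  let ?P = "\<lambda>i. smult \<kappa> (pcompose (p i) [:\<beta>, \<alpha>:])" and ?R = "\<lambda>i. pcompose (r i) [:\<beta>, \<alpha>:]"
  have "uniform_limit ?S (\<lambda>i z. poly (?P i) z / poly (?R i) z) g sequentially"
  proof (rule uniform_limitI)
    fix e :: real assume e: "0 < e"
    define e' where "e' = e / (absval \<kappa> + 1)"
    have pos: "0 < absval \<kappa> + 1" by (simp add: add_nonneg_pos)
    have "0 < e'" using e pos by (simp add: e'_def)
    with pr(2) have "\<forall>\<^sub>F n in sequentially. \<forall>x\<in>Omega_affinoid \<iota> m'. dist (poly (p n) x / poly (r n) x) (f x) < e'"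
      by (rule uniform_limitD)
    then show "\<forall>\<^sub>F n in sequentially. \<forall>z\<in>?S. dist (poly (?P n) z / poly (?R n) z) (g z) < e"
    proof eventually_elim
      case (elim n)
      show ?case
      proof
        fix z assume z: "z \<in> ?S"
        let ?x = "\<alpha> * z + \<beta>"
        have "poly [:\<beta>, \<alpha>:] z = ?x" by (simp add: mult.commute)
        moreover have "g z = \<kappa> * f ?x" using g z Omega_affinoid_subset_Omega by blast
        ultimately have "poly (?P n) z / poly (?R n) z - g z = \<kappa> * (poly (p n) ?x / poly (r n) ?x - f ?x)"
          by (simp only: poly_pcompose poly_smult right_diff_distrib times_divide_eq_right)
        then have "dist (poly (?P n) z / poly (?R n) z) (g z)
            = absval \<kappa> * dist (poly (p n) ?x / poly (r n) ?x) (f ?x)"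
          by (simp only: nonarch_dist[of _ "g z"] nonarch_dist[of _ "f ?x"] absval_mult)
        also have "\<dots> \<le> absval \<kappa> * e'" using elim m'[OF z] by (intro mult_left_mono) (auto intro: less_imp_le)
        also have "\<dots> < e" using e pos by (simp add: e'_def field_simps)
        finally show "dist (poly (?P n) z / poly (?R n) z) (g z) < e" .
      qed
    qed
  qed
  then show "\<exists>p r. (\<forall>i. \<forall>z\<in>?S. poly (r i) z \<noteq> 0) \<and>
      uniform_limit ?S (\<lambda>i z. poly (p i) z / poly (r i) z) g sequentially"
    using pr(1) m' by (intro exI[of _ ?P] exI[of _ ?R]) (auto simp: poly_pcompose algebra_simps)
qed

lemma rigid_holomorphic_0: "rigid_holomorphic \<iota> (\<lambda>_. 0)"
  unfolding rigid_holomorphic_def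
  by (intro allI exI[of _ "\<lambda>_. 0"] exI[of _ "\<lambda>_. 1"]) (auto intro: uniform_limit_const)

lemma rigid_holomorphic_cmult: "rigid_holomorphic \<iota> f \<Longrightarrow> rigid_holomorphic \<iota> (\<lambda>z. c * f z)"
  using rigid_holomorphic_affine[of f 1 0 "\<lambda>z. c * f z" c] emb_in_range[of 0] emb_in_range[of 1]
  by (simp del: emb_in_range)

lemma rigid_holomorphic_sum:
  "(\<And>i. i \<in> I \<Longrightarrow> rigid_holomorphic \<iota> (f i)) \<Longrightarrow> rigid_holomorphic \<iota> (\<lambda>z. \<Sum>i\<in>I. f i z)"
  by (induction I rule: infinite_finite_induct) (auto intro: rigid_holomorphic_0 rigid_holomorphic_add)

end

section \<open>Expansions at the cusps\<close>

context carlitz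
begin

text \<open>
  A bound for the coefficients is part of the definition, since manipulating the series needs it;
  \<open>vanishes_at_infinity_iff\<close> shows that it comes for free. The series is indexed from \<open>0\<close> with
  \<open>a 0 = 0\<close>, and membership in \<open>\<Omega>\<close> is left to the condition on the imaginary part.
\<close>

definition cusp_expansion :: "'q poly \<Rightarrow> ('c \<Rightarrow> 'c) \<Rightarrow> bool" where
  "cusp_expansion N f \<longleftrightarrow> (\<exists>a r M R. a 0 = 0 \<and> 0 < r \<and> gauss_bounded r a M \<and>
     (\<forall>z. R < imag_part z \<longrightarrow> (\<lambda>i. a i * (1 / scaled_exp (z / emb N)) ^ i) sums f z))"

lemma scaled_exp_nonzero: "N \<noteq> 0 \<Longrightarrow> 0 < imag_part z \<Longrightarrow> scaled_exp (z / emb N) \<noteq> 0"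
  using absval_scaled_exp_ge_imag[of "z / emb N"]
  by (auto simp: imag_part_divide divide_le_0_iff mult_le_0_iff)

lemma cusp_parameter_small:
  assumes "N \<noteq> 0" "0 < \<epsilon>"
  obtains R where "0 \<le> R" "\<And>z. R < imag_part z \<Longrightarrow> scaled_exp (z / emb N) \<noteq> 0 \<and> absval (1 / scaled_exp (z / emb N)) < \<epsilon>"
proof
  define R where "R = absval (emb N) / (absval \<pi> * \<epsilon>)"
  show "0 \<le> R" using assms by (simp add: R_def)
  fix z assume z: "R < imag_part z"
  have nz: "scaled_exp (z / emb N) \<noteq> 0" using z \<open>0 \<le> R\<close> assms by (intro scaled_exp_nonzero) auto
  have "1 / \<epsilon> < absval \<pi> * imag_part (z / emb N)"
    using z assms by (simp add: R_def imag_part_divide field_simps)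
  also have "\<dots> \<le> absval (scaled_exp (z / emb N))" by (rule absval_scaled_exp_ge_imag)
  finally have "1 / \<epsilon> < absval (scaled_exp (z / emb N))" .
  then show "scaled_exp (z / emb N) \<noteq> 0 \<and> absval (1 / scaled_exp (z / emb N)) < \<epsilon>"
    using nz assms by (simp add: absval_divide field_simps)
qed

text \<open>
  Convergence at one point with \<open>t \<noteq> 0\<close> bounds the Gauss norm of radius \<open>\<bar>t\<bar>\<close>. If there is no point
  of large imaginary part, both sides hold trivially.
\<close>

lemma vanishes_at_infinity_iff:
  assumes "N \<noteq> 0" shows "vanishes_at_infinity \<iota> \<pi> N f \<longleftrightarrow> cusp_expansion N f"
proof
  assume "vanishes_at_infinity \<iota> \<pi> N f"
  then obtain a R where aR: "\<And>z. z \<in> Omega \<iota> \<Longrightarrow> R < imag_part z \<Longrightarrow>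
      (\<lambda>i. a (Suc i) * (1 / scaled_exp (z / emb N)) ^ Suc i) sums f z"
    unfolding vanishes_at_infinity_def cusp_parameter_def scaled_exp_def by blast
  define a' where "a' i = (if i = 0 then 0 else a i)" for i
  have sums: "(\<lambda>i. a' i * (1 / scaled_exp (z / emb N)) ^ i) sums f z" if "max 0 R < imag_part z" for z
  proof -
    have "(\<lambda>i. a' (Suc i) * (1 / scaled_exp (z / emb N)) ^ Suc i) sums f z"
      using aR[of z] imag_part_pos_Omega[of z] that by (simp add: a'_def)
    from sums_Suc[OF this] show ?thesis by (simp add: a'_def)
  qed
  show "cusp_expansion N f"
  proof (cases "\<exists>z. max 0 R < imag_part z")
    case True
    then obtain z where z: "max 0 R < imag_part z" by blast
    define t where "t = 1 / scaled_exp (z / emb N)"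
    have t: "t \<noteq> 0" using scaled_exp_nonzero[OF assms, of z] z by (simp add: t_def)
    have "(\<lambda>i. a' i * t ^ i) \<longlonglongrightarrow> 0"
      using nonarch_sums_terms_0[OF sums[OF z]] by (simp add: t_def)
    then have "(\<lambda>i. absval (a' i * t ^ i)) \<longlonglongrightarrow> 0" by (simp add: tendsto_absval_0_iff)
    then have "Bseq (\<lambda>i. absval (a' i * t ^ i))" by (rule convergent_imp_Bseq[OF convergentI])
    then obtain M where "\<And>i. norm (absval (a' i * t ^ i)) \<le> M" by (auto simp: Bseq_def)
    then have "gauss_bounded (absval t) a' M" by (simp add: gauss_bounded_def absval_mult absval_power)
    then show ?thesis unfolding cusp_expansion_def using sums t
      by (intro exI[of _ a'] exI[of _ "absval t"] exI[of _ M] exI[of _ "max 0 R"]) (auto simp: a'_def)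
  next
    case False
    then show ?thesis unfolding cusp_expansion_def
      by (intro exI[of _ "\<lambda>_. 0"] exI[of _ 1] exI[of _ 0] exI[of _ "max 0 R"]) (auto simp: gauss_bounded_def)
  qed
next
  assume "cusp_expansion N f"
  then obtain a R where aR: "a 0 = 0" "\<And>z. R < imag_part z \<Longrightarrow> (\<lambda>i. a i * (1 / scaled_exp (z / emb N)) ^ i) sums f z"
    unfolding cusp_expansion_def by blast
  have "(\<lambda>i. a (Suc i) * (1 / scaled_exp (z / emb N)) ^ Suc i) sums f z" if "R < imag_part z" for z
  proof -
    let ?f = "\<lambda>i. a i * (1 / scaled_exp (z / emb N)) ^ i"
    have "(\<lambda>n. sum ?f {..<Suc n}) \<longlonglongrightarrow> f z"
      using aR(2)[OF that] unfolding sums_def by (rule LIMSEQ_Suc)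
    then show ?thesis
      unfolding sums_def sum.lessThan_Suc_shift using aR(1) by simp
  qed
  then show "vanishes_at_infinity \<iota> \<pi> N f"
    unfolding vanishes_at_infinity_def cusp_parameter_def scaled_exp_def[symmetric] by blast
qed

lemma cusp_expansion_add:
  assumes "cusp_expansion N f" "cusp_expansion N g" shows "cusp_expansion N (\<lambda>z. f z + g z)"
proof -
  obtain a r M R where f: "a 0 = 0" "0 < r" "gauss_bounded r a M"
    "\<And>z. R < imag_part z \<Longrightarrow> (\<lambda>i. a i * (1 / scaled_exp (z / emb N)) ^ i) sums f z"
    using assms(1) unfolding cusp_expansion_def by blast
  obtain b s M' R' where g: "b 0 = 0" "0 < s" "gauss_bounded s b M'"
    "\<And>z. R' < imag_part z \<Longrightarrow> (\<lambda>i. b i * (1 / scaled_exp (z / emb N)) ^ i) sums g z"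
    using assms(2) unfolding cusp_expansion_def by blast
  let ?r = "min r s"
  have "gauss_bounded ?r a M" "gauss_bounded ?r b M'"
    using f g by (auto intro: gauss_bounded_antimono)
  then have "gauss_bounded ?r (\<lambda>i. a i + b i) (max M M')"
    unfolding gauss_bounded_def
  proof (intro allI)
    fix i
    assume *: "\<forall>i. absval (a i) * ?r ^ i \<le> M" "\<forall>i. absval (b i) * ?r ^ i \<le> M'"
    have "absval (a i + b i) * ?r ^ i \<le> max (absval (a i)) (absval (b i)) * ?r ^ i"
      using f g by (intro mult_right_mono absval_add) auto
    also have "\<dots> = max (absval (a i) * ?r ^ i) (absval (b i) * ?r ^ i)"
      using f g by (simp add: max_mult_distrib_right)
    also have "\<dots> \<le> max M M'" using * by (intro max.mono) auto
    finally show "absval (a i + b i) * ?r ^ i \<le> max M M'" .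
  qed
  moreover have "(\<lambda>i. (a i + b i) * (1 / scaled_exp (z / emb N)) ^ i) sums (f z + g z)"
    if "max R R' < imag_part z" for z
    unfolding distrib_right using that by (intro sums_add f g) auto
  ultimately show ?thesis unfolding cusp_expansion_def using f g
    by (intro exI[of _ "\<lambda>i. a i + b i"] exI[of _ ?r] exI[of _ "max M M'"] exI[of _ "max R R'"]) auto
qed

lemma cusp_expansion_cmult:
  assumes "cusp_expansion N f" shows "cusp_expansion N (\<lambda>z. c * f z)"
proof -
  obtain a r M R where f: "a 0 = 0" "0 < r" "gauss_bounded r a M"
    "\<And>z. R < imag_part z \<Longrightarrow> (\<lambda>i. a i * (1 / scaled_exp (z / emb N)) ^ i) sums f z"
    using assms(1) unfolding cusp_expansion_def by blast
  have "gauss_bounded r (\<lambda>i. c * a i) (absval c * M)"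
    using f(3) by (auto simp: gauss_bounded_def absval_mult mult.assoc intro: mult_left_mono)
  moreover have "(\<lambda>i. c * a i * (1 / scaled_exp (z / emb N)) ^ i) sums (c * f z)"
    if "R < imag_part z" for z
    unfolding mult.assoc using that by (intro nonarch_sums_mult f)
  ultimately show ?thesis unfolding cusp_expansion_def using f
    by (intro exI[of _ "\<lambda>i. c * a i"] exI[of _ r] exI[of _ "absval c * M"] exI[of _ R]) auto
qed

lemma cusp_expansion_0: "cusp_expansion N (\<lambda>_. 0)"
  unfolding cusp_expansion_def
  by (intro exI[of _ "\<lambda>_. 0"] exI[of _ 1] exI[of _ 0] exI[of _ 0]) (auto simp: gauss_bounded_def)

lemma cusp_expansion_sum:
  "(\<And>i. i \<in> I \<Longrightarrow> cusp_expansion N (f i)) \<Longrightarrow> cusp_expansion N (\<lambda>z. \<Sum>i\<in>I. f i z)"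
  by (induction I rule: infinite_finite_induct) (auto intro: cusp_expansion_0 cusp_expansion_add)

text \<open>
  In terms of \<open>y = z / (N M)\<close> the substituted argument is \<open>\<kappa> y\<close> plus a constant, where
  \<open>\<kappa> = a M / d\<close> is a polynomial. So \<open>1 / u\<close> of the new argument is a polynomial in \<open>1 / u(y)\<close>, and
  \<open>power_series_substitution\<close> applies.
\<close>

lemma cusp_expansion_affine:
  assumes f: "cusp_expansion N f" and nz: "N \<noteq> 0" "M \<noteq> 0" "a \<noteq> 0" "d \<noteq> 0" and dvd: "d dvd a * M"
  shows "cusp_expansion (N * M) (\<lambda>z. f ((emb a * z + emb b) / emb d))"
proof -
  obtain c r B R where c: "c 0 = 0" "gauss_bounded r c B" "0 < r"
    "\<And>z. R < imag_part z \<Longrightarrow> (\<lambda>i. c i * (1 / scaled_exp (z / emb N)) ^ i) sums f z"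
    using f unfolding cusp_expansion_def by blast
  obtain \<kappa> where \<kappa>: "a * M = d * \<kappa>" using dvd by blast
  have \<kappa>0: "\<kappa> \<noteq> 0" using \<kappa> nz by auto
  obtain \<rho> where \<rho>: "degree \<rho> = CARD('q) ^ degree \<kappa>"
    "\<And>z. scaled_exp (emb \<kappa> * z) = poly \<rho> (scaled_exp z)"
    using ex_carlitz_poly[OF \<kappa>0] by blast
  define G where "G = \<rho> + [:scaled_exp (emb b / emb (d * N)):]"
  have pos: "0 < CARD('q) ^ degree \<kappa>" using card_gt_1 by simp
  then have G: "0 < degree G" unfolding G_def using \<rho>(1) by (subst degree_add_eq_left) auto
  obtain c' r' where c': "c' 0 = 0" "0 < r'" "gauss_bounded r' c' B"
    "\<And>t Y. t \<noteq> 0 \<Longrightarrow> absval t < r' \<Longrightarrow> (\<lambda>i. c i * (1 / poly G (1 / t)) ^ i) sums Y \<Longrightarrow>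
       (\<lambda>i. c' i * t ^ i) sums Y"
    by (rule power_series_substitution[OF c(1-3) G]) blast
  have NM: "N * M \<noteq> 0" using nz by simp
  obtain R1 where R1: "0 \<le> R1" "\<And>z. R1 < imag_part z \<Longrightarrow>
      scaled_exp (z / emb (N * M)) \<noteq> 0 \<and> absval (1 / scaled_exp (z / emb (N * M))) < r'"
    using cusp_parameter_small[OF NM c'(2)] by blast
  define R2 where "R2 = max R1 (R * (absval (emb d) / absval (emb a)))"
  have "(\<lambda>i. c' i * (1 / scaled_exp (z / emb (N * M))) ^ i) sums f ((emb a * z + emb b) / emb d)"
    if z: "R2 < imag_part z" for z
  proof (rule c'(4))
    let ?t = "1 / scaled_exp (z / emb (N * M))" and ?z = "(emb a * z + emb b) / emb d"
    show "?t \<noteq> 0" "absval ?t < r'" using R1(2)[of z] z by (auto simp: R2_def)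
    have z_eq: "?z = emb a / emb d * z + emb b / emb d" by (simp add: add_divide_distrib)
    have "imag_part ?z = absval (emb a / emb d) * imag_part z"
      unfolding z_eq using nz by (intro imag_part_affine) auto
    moreover have "absval (emb a / emb d) * (R * (absval (emb d) / absval (emb a)))
        < absval (emb a / emb d) * imag_part z"
      using z nz by (intro mult_strict_left_mono) (auto simp: R2_def)
    moreover have "absval (emb a / emb d) * (R * (absval (emb d) / absval (emb a))) = R"
      using nz by (simp add: absval_divide)
    ultimately have "R < imag_part ?z" by linarith
    from c(4)[OF this] have "(\<lambda>i. c i * (1 / scaled_exp (?z / emb N)) ^ i) sums f ?z" .
    moreover have "scaled_exp (?z / emb N) = poly G (1 / ?t)"
    proof -
      have "emb a * emb M = emb d * emb \<kappa>" using arg_cong[OF \<kappa>, of emb] by simp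
      then have "emb a / emb d = emb \<kappa> / emb M" using nz by (simp add: frac_eq_eq mult.commute)
      then have "?z / emb N = emb \<kappa> * (z / emb (N * M)) + emb b / emb (d * N)"
        unfolding z_eq using nz by (simp add: field_simps)
      then have "scaled_exp (?z / emb N) =
          poly \<rho> (scaled_exp (z / emb (N * M))) + scaled_exp (emb b / emb (d * N))"
        by (simp only: scaled_exp_add \<rho>(2))
      then show ?thesis by (simp add: G_def)
    qed
    ultimately show "(\<lambda>i. c i * (1 / poly G (1 / ?t)) ^ i) sums f ?z" by (simp only:)
  qed
  then show ?thesis unfolding cusp_expansion_def using c'
    by (intro exI[of _ c'] exI[of _ r'] exI[of _ B] exI[of _ R2]) auto
qed

text \<open>
  The values of \<open>1 / u(z / (N P))\<close> at the translates \<open>z + N x\<close>, with \<open>x\<close> running over the residues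
  modulo \<open>P\<close>, are \<open>q ^ degree P\<close> different solutions of \<open>\<rho>(e) = 1 / u(z / N)\<close>; they are different
  because the exponential vanishes only on \<open>A\<close>. That is the number required by
  \<open>power_series_descent\<close>.
\<close>

lemma cusp_expansion_descent:
  assumes F: "cusp_expansion (N * P) F" and N: "N \<noteq> 0" and P: "0 < degree P"
    and inv: "\<And>x z. 0 < imag_part z \<Longrightarrow> F (z + emb N * emb x) = F z"
  shows "cusp_expansion N F"
proof -
  obtain a r M R where a: "a 0 = 0" "gauss_bounded r a M" "0 < r"
    "\<And>z. R < imag_part z \<Longrightarrow> (\<lambda>i. a i * (1 / scaled_exp (z / emb (N * P))) ^ i) sums F z"
    using F unfolding cusp_expansion_def by blast
  have P0: "P \<noteq> 0" using P by auto
  obtain \<rho> where \<rho>: "degree \<rho> = CARD('q) ^ degree P" "Polynomial.coeff \<rho> 0 = 0"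
    "\<And>z. scaled_exp (emb P * z) = poly \<rho> (scaled_exp z)"
    using ex_carlitz_poly[OF P0] by blast
  have \<rho>pos: "0 < degree \<rho>" using card_gt_1 \<rho>(1) by simp
  obtain b s where b: "b 0 = 0" "0 < s" "gauss_bounded s b M"
    "\<And>E S Y. E \<noteq> 0 \<Longrightarrow> absval (1 / E) < s \<Longrightarrow> finite S \<Longrightarrow> degree \<rho> \<le> card S \<Longrightarrow>
       (\<And>e. e \<in> S \<Longrightarrow> poly \<rho> e = E \<and> (\<lambda>i. a i * (1 / e) ^ i) sums Y) \<Longrightarrow>
       (\<lambda>i. b i * (1 / E) ^ i) sums Y"
    by (rule power_series_descent[OF a(1-3) \<rho>(2) \<rho>pos]) blast
  obtain R1 where R1: "0 \<le> R1" "\<And>z. R1 < imag_part z \<Longrightarrow>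
      scaled_exp (z / emb N) \<noteq> 0 \<and> absval (1 / scaled_exp (z / emb N)) < s"
    using cusp_parameter_small[OF N b(2)] by blast
  have "(\<lambda>i. b i * (1 / scaled_exp (z / emb N)) ^ i) sums F z" if z: "max R1 R < imag_part z" for z
  proof -
    define e where "e x = scaled_exp ((z + emb N * emb x) / emb (N * P))" for x
    have e_eq: "e x = scaled_exp (z / emb (N * P)) + scaled_exp (emb x / emb P)" for x
      unfolding e_def using N P0 by (simp add: scaled_exp_add[symmetric] add_divide_distrib)
    have inj: "inj_on e (residue_polys P)"
    proof (rule inj_onI)
      fix x y assume xy: "x \<in> residue_polys P" "y \<in> residue_polys P" "e x = e y"
      then have "scaled_exp (emb x / emb P) - scaled_exp (emb y / emb P) = 0" by (simp add: e_eq)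
      then have "scaled_exp (emb (x - y) / emb P) = 0"
        by (simp add: scaled_exp_diff[symmetric] diff_divide_distrib)
      then obtain w where "emb (x - y) / emb P = emb w" using scaled_exp_eq_0_imp by blast
      then have "emb (x - y) = emb (w * P)" using P0 by (simp add: divide_eq_eq del: emb_diff)
      then have "x - y = w * P" by (simp only: emb_eq_iff)
      moreover have "degree (x - y) < degree P"
        using xy by (auto simp: residue_polys_def intro: degree_diff_less)
      ultimately have "x - y = 0"
        by (metis P0 degree_mult_eq less_add_same_cancel2 mult_eq_0_iff not_add_less2)
      then show "x = y" by simp
    qed
    show ?thesis
    proof (rule b(4))
      show "scaled_exp (z / emb N) \<noteq> 0" "absval (1 / scaled_exp (z / emb N)) < s"
        using R1(2)[of z] z by auto
      show "finite (e ` residue_polys P)" by simp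
      show "degree \<rho> \<le> card (e ` residue_polys P)"
        using card_image[OF inj] card_residue_polys[OF P] \<rho>(1) by simp
      fix y assume "y \<in> e ` residue_polys P"
      then obtain x where x: "y = e x" by blast
      have im: "imag_part (z + emb N * emb x) = imag_part z"
        using imag_part_affine[of 1 "emb N * emb x" z] emb_in_range[of 1] emb_mult_in_range[of N x] by simp
      have "poly \<rho> y = scaled_exp (emb P * ((z + emb N * emb x) / emb (N * P)))"
        by (simp only: x e_def \<rho>(3))
      also have "emb P * ((z + emb N * emb x) / emb (N * P)) = z / emb N + emb x"
        using N P0 by (simp add: field_simps)
      finally have "poly \<rho> y = scaled_exp (z / emb N)" by (simp add: scaled_exp_add)
      moreover have "(\<lambda>i. a i * (1 / y) ^ i) sums F (z + emb N * emb x)"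
        unfolding x e_def using z im by (intro a(4)) simp
      then have "(\<lambda>i. a i * (1 / y) ^ i) sums F z" using inv[of z x] z R1(1) by simp
      ultimately show "poly \<rho> y = scaled_exp (z / emb N) \<and> (\<lambda>i. a i * (1 / y) ^ i) sums F z" by simp
    qed
  qed
  then show ?thesis unfolding cusp_expansion_def using b
    by (intro exI[of _ b] exI[of _ s] exI[of _ M] exI[of _ "max R1 R"]) auto
qed

end

section \<open>Integral matrices and their cosets\<close>

text \<open>
  From here on \<open>$\<close> selects matrix entries; sharing it with power series makes terms ambiguous.
\<close>

no_notation fps_nth (infixl \<open>$\<close> 75)

lemma mat2_nth [simp]:
  "mat2 a b c d $ 1 $ 1 = a" "mat2 a b c d $ 1 $ 2 = b"
  "mat2 a b c d $ 2 $ 1 = c" "mat2 a b c d $ 2 $ 2 = d"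
  by (simp_all add: mat2_def)

lemma mat2_eq_iff: "(A :: 'a::zero^2^2) = B \<longleftrightarrow>
    A$1$1 = B$1$1 \<and> A$1$2 = B$1$2 \<and> A$2$1 = B$2$1 \<and> A$2$2 = B$2$2"
  by (auto simp: vec_eq_iff forall_2)

lemma mat2_cases: obtains a b c d where "(A :: 'a::zero^2^2) = mat2 a b c d"
  using that[of "A$1$1" "A$1$2" "A$2$1" "A$2$2"] by (simp add: mat2_eq_iff)

lemma mat2_mult: "mat2 a b c d ** mat2 a' b' c' d' =
    mat2 (a * a' + b * c') (a * b' + b * d') (c * a' + d * c') (c * b' + d * d')"
  for a :: "'a::comm_ring_1"
  by (simp add: mat2_eq_iff matrix_matrix_mult_def sum_2)

lemma mat_1_mat2: "mat 1 = (mat2 1 0 0 1 :: 'a::comm_ring_1^2^2)"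
  by (simp add: mat2_eq_iff mat_def)

lemma det_mat2: "det (mat2 a b c d) = a * d - b * c" for a :: "'a::comm_ring_1"
  by (simp add: det_2)

lemma mat2_eq_mat2_iff [simp]: "mat2 a b c d = mat2 a' b' c' d' \<longleftrightarrow> a = a' \<and> b = b' \<and> c = c' \<and> d = d'"
  by (auto simp: mat2_eq_iff)

lemma invertible_iff_det_unit: "invertible (A :: 'a::comm_ring_1^2^2) \<longleftrightarrow> det A dvd 1"
proof
  assume "invertible A"
  then obtain B where "A ** B = mat 1" by (auto simp: invertible_def)
  then have "det A * det B = 1" by (simp flip: det_mul)
  then show "det A dvd 1" by (metis dvd_triv_left)
next
  assume "det A dvd 1"
  then obtain u where u: "det A * u = 1" by (metis dvdE)
  obtain a b c d where A: "A = mat2 a b c d" by (rule mat2_cases)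
  have u': "(a * d - b * c) * u = 1" using u by (simp add: A det_mat2)
  let ?B = "mat2 (d * u) (- b * u) (- c * u) (a * u)"
  have "A ** ?B = mat 1" "?B ** A = mat 1"
    using u' by (simp_all add: A mat2_mult mat_1_mat2 algebra_simps)
  then show "invertible A" unfolding invertible_def by blast
qed

lemma matrix_mult_right_cancel:
  fixes A B W :: "'a::idom^2^2"
  assumes "A ** W = B ** W" "det W \<noteq> 0" shows "A = B"
proof -
  obtain a b c d where W: "W = mat2 a b c d" by (rule mat2_cases)
  define D where "D = a * d - b * c"
  have D: "D \<noteq> 0" using assms(2) by (simp add: W det_mat2 D_def)
  have WD: "W ** mat2 d (- b) (- c) a = mat2 D 0 0 D" by (simp add: W mat2_mult D_def algebra_simps)
  have "A ** (W ** mat2 d (- b) (- c) a) = B ** (W ** mat2 d (- b) (- c) a)"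
    using assms(1) by (simp only: matrix_mul_assoc)
  then have "A ** mat2 D 0 0 D = B ** mat2 D 0 0 D" by (simp only: WD)
  moreover obtain a1 b1 c1 d1 where "A = mat2 a1 b1 c1 d1" by (rule mat2_cases)
  moreover obtain a2 b2 c2 d2 where "B = mat2 a2 b2 c2 d2" by (rule mat2_cases)
  ultimately show ?thesis using D by (simp add: mat2_mult)
qed

lemma Gamma0_iff: "\<gamma> \<in> Gamma0 m \<longleftrightarrow> det \<gamma> dvd 1 \<and> m dvd \<gamma>$2$1"
  by (simp add: Gamma0_def invertible_iff_det_unit)

lemma Gamma0_mat2_iff [simp]: "mat2 a b c d \<in> Gamma0 m \<longleftrightarrow> a * d - b * c dvd 1 \<and> m dvd c"
  by (simp add: Gamma0_iff det_mat2)

lemma Gamma0_1: "mat 1 \<in> Gamma0 m"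
  by (simp add: mat_1_mat2)

lemma Gamma0_mult: "\<gamma> \<in> Gamma0 m \<Longrightarrow> \<delta> \<in> Gamma0 m \<Longrightarrow> \<gamma> ** \<delta> \<in> Gamma0 m"
  unfolding Gamma0_iff det_mul by (auto simp: matrix_matrix_mult_def sum_2)

lemma Gamma0_inverse:
  assumes "\<gamma> \<in> Gamma0 m" obtains \<delta> where "\<delta> \<in> Gamma0 m" "\<gamma> ** \<delta> = mat 1" "\<delta> ** \<gamma> = mat 1"
proof -
  obtain u where u: "det \<gamma> * u = 1" using assms by (metis Gamma0_iff dvdE)
  obtain a b c d where A: "\<gamma> = mat2 a b c d" by (rule mat2_cases)
  have u': "(a * d - b * c) * u = 1" using u by (simp add: A det_mat2)
  let ?B = "mat2 (d * u) (- b * u) (- c * u) (a * u)"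
  have inv: "\<gamma> ** ?B = mat 1" "?B ** \<gamma> = mat 1"
    using u' by (simp_all add: A mat2_mult mat_1_mat2 algebra_simps)
  have "det ?B dvd 1" by (metis inv(1) det_I det_mul dvd_triv_right)
  then have "?B \<in> Gamma0 m" using assms by (simp add: Gamma0_iff A)
  then show ?thesis using inv that by blast
qed

lemma Gamma0_det_nonzero: "\<gamma> \<in> Gamma0 m \<Longrightarrow> det \<gamma> \<noteq> 0" for m :: "'q::field poly"
  by (auto simp: Gamma0_iff)

text \<open>
  By the Euclidean algorithm; the combination \<open>s a + t c\<close> is a greatest common divisor.
\<close>

lemma poly_bezout:
  fixes a c :: "'q::field poly"
  obtains s t where "s * a + t * c dvd a" "s * a + t * c dvd c"
proof -
  have "\<exists>s t. s * a + t * c dvd a \<and> s * a + t * c dvd c"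
  proof (induction "euclidean_size c" arbitrary: a c rule: less_induct)
    case less
    show ?case
    proof (cases "c = 0")
      case True
      then show ?thesis by (intro exI[of _ 1] exI[of _ 0]) simp
    next
      case False
      obtain s t where st: "s * c + t * (a mod c) dvd c" "s * c + t * (a mod c) dvd a mod c"
        using less[of "a mod c" c] mod_size_less[OF False] by blast
      have eq: "s * c + t * (a mod c) = t * a + (s - t * (a div c)) * c"
        using minus_mod_eq_mult_div[of a c] by (simp add: minus_mult_div_eq_mod[symmetric] algebra_simps)
      have "s * c + t * (a mod c) dvd a" using st by (metis dvd_mod_imp_dvd)
      with st(1) show ?thesis unfolding eq by blast
    qed
  qed
  then show ?thesis using that by blast
qed

lemma monic_prime_degree_pos: "monic_prime P \<Longrightarrow> 0 < degree P"
  using is_unit_iff_degree[of P] by (auto simp: monic_prime_def irreducible_def)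

lemma monic_prime_nonzero: "monic_prime P \<Longrightarrow> P \<noteq> 0"
  by (auto simp: monic_prime_def)

lemma monic_prime_bezout:
  assumes "monic_prime P" "\<not> P dvd a" obtains s t where "s * P + t * a = 1"
proof -
  obtain s t where st: "s * P + t * a dvd P" "s * P + t * a dvd a" by (rule poly_bezout)
  then obtain h where h: "P = (s * P + t * a) * h" by blast
  have "s * P + t * a dvd 1"
  proof (rule ccontr)
    assume "\<not> s * P + t * a dvd 1"
    then have "h dvd 1" using h assms(1) by (metis irreducibleD monic_prime_def)
    then have "P dvd s * P + t * a" using h by (metis dvd_mult_unit_iff' dvd_refl mult.commute)
    then show False using st(2) assms(2) dvd_trans by blast
  qed
  then obtain u where "1 = (s * P + t * a) * u" by blast
  then have "(s * u) * P + (t * u) * a = 1" by (simp add: algebra_simps)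
  then show ?thesis using that by blast
qed

lemma monic_prime_dvd_mult:
  assumes "monic_prime P" "P dvd a * b" shows "P dvd a \<or> P dvd b"
proof (cases "P dvd a")
  case False
  then obtain s t where "s * P + t * a = 1" using monic_prime_bezout assms(1) by blast
  then have "(s * P + t * a) * b = b" by simp
  then have "P * (s * b) + t * (a * b) = b" by (simp add: algebra_simps)
  moreover have "P dvd P * (s * b) + t * (a * b)" by (rule dvd_add[OF dvd_triv_left dvd_mult[OF assms(2)]])
  ultimately have "P dvd b" by simp
  then show ?thesis ..
qed simp

lemma monic_prime_not_dvd_unit: "monic_prime P \<Longrightarrow> u dvd 1 \<Longrightarrow> \<not> P dvd u"
  using dvd_trans by (auto simp: monic_prime_def irreducible_def)

lemma squarefree_cofactor_not_dvd:
  assumes "squarefree (R * m)" "monic_prime R" shows "\<not> R dvd m"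
proof
  assume "R dvd m"
  then have "R\<^sup>2 dvd R * m" by (simp add: power2_eq_square mult_dvd_mono)
  then have "R dvd 1" using assms(1) by (simp add: squarefree_def)
  then show False using monic_prime_not_dvd_unit[OF assms(2), of 1] by simp
qed

lemma monic_prime_dvd_imp_eq:
  assumes "monic_prime P" "monic_prime P'" "P dvd P'" shows "P = P'"
proof -
  obtain h where h: "P' = P * h" using assms(3) by blast
  then have "h dvd 1" using assms by (metis irreducibleD irreducible_not_unit monic_prime_def)
  moreover from this have "h \<noteq> 0" by auto
  ultimately have "degree h = 0" using is_unit_iff_degree[of h] by blast
  then obtain c where c: "h = [:c:]" by (rule degree_eq_zeroE)
  have "lead_coeff P' = lead_coeff P * lead_coeff h" unfolding h by (rule lead_coeff_mult)
  then have "c = 1" using assms(1,2) c by (simp add: monic_prime_def)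
  then show ?thesis using h c by simp
qed

lemma residue_polys_mod: "0 < degree P \<Longrightarrow> y mod P \<in> residue_polys P"
  using degree_mod_less[of P y] by (cases "P = 0") (auto simp: residue_polys_def)

lemma residue_polys_eq:
  assumes "x \<in> residue_polys P" "y \<in> residue_polys P" "P dvd x - y" shows "x = y"
proof (rule ccontr)
  assume "x \<noteq> y"
  then have "degree P \<le> degree (x - y)" using assms(3) by (intro dvd_imp_degree_le) auto
  moreover have "degree (x - y) < degree P"
    using assms by (auto simp: residue_polys_def intro: degree_diff_less)
  ultimately show False by simp
qed

text \<open>
  If \<open>g\<close> is a greatest common divisor of the first column, a unimodular matrix maps the column to
  \<open>(g, 0)\<close>.
\<close>

lemma upper_triangular_decomposition:
  fixes x :: "'q::field poly^2^2"
  assumes "det x \<noteq> 0"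
  obtains \<gamma> a b d where "invertible \<gamma>" "x = \<gamma> ** mat2 a b 0 d"
proof -
  obtain a b c d where x: "x = mat2 a b c d" by (rule mat2_cases)
  obtain s t where g: "s * a + t * c dvd a" "s * a + t * c dvd c" by (rule poly_bezout)
  define g where "g = s * a + t * c"
  obtain a' c' where ac: "a = g * a'" "c = g * c'" using g unfolding g_def[symmetric] by blast
  have "g \<noteq> 0" using assms ac by (auto simp: x det_mat2)
  moreover have "g * (s * a' + t * c') = s * (g * a') + t * (g * c')" by (simp add: algebra_simps)
  then have "g * (s * a' + t * c') = g * 1" unfolding ac[symmetric] g_def[symmetric] by simp
  ultimately have 1: "s * a' + t * c' = 1" by (simp only: mult_cancel_left) simp
  have "invertible (mat2 a' (- t) c' s)"
    using 1 by (simp add: invertible_iff_det_unit det_mat2 algebra_simps)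
  moreover have "x = mat2 a' (- t) c' s ** mat2 g (s * b + t * d) 0 (a' * d - b * c')"
  proof -
    have "(s * a' + t * c') * b = b" "(s * a' + t * c') * d = d" using 1 by simp_all
    then show ?thesis using ac by (simp add: x mat2_mult algebra_simps)
  qed
  ultimately show ?thesis using that by blast
qed

definition hecke_reps :: "'q::{field,finite} poly \<Rightarrow> 'q poly \<Rightarrow> ('q poly^2^2) set" where
  "hecke_reps m P = (\<lambda>Q. mat2 1 Q 0 P) ` residue_polys P \<union> (if P dvd m then {} else {mat2 P 0 0 1})"

text \<open>
  The union of the cosets \<open>\<Gamma>\<^sub>0(m) \<alpha>\<close> with \<open>\<alpha> \<in> hecke_reps m P\<close>. For \<open>P dvd m\<close> the condition on the
  upper left entry excludes the coset of the matrix with rows \<open>(P, 0), (0, 1)\<close>, which does not occur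
  in \<open>U\<^sub>P\<close>.
\<close>

definition hecke_matrices :: "'q::{field,finite} poly \<Rightarrow> 'q poly \<Rightarrow> ('q poly^2^2) set" where
  "hecke_matrices m P = {x. (\<exists>u. u dvd 1 \<and> det x = u * P) \<and> m dvd x$2$1 \<and> (P dvd m \<longrightarrow> \<not> P dvd x$1$1)}"

lemma finite_hecke_reps [simp]: "finite (hecke_reps m P)"
  by (simp add: hecke_reps_def)

lemma hecke_reps_subset: "monic_prime P \<Longrightarrow> hecke_reps m P \<subseteq> hecke_matrices m P"
  using monic_prime_not_dvd_unit[of P 1]
  by (auto simp: hecke_reps_def hecke_matrices_def det_mat2 intro!: exI[of _ 1])

lemma hecke_matrices_det_nonzero: "monic_prime P \<Longrightarrow> x \<in> hecke_matrices m P \<Longrightarrow> det x \<noteq> 0"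
  by (auto simp: hecke_matrices_def dest: monic_prime_nonzero)

lemma hecke_matrices_mult_right:
  assumes P: "monic_prime P" and x: "x \<in> hecke_matrices m P" and \<gamma>: "\<gamma> \<in> Gamma0 m"
  shows "x ** \<gamma> \<in> hecke_matrices m P"
proof -
  obtain u where u: "u dvd 1" "det x = u * P" using x by (auto simp: hecke_matrices_def)
  have "det (x ** \<gamma>) = (u * det \<gamma>) * P" "u * det \<gamma> dvd 1"
    using u \<gamma> by (auto simp: det_mul Gamma0_iff)
  moreover have "m dvd (x ** \<gamma>)$2$1"
    using x \<gamma> by (auto simp: hecke_matrices_def Gamma0_iff matrix_matrix_mult_def sum_2)
  moreover have "\<not> P dvd (x ** \<gamma>)$1$1" if "P dvd m"
  proof
    assume *: "P dvd (x ** \<gamma>)$1$1"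
    have P21: "P dvd \<gamma>$2$1" using \<gamma> that by (meson Gamma0_iff dvd_trans)
    have "P dvd x$1$1 * \<gamma>$1$1"
      using * P21 by (simp add: matrix_matrix_mult_def sum_2 dvd_add_left_iff)
    moreover have "\<not> P dvd x$1$1" using x that by (simp add: hecke_matrices_def)
    ultimately have "P dvd \<gamma>$1$1" using monic_prime_dvd_mult[OF P] by blast
    then have "P dvd det \<gamma>" using P21 by (simp add: det_2)
    then show False using \<gamma> monic_prime_not_dvd_unit[OF P] by (auto simp: Gamma0_iff)
  qed
  ultimately show ?thesis by (auto simp: hecke_matrices_def)
qed

text \<open>
  The greatest common divisor \<open>g\<close> of the first column divides \<open>P\<close>. If it is a unit, the column can be
  moved to \<open>(1, 0)\<close> and the upper right entry reduced modulo \<open>P\<close>; otherwise \<open>P\<close> divides the column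
  and can be split off to the right.
\<close>

lemma hecke_matrices_cover:
  assumes P: "monic_prime P" and x: "x \<in> hecke_matrices m P"
  obtains \<gamma> \<alpha> where "\<gamma> \<in> Gamma0 m" "\<alpha> \<in> hecke_reps m P" "x = \<gamma> ** \<alpha>"
proof -
  obtain a b c d where x': "x = mat2 a b c d" by (rule mat2_cases)
  obtain u where u: "u dvd 1" "a * d - b * c = u * P" and mc: "m dvd c" and Pa: "P dvd m \<Longrightarrow> \<not> P dvd a"
    using x by (auto simp: hecke_matrices_def x' det_mat2)
  have P0: "P \<noteq> 0" using P by (rule monic_prime_nonzero)
  obtain s t where g: "s * a + t * c dvd a" "s * a + t * c dvd c" by (rule poly_bezout)
  define g where "g = s * a + t * c"
  have "g dvd u * P" using g u(2)[symmetric] by (simp add: g_def)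
  then have "g dvd P" using u(1) by (simp add: dvd_mult_unit_iff')
  then obtain h where h: "P = g * h" by blast
  show ?thesis
  proof (cases "g dvd 1")
    case True
    then obtain v where v: "g * v = 1" by (metis dvdE)
    define s' t' where "s' = v * s" and "t' = v * t"
    have 1: "s' * a + t' * c = 1" using v unfolding g_def s'_def t'_def by (simp add: algebra_simps)
    define y where "y = s' * b + t' * d"
    define w where "w = y div P"
    have y: "y = y mod P + w * P" by (simp add: w_def)
    have "mat2 a (a * w - t' * u) c (c * w + s' * u) \<in> Gamma0 m"
    proof -
      have "a * (c * w + s' * u) - (a * w - t' * u) * c = u * (s' * a + t' * c)"
        by (simp add: algebra_simps)
      then show ?thesis using 1 u mc by simp
    qed
    moreover have "mat2 1 (y mod P) 0 P \<in> hecke_reps m P"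
      using residue_polys_mod monic_prime_degree_pos[OF P] by (auto simp: hecke_reps_def)
    moreover have "x = mat2 a (a * w - t' * u) c (c * w + s' * u) ** mat2 1 (y mod P) 0 P"
    proof -
      have "b = a * y - t' * (u * P)" "d = c * y + s' * (u * P)"
      proof -
        have "(s' * a + t' * c) * b = b" "(s' * a + t' * c) * d = d" using 1 by simp_all
        then show "b = a * y - t' * (u * P)" "d = c * y + s' * (u * P)"
          unfolding u(2)[symmetric] y_def by (simp_all add: algebra_simps)
      qed
      moreover have "a * y - t' * (u * P) = a * (y mod P) + (a * w - t' * u) * P"
        "c * y + s' * (u * P) = c * (y mod P) + (c * w + s' * u) * P"
        by (subst y, simp add: algebra_simps)+
      ultimately show ?thesis by (simp add: x' mat2_mult)
    qed
    ultimately show ?thesis using that by blast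
  next
    case False
    then have "h dvd 1" using h P by (metis irreducibleD monic_prime_def)
    then have "P dvd g" using h by (metis dvd_mult_unit_iff' dvd_refl mult.commute)
    then have "P dvd a" "P dvd c" using g dvd_trans unfolding g_def by blast+
    then obtain a' c' where ac: "a = a' * P" "c = c' * P" by (metis dvdE mult.commute)
    have Pm: "\<not> P dvd m" using Pa \<open>P dvd a\<close> by blast
    then obtain s t where "s * P + t * m = 1" using monic_prime_bezout P by blast
    then have "(s * P + t * m) * c' = c'" by simp
    then have "s * c + m * (t * c') = c'" unfolding ac by (simp add: algebra_simps)
    moreover have "m dvd s * c + m * (t * c')" by (rule dvd_add[OF dvd_mult[OF mc] dvd_triv_left])
    ultimately have "m dvd c'" by simp
    moreover have "P * (a' * d - b * c') = P * u" using u(2) by (simp add: ac algebra_simps)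
    then have "a' * d - b * c' = u" using P0 by simp
    ultimately have "mat2 a' b c' d \<in> Gamma0 m" using u by simp
    moreover have "x = mat2 a' b c' d ** mat2 P 0 0 1" by (simp add: x' ac mat2_mult)
    moreover have "mat2 P 0 0 1 \<in> hecke_reps m P" using Pm by (simp add: hecke_reps_def)
    ultimately show ?thesis using that by blast
  qed
qed

lemma hecke_reps_unique:
  assumes P: "monic_prime P" and \<gamma>: "\<gamma> \<in> Gamma0 m"
    and ab: "\<alpha> \<in> hecke_reps m P" "\<beta> \<in> hecke_reps m P" "\<alpha> = \<gamma> ** \<beta>"
  shows "\<alpha> = \<beta>"
proof -
  obtain a b c d where g: "\<gamma> = mat2 a b c d" by (rule mat2_cases)
  have P0: "P \<noteq> 0" using P by (rule monic_prime_nonzero)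
  have nu: "\<not> P dvd 1" using monic_prime_not_dvd_unit[OF P, of 1] by simp
  consider Q Q' where "\<alpha> = mat2 1 Q 0 P" "\<beta> = mat2 1 Q' 0 P" "Q \<in> residue_polys P" "Q' \<in> residue_polys P"
    | Q where "\<alpha> = mat2 1 Q 0 P" "\<beta> = mat2 P 0 0 1"
    | Q where "\<alpha> = mat2 P 0 0 1" "\<beta> = mat2 1 Q 0 P"
    | "\<alpha> = mat2 P 0 0 1" "\<beta> = mat2 P 0 0 1"
    using ab(1,2) by (auto simp: hecke_reps_def split: if_splits)
  then show ?thesis
  proof cases
    case 1
    then have "a = 1" "Q = Q' + b * P" using ab(3) by (auto simp: g mat2_mult)
    then show ?thesis using 1 residue_polys_eq[of Q P Q'] by simp
  next
    case 2
    then have "a * P = 1" using ab(3) by (auto simp: g mat2_mult)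
    then show ?thesis using nu by (metis dvd_triv_right)
  next
    case 3
    then have "c = 0" "1 = c * Q + d * P" using ab(3) by (auto simp: g mat2_mult)
    then show ?thesis using nu by (metis add_0 dvd_triv_right mult_zero_left)
  qed simp
qed

section \<open>The slash operator\<close>

locale modular = carlitz \<iota> \<pi> for \<iota> :: "'q::{field,finite} fls \<Rightarrow> 'c::nonarch_complete_field" and \<pi> +
  fixes k l :: nat
begin

abbreviation sl :: "('c \<Rightarrow> 'c) \<Rightarrow> 'q poly^2^2 \<Rightarrow> 'c \<Rightarrow> 'c" where
  "sl f \<gamma> \<equiv> slash_A \<iota> k l f \<gamma>"

lemma sl_mat2: "sl f (mat2 a b c d) z = (if z \<in> Omega \<iota>
    then emb (a * d - b * c) ^ l / (emb c * z + emb d) ^ k * f ((emb a * z + emb b) / (emb c * z + emb d)) else 0)"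
proof -
  have "\<iota> (det (map_matrix poly_to_fls (mat2 a b c d))) = emb (a * d - b * c)"
    by (simp add: det_2 of_A_def[symmetric])
  then show ?thesis by (simp add: slash_def of_A_def[symmetric])
qed

lemma sl_outside: "z \<notin> Omega \<iota> \<Longrightarrow> sl f \<gamma> z = 0"
  by (simp add: slash_def)

text \<open>
  If the image, or the pole, lay in \<open>K\<^sub>\<infinity>\<close>, then solving for \<open>z\<close> would put \<open>z\<close> into \<open>K\<^sub>\<infinity>\<close>.
\<close>

lemma moebius_Omega:
  assumes "a * d - b * c \<noteq> 0" "z \<in> Omega \<iota>"
  shows "emb c * z + emb d \<noteq> 0" "(emb a * z + emb b) / (emb c * z + emb d) \<in> Omega \<iota>"
proof -
  have z: "z \<noteq> \<iota> x" for x using assms(2) by (auto simp: Omega_def)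
  show nz: "emb c * z + emb d \<noteq> 0"
  proof
    assume 0: "emb c * z + emb d = 0"
    show False
    proof (cases "c = 0")
      case True
      then show False using 0 assms(1) by simp
    next
      case False
      have "z * emb c = emb (- d)" using 0 by (simp add: eq_neg_iff_add_eq_0 mult.commute)
      then have "z = emb (- d) / emb c" using False by (simp only: nonzero_eq_divide_eq emb_eq_0_iff not_False_eq_True)
      then show False using z emb_divide_in_range[of "- d" c] by (metis rangeE)
    qed
  qed
  show "(emb a * z + emb b) / (emb c * z + emb d) \<in> Omega \<iota>"
  proof (rule ccontr)
    assume "(emb a * z + emb b) / (emb c * z + emb d) \<notin> Omega \<iota>"
    then obtain x where "(emb a * z + emb b) / (emb c * z + emb d) = \<iota> x" by (auto simp: Omega_def)
    then have eq: "emb a * z + emb b = \<iota> x * (emb c * z + emb d)" using nz by (simp add: divide_eq_eq)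
    show False
    proof (cases "emb a = \<iota> x * emb c")
      case True
      then have "emb b = \<iota> x * emb d" using eq by (simp add: algebra_simps)
      then have "emb (a * d - b * c) = 0" using True by simp
      then show False using assms(1) by (simp only: emb_eq_0_iff)
    next
      case False
      then have "z = (\<iota> x * emb d - emb b) / (emb a - \<iota> x * emb c)"
        using eq by (simp add: eq_divide_eq algebra_simps)
      also have "\<dots> \<in> range \<iota>" by (simp add: of_A_def flip: iota_hom iota_diff iota_divide)
      finally show False using z by blast
    qed
  qed
qed

lemma sl_sl:
  assumes "det x \<noteq> 0" "det y \<noteq> 0" shows "sl (sl f x) y = sl f (x ** y)"
proof
  fix z
  obtain a b c d where x: "x = mat2 a b c d" by (rule mat2_cases)
  obtain a' b' c' d' where y: "y = mat2 a' b' c' d'" by (rule mat2_cases)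
  have dx: "a * d - b * c \<noteq> 0" and dy: "a' * d' - b' * c' \<noteq> 0" using assms by (auto simp: x y det_mat2)
  show "sl (sl f x) y z = sl f (x ** y) z"
  proof (cases "z \<in> Omega \<iota>")
    case True
    define j where "j = emb c' * z + emb d'"
    define w where "w = (emb a' * z + emb b') / j"
    have j: "j \<noteq> 0" and w: "w \<in> Omega \<iota>" using moebius_Omega[OF dy True] by (auto simp: j_def w_def)
    have jw: "j * w = emb a' * z + emb b'" using j by (simp add: w_def)
    have den: "emb (c * a' + d * c') * z + emb (c * b' + d * d') = j * (emb c * w + emb d)"
      and num: "emb (a * a' + b * c') * z + emb (a * b' + b * d') = j * (emb a * w + emb b)"
      using jw by (simp_all add: algebra_simps j_def)
        (metis (no_types, lifting) distrib_left mult.left_commute mult.commute add.assoc jw)+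
    have det: "emb ((a * a' + b * c') * (c * b' + d * d') - (a * b' + b * d') * (c * a' + d * c')) =
        emb (a * d - b * c) * emb (a' * d' - b' * c')"
      unfolding emb_hom(4)[symmetric] by (rule arg_cong[of _ _ emb]) (simp add: algebra_simps)
    have "sl (sl f x) y z = emb (a' * d' - b' * c') ^ l / j ^ k *
        (emb (a * d - b * c) ^ l / (emb c * w + emb d) ^ k * f ((emb a * w + emb b) / (emb c * w + emb d)))"
      unfolding x y sl_mat2 using True w by (simp only: if_True j_def[symmetric] w_def[symmetric])
    also have "\<dots> = sl f (x ** y) z"
      unfolding x y mat2_mult sl_mat2 det den num using True j
      by (simp add: power_mult_distrib mult_ac)
    finally show ?thesis .
  qed (simp add: sl_outside)
qed

lemma sl_sum: "sl (\<lambda>z. \<Sum>i\<in>I. f i z) \<gamma> z = (\<Sum>i\<in>I. sl (f i) \<gamma> z)"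
  by (simp add: slash_def sum_distrib_left)

lemma sl_add: "sl (\<lambda>z. f z + g z) \<gamma> z = sl f \<gamma> z + sl g \<gamma> z"
  by (simp add: slash_def distrib_left)

lemma sl_cmult: "sl (\<lambda>z. c * f z) \<gamma> z = c * sl f \<gamma> z"
  by (simp add: slash_def)

lemma sl_0: "sl (\<lambda>_. 0) \<gamma> z = 0"
  by (simp add: slash_def)

lemma sl_mat_1: "(\<And>z. z \<notin> Omega \<iota> \<Longrightarrow> f z = 0) \<Longrightarrow> sl f (mat 1) = f"
  by (rule ext) (simp add: mat_1_mat2 sl_mat2)

text \<open>
  The scalar matrix \<open>p\<close> acts by \<open>p ^ (2 l - k)\<close>, written without integer exponents.
\<close>

lemma sl_scalar:
  assumes "p \<noteq> 0"
  shows "sl f (mat2 (p * a) (p * b) (p * c) (p * d)) z = emb p ^ (2 * l) / emb p ^ k * sl f (mat2 a b c d) z"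
proof -
  have det: "emb (p * a * (p * d) - p * b * (p * c)) = emb p ^ 2 * emb (a * d - b * c)"
    by (simp add: power2_eq_square algebra_simps)
  have den: "emb (p * c) * z + emb (p * d) = emb p * (emb c * z + emb d)"
    and num: "emb (p * a) * z + emb (p * b) = emb p * (emb a * z + emb b)"
    by (simp_all add: algebra_simps)
  show ?thesis unfolding sl_mat2 det den num using assms
    by (simp add: power_mult_distrib mult_ac flip: power_mult)
qed

text \<open>
  The transformation behaviour of modular forms without any analytic condition. The coset arguments
  use only this, which matters because \<open>f|W\<close> is never shown to be a cusp form.
\<close>

definition weakly_modular :: "'q poly \<Rightarrow> ('c \<Rightarrow> 'c) \<Rightarrow> bool" where
  "weakly_modular m f \<longleftrightarrow> (\<forall>z. z \<notin> Omega \<iota> \<longrightarrow> f z = 0) \<and> (\<forall>\<gamma>\<in>Gamma0 m. sl f \<gamma> = f)"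

lemma weakly_modular_coset:
  assumes "weakly_modular m f" "\<gamma> \<in> Gamma0 m" "det y \<noteq> 0" shows "sl f (\<gamma> ** y) = sl f y"
  using sl_sl[of \<gamma> y f] assms Gamma0_det_nonzero[of \<gamma> m] by (simp add: weakly_modular_def)

text \<open>
  If \<open>\<phi>\<close> moves the representatives inside \<open>hecke_matrices\<close> and different cosets stay different, then
  the finitely many cosets are permuted, and the invariant \<open>f\<close> does not notice.
\<close>

lemma hecke_sum_permute:
  assumes f: "weakly_modular m f" and P: "monic_prime P"
    and mem: "\<And>\<alpha>. \<alpha> \<in> hecke_reps m P \<Longrightarrow> \<phi> \<alpha> \<in> hecke_matrices m P"
    and inj: "\<And>\<alpha> \<beta> \<gamma>. \<alpha> \<in> hecke_reps m P \<Longrightarrow> \<beta> \<in> hecke_reps m P \<Longrightarrow> \<gamma> \<in> Gamma0 m \<Longrightarrow>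
        \<phi> \<alpha> = \<gamma> ** \<phi> \<beta> \<Longrightarrow> \<exists>\<delta>\<in>Gamma0 m. \<alpha> = \<delta> ** \<beta>"
  shows "(\<Sum>\<alpha>\<in>hecke_reps m P. sl f (\<phi> \<alpha>) z) = (\<Sum>\<alpha>\<in>hecke_reps m P. sl f \<alpha> z)"
proof -
  let ?R = "hecke_reps m P"
  have "\<exists>\<beta> \<gamma>. \<gamma> \<in> Gamma0 m \<and> \<beta> \<in> ?R \<and> \<phi> \<alpha> = \<gamma> ** \<beta>" if "\<alpha> \<in> ?R" for \<alpha>
    using hecke_matrices_cover[OF P mem[OF that]] by metis
  then obtain \<sigma> where \<sigma>: "\<And>\<alpha>. \<alpha> \<in> ?R \<Longrightarrow> \<sigma> \<alpha> \<in> ?R \<and> (\<exists>\<gamma>\<in>Gamma0 m. \<phi> \<alpha> = \<gamma> ** \<sigma> \<alpha>)"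
    by metis
  have "inj_on \<sigma> ?R"
  proof (rule inj_onI)
    fix \<alpha> \<beta> assume ab: "\<alpha> \<in> ?R" "\<beta> \<in> ?R" "\<sigma> \<alpha> = \<sigma> \<beta>"
    obtain \<gamma> \<gamma>' where g: "\<gamma> \<in> Gamma0 m" "\<gamma>' \<in> Gamma0 m" "\<phi> \<alpha> = \<gamma> ** \<sigma> \<alpha>" "\<phi> \<beta> = \<gamma>' ** \<sigma> \<beta>"
      using \<sigma> ab(1,2) by meson
    obtain \<delta> where \<delta>: "\<delta> \<in> Gamma0 m" "\<delta> ** \<gamma>' = mat 1" using Gamma0_inverse[OF g(2)] by blast
    have "(\<gamma> ** \<delta>) ** \<phi> \<beta> = \<gamma> ** ((\<delta> ** \<gamma>') ** \<sigma> \<beta>)"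
      unfolding g(4) by (simp only: matrix_mul_assoc)
    then have "\<phi> \<alpha> = (\<gamma> ** \<delta>) ** \<phi> \<beta>" using \<delta>(2) g(3) ab(3) by simp
    moreover have "\<gamma> ** \<delta> \<in> Gamma0 m" using g \<delta> by (intro Gamma0_mult)
    ultimately have "\<exists>\<delta>\<in>Gamma0 m. \<alpha> = \<delta> ** \<beta>" using inj[OF ab(1,2)] by blast
    then show "\<alpha> = \<beta>" using hecke_reps_unique[OF P _ ab(1,2)] by blast
  qed
  moreover have "\<sigma> ` ?R \<subseteq> ?R" using \<sigma> by blast
  ultimately have bij: "bij_betw \<sigma> ?R ?R"
    unfolding bij_betw_def using endo_inj_surj[of ?R \<sigma>] by simp
  have "sl f (\<phi> \<alpha>) z = sl f (\<sigma> \<alpha>) z" if "\<alpha> \<in> ?R" for \<alpha>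
  proof -
    have "det (\<sigma> \<alpha>) \<noteq> 0"
      using \<sigma>[OF that] hecke_reps_subset[OF P] hecke_matrices_det_nonzero[OF P] by blast
    then show ?thesis using \<sigma>[OF that] weakly_modular_coset[OF f] by metis
  qed
  then show ?thesis using sum.reindex_bij_betw[OF bij, of "\<lambda>\<alpha>. sl f \<alpha> z"] by simp
qed

section \<open>Hecke operators preserve cusp forms\<close>

abbreviation hecke_factor :: "'q poly \<Rightarrow> 'c" where
  "hecke_factor P \<equiv> emb P powi (int k - int l)"

definition hecke_sum :: "'q poly \<Rightarrow> ('c \<Rightarrow> 'c) \<Rightarrow> 'c \<Rightarrow> 'c" where
  "hecke_sum P f = (\<lambda>z. \<Sum>Q\<in>residue_polys P. sl f (mat2 1 Q 0 P) z)"

text \<open>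
  This is \<open>T\<^sub>P\<close> or \<open>U\<^sub>P\<close>, according to whether \<open>P\<close> divides the level \<open>m\<close>.
\<close>

definition hecke :: "'q poly \<Rightarrow> 'q poly \<Rightarrow> ('c \<Rightarrow> 'c) \<Rightarrow> 'c \<Rightarrow> 'c" where
  "hecke m P f = (\<lambda>z. hecke_factor P *
     (hecke_sum P f z + (if P dvd m then 0 else sl f (mat2 P 0 0 1) z)))"

lemma hecke_T_eq: "\<not> P dvd m \<Longrightarrow> hecke_T \<iota> k l P f = hecke m P f"
  by (simp add: hecke_T_def hecke_def hecke_sum_def residue_polys_def distrib_left)

lemma hecke_U_eq: "P dvd m \<Longrightarrow> hecke_U \<iota> k l P f = hecke m P f"
  by (simp add: hecke_U_def hecke_def hecke_sum_def residue_polys_def)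

lemma hecke_eq_sum_reps:
  assumes "monic_prime P"
  shows "hecke m P f = (\<lambda>z. hecke_factor P * (\<Sum>\<alpha>\<in>hecke_reps m P. sl f \<alpha> z))"
proof
  fix z
  have "P \<noteq> 1" using monic_prime_degree_pos[OF assms] by auto
  then have "mat2 P 0 0 1 \<notin> (\<lambda>Q. mat2 1 Q 0 P) ` residue_polys P" by auto
  moreover have "(\<Sum>\<alpha>\<in>(\<lambda>Q. mat2 1 Q 0 P) ` residue_polys P. sl f \<alpha> z) = hecke_sum P f z"
    unfolding hecke_sum_def by (subst sum.reindex) (auto simp: inj_on_def)
  ultimately show "hecke m P f z = hecke_factor P * (\<Sum>\<alpha>\<in>hecke_reps m P. sl f \<alpha> z)"
    by (simp add: hecke_def hecke_reps_def add.commute)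
qed

lemma hecke_sum_add: "hecke_sum P (\<lambda>z. f z + g z) z = hecke_sum P f z + hecke_sum P g z"
  by (simp add: hecke_sum_def sl_add sum.distrib)

lemma hecke_sum_cmult: "hecke_sum P (\<lambda>z. c * f z) z = c * hecke_sum P f z"
  by (simp add: hecke_sum_def sl_cmult sum_distrib_left)

lemma hecke_add: "hecke m P (\<lambda>z. f z + g z) z = hecke m P f z + hecke m P g z"
  by (simp add: hecke_def hecke_sum_add sl_add algebra_simps)

lemma hecke_cmult: "hecke m P (\<lambda>z. c * f z) z = c * hecke m P f z"
  by (simp add: hecke_def hecke_sum_cmult sl_cmult algebra_simps)

lemma hecke_0: "hecke m P (\<lambda>_. 0) z = 0"
  using hecke_cmult[of m P 0 "\<lambda>_. 0" z] by simp

lemma hecke_finite_sum: "hecke m P (\<lambda>z. \<Sum>i\<in>I. f i z) z = (\<Sum>i\<in>I. hecke m P (f i) z)"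
  by (induction I rule: infinite_finite_induct) (simp_all add: hecke_0 hecke_add)

lemma hecke_reps_det_nonzero: "monic_prime P \<Longrightarrow> \<alpha> \<in> hecke_reps m P \<Longrightarrow> det \<alpha> \<noteq> 0"
  using hecke_reps_subset hecke_matrices_det_nonzero by blast

lemma sl_hecke:
  assumes "monic_prime P" "det \<gamma> \<noteq> 0"
  shows "sl (hecke m P f) \<gamma> z = hecke_factor P * (\<Sum>\<alpha>\<in>hecke_reps m P. sl f (\<alpha> ** \<gamma>) z)"
  using assms by (simp add: hecke_eq_sum_reps[OF assms(1)] sl_cmult sl_sum sl_sl hecke_reps_det_nonzero)

lemma weakly_modular_hecke:
  assumes f: "weakly_modular m f" and P: "monic_prime P"
  shows "weakly_modular m (hecke m P f)"
  unfolding weakly_modular_def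
proof (intro conjI allI impI ballI ext)
  fix z assume "z \<notin> Omega \<iota>"
  then show "hecke m P f z = 0" by (simp add: hecke_def hecke_sum_def sl_outside)
next
  fix \<gamma> z assume \<gamma>: "\<gamma> \<in> Gamma0 m"
  have det: "det \<gamma> \<noteq> 0" using \<gamma> by (rule Gamma0_det_nonzero)
  have "sl (hecke m P f) \<gamma> z = hecke_factor P * (\<Sum>\<alpha>\<in>hecke_reps m P. sl f (\<alpha> ** \<gamma>) z)"
    by (rule sl_hecke[OF P det])
  also have "(\<Sum>\<alpha>\<in>hecke_reps m P. sl f (\<alpha> ** \<gamma>) z) = (\<Sum>\<alpha>\<in>hecke_reps m P. sl f \<alpha> z)"
  proof (rule hecke_sum_permute[OF f P])
    fix \<alpha> assume "\<alpha> \<in> hecke_reps m P"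
    then show "\<alpha> ** \<gamma> \<in> hecke_matrices m P"
      using hecke_matrices_mult_right[OF P _ \<gamma>] hecke_reps_subset[OF P] by blast
  next
    fix \<alpha> \<beta> \<delta> assume "\<delta> \<in> Gamma0 m" "\<alpha> ** \<gamma> = \<delta> ** (\<beta> ** \<gamma>)"
    then have "\<alpha> = \<delta> ** \<beta>"
      using matrix_mult_right_cancel[OF _ det, of \<alpha> "\<delta> ** \<beta>"] by (simp add: matrix_mul_assoc)
    then show "\<exists>\<delta>\<in>Gamma0 m. \<alpha> = \<delta> ** \<beta>" using \<open>\<delta> \<in> Gamma0 m\<close> by blast
  qed
  finally show "sl (hecke m P f) \<gamma> z = hecke m P f z" by (simp add: hecke_eq_sum_reps[OF P])
qed

lemma cusp_expansion_cong:
  assumes "cusp_expansion N f" "\<And>z. 0 < imag_part z \<Longrightarrow> g z = f z" shows "cusp_expansion N g"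
proof -
  obtain a r M R where a: "a 0 = 0" "0 < r" "gauss_bounded r a M"
    "\<And>z. R < imag_part z \<Longrightarrow> (\<lambda>i. a i * (1 / scaled_exp (z / emb N)) ^ i) sums f z"
    using assms(1) unfolding cusp_expansion_def by blast
  then show ?thesis unfolding cusp_expansion_def
    using assms(2) by (intro exI[of _ a] exI[of _ r] exI[of _ M] exI[of _ "max 0 R"]) auto
qed

lemma cusp_forms_iff:
  assumes "m \<noteq> 0"
  shows "f \<in> cusp_forms \<iota> \<pi> k l m \<longleftrightarrow> rigid_holomorphic \<iota> f \<and> weakly_modular m f \<and>
    (\<forall>\<gamma>. invertible \<gamma> \<longrightarrow> cusp_expansion m (sl f \<gamma>))"
  using assms by (auto simp: cusp_forms_def weakly_modular_def vanishes_at_infinity_iff)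

lemma cusp_forms_cmult:
  assumes "m \<noteq> 0" "f \<in> cusp_forms \<iota> \<pi> k l m"
  shows "(\<lambda>z. c * f z) \<in> cusp_forms \<iota> \<pi> k l m"
  using assms by (auto simp: cusp_forms_iff weakly_modular_def sl_cmult[abs_def]
      intro: rigid_holomorphic_cmult cusp_expansion_cmult)

lemma rigid_holomorphic_hecke:
  assumes P: "monic_prime P" and f: "rigid_holomorphic \<iota> f"
  shows "rigid_holomorphic \<iota> (hecke m P f)"
proof -
  have P0: "P \<noteq> 0" using P by (rule monic_prime_nonzero)
  have 1: "rigid_holomorphic \<iota> (sl f (mat2 1 Q 0 P))" for Q
  proof (rule rigid_holomorphic_affine[OF f])
    show "emb 1 / emb P \<in> range \<iota>" "emb Q / emb P \<in> range \<iota>" by (rule emb_divide_in_range)+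
    show "emb 1 / emb P \<noteq> 0" using P0 by simp
    show "sl f (mat2 1 Q 0 P) z = emb P ^ l / emb P ^ k * f (emb 1 / emb P * z + emb Q / emb P)"
      if "z \<in> Omega \<iota>" for z
      using that P0 by (simp add: sl_mat2 add_divide_distrib)
  qed
  have 2: "rigid_holomorphic \<iota> (sl f (mat2 P 0 0 1))"
  proof (rule rigid_holomorphic_affine[OF f])
    show "emb P \<in> range \<iota>" "emb 0 \<in> range \<iota>" by (rule emb_in_range)+
    show "emb P \<noteq> 0" using P0 by simp
    show "sl f (mat2 P 0 0 1) z = emb P ^ l * f (emb P * z + emb 0)" if "z \<in> Omega \<iota>" for z
      using that by (simp add: sl_mat2)
  qed
  have 3: "rigid_holomorphic \<iota> (\<lambda>z. if P dvd m then 0 else sl f (mat2 P 0 0 1) z)"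
    using 2 rigid_holomorphic_0 by (cases "P dvd m") auto
  show ?thesis unfolding hecke_def hecke_sum_def
    by (intro rigid_holomorphic_cmult rigid_holomorphic_add rigid_holomorphic_sum 1 3)
qed

lemma cusp_expansion_upper_triangular:
  assumes g: "cusp_expansion N g" and nz: "N \<noteq> 0" "M \<noteq> 0" "a * d \<noteq> 0" and dvd: "d dvd a * M"
  shows "cusp_expansion (N * M) (sl g (mat2 a b 0 d))"
proof (rule cusp_expansion_cong)
  show "cusp_expansion (N * M) (\<lambda>z. emb (a * d) ^ l / emb d ^ k * g ((emb a * z + emb b) / emb d))"
    using nz dvd by (intro cusp_expansion_cmult cusp_expansion_affine[OF g]) auto
  show "sl g (mat2 a b 0 d) z = emb (a * d) ^ l / emb d ^ k * g ((emb a * z + emb b) / emb d)"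
    if "0 < imag_part z" for z
    using imag_part_pos_Omega[OF that] by (simp add: sl_mat2)
qed

text \<open>
  Writing each \<open>\<alpha> \<gamma>\<close> as an element of \<open>GL\<^sub>2(A)\<close> times an upper triangular matrix of determinant \<open>P\<close>
  (up to a unit) gives every summand an expansion at level \<open>m P\<close>. The sum \<open>(H f)|\<gamma>\<close> is invariant under
  \<open>z \<mapsto> z + m x\<close> because the conjugate of this translation by \<open>\<gamma>\<close> lies in \<open>\<Gamma>\<^sub>0(m)\<close>, so
  \<open>cusp_expansion_descent\<close> brings the expansion down to level \<open>m\<close>.
\<close>

lemma cusp_expansion_hecke:
  assumes m: "m \<noteq> 0" and P: "monic_prime P" and f: "weakly_modular m f"
    and cusp: "\<And>\<gamma>. invertible \<gamma> \<Longrightarrow> cusp_expansion m (sl f \<gamma>)" and \<gamma>: "invertible \<gamma>"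
  shows "cusp_expansion m (sl (hecke m P f) \<gamma>)"
proof (rule cusp_expansion_descent[OF _ m monic_prime_degree_pos[OF P]])
  have P0: "P \<noteq> 0" using P by (rule monic_prime_nonzero)
  obtain v where v: "det \<gamma> * v = 1" using \<gamma> by (metis invertible_iff_det_unit dvdE)
  then have det: "det \<gamma> \<noteq> 0" by auto
  have each: "cusp_expansion (m * P) (sl f (\<alpha> ** \<gamma>))" if \<alpha>: "\<alpha> \<in> hecke_reps m P" for \<alpha>
  proof -
    have d\<alpha>: "det \<alpha> = P" using \<alpha> by (auto simp: hecke_reps_def det_mat2 split: if_splits)
    then have "det (\<alpha> ** \<gamma>) \<noteq> 0" using det P0 by (simp add: det_mul)
    then obtain \<gamma>' a b d where dec: "invertible \<gamma>'" "\<alpha> ** \<gamma> = \<gamma>' ** mat2 a b 0 d"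
      by (rule upper_triangular_decomposition)
    have eq: "P * det \<gamma> = det \<gamma>' * (a * d)"
      using arg_cong[OF dec(2), of det] d\<alpha> by (simp add: det_mul det_mat2)
    have "P = (P * det \<gamma>) * v" using v by (simp add: mult.assoc)
    also have "\<dots> = d * (det \<gamma>' * a * v)" unfolding eq by (simp add: mult_ac)
    finally have "d dvd P" by (metis dvd_triv_left)
    moreover have ad: "a * d \<noteq> 0" using eq det P0 by (metis mult_eq_0_iff)
    moreover have "sl f (\<alpha> ** \<gamma>) = sl (sl f \<gamma>') (mat2 a b 0 d)"
      unfolding dec(2) using dec(1) ad
      by (intro sl_sl[symmetric]) (auto simp: invertible_iff_det_unit det_mat2)
    ultimately show ?thesis
      using cusp_expansion_upper_triangular[OF cusp[OF dec(1)] m P0] by simp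
  qed
  show "cusp_expansion (m * P) (sl (hecke m P f) \<gamma>)"
    unfolding sl_hecke[OF P det, abs_def] by (intro cusp_expansion_cmult cusp_expansion_sum each)
  fix x z assume z: "0 < imag_part z"
  let ?F = "hecke m P f"
  have z\<Omega>: "z \<in> Omega \<iota>" by (rule imag_part_pos_Omega[OF z])
  obtain a b c d where g: "\<gamma> = mat2 a b c d" by (rule mat2_cases)
  define y where "y = m * x * v"
  have v': "(a * d - b * c) * v = 1" using v by (simp add: g det_mat2)
  \<comment> \<open>\<open>?\<delta>\<close> is \<open>\<gamma> ** ?t\<close> times the inverse of \<open>\<gamma>\<close>, computed with \<open>v\<close> as the inverse of the determinant.\<close>
  let ?t = "mat2 1 (m * x) 0 1" and ?\<delta> = "mat2 (1 - y * a * c) (y * a * a) (- y * c * c) (1 + y * a * c)"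
  have "(1 - y * a * c) * (1 + y * a * c) - (y * a * a) * (- y * c * c) = 1" by (simp add: algebra_simps)
  then have \<delta>: "?\<delta> \<in> Gamma0 m" by (simp add: y_def mult.assoc)
  have "\<gamma> ** ?t = ?\<delta> ** \<gamma>"
  proof -
    have "y * (a * d - b * c) = m * x" using v' by (simp add: y_def mult_ac)
    then have "y * (a * d - b * c) * a = m * x * a" "y * (a * d - b * c) * c = m * x * c" by simp_all
    then show ?thesis by (simp add: g mat2_mult algebra_simps)
  qed
  then have "sl (sl ?F \<gamma>) ?t = sl ?F (?\<delta> ** \<gamma>)" using sl_sl[of \<gamma> ?t ?F] det by (simp add: det_mat2)
  also have "\<dots> = sl ?F \<gamma>" by (rule weakly_modular_coset[OF weakly_modular_hecke[OF f P] \<delta> det])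
  finally have "sl (sl ?F \<gamma>) ?t z = sl ?F \<gamma> z" by simp
  then show "sl ?F \<gamma> (z + emb m * emb x) = sl ?F \<gamma> z" using z\<Omega> by (simp add: sl_mat2)
qed

lemma hecke_cusp_forms:
  assumes "m \<noteq> 0" "monic_prime P" "f \<in> cusp_forms \<iota> \<pi> k l m"
  shows "hecke m P f \<in> cusp_forms \<iota> \<pi> k l m"
  using assms by (auto simp: cusp_forms_iff intro: rigid_holomorphic_hecke weakly_modular_hecke cusp_expansion_hecke)

section \<open>Commutation relations between Hecke operators\<close>

text \<open>
  Both orders give the sum over the residues \<open>B\<close> modulo \<open>P P'\<close>, by writing \<open>B = Q + Q' P\<close> with \<open>Q\<close>
  and \<open>Q'\<close> reduced.
\<close>

lemma hecke_sum_comm: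
  assumes "0 < degree P" "0 < degree P'"
  shows "hecke_sum P (hecke_sum P' f) z = hecke_sum P' (hecke_sum P f) z"
proof -
  have main: "hecke_sum P (hecke_sum P' f) z = (\<Sum>B\<in>residue_polys (P * P'). sl f (mat2 1 B 0 (P * P')) z)"
    if P: "0 < degree P" and P': "0 < degree P'" for P P' :: "'q poly"
  proof -
    have nz: "P \<noteq> 0" "P' \<noteq> 0" using P P' by auto
    let ?h = "\<lambda>(Q, Q'). Q + Q' * P"
    have bij: "bij_betw ?h (residue_polys P \<times> residue_polys P') (residue_polys (P * P'))"
    proof (rule bij_betwI[where g = "\<lambda>B. (B mod P, B div P)"])
      show "?h \<in> residue_polys P \<times> residue_polys P' \<rightarrow> residue_polys (P * P')"
      proof safe
        fix Q Q' assume "Q \<in> residue_polys P" "Q' \<in> residue_polys P'"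
        then have "degree Q < degree P + degree P'" "degree (Q' * P) < degree P + degree P'"
          using nz P by (auto simp: residue_polys_def intro: le_less_trans[OF degree_mult_le])
        then show "Q + Q' * P \<in> residue_polys (P * P')"
          using nz by (simp add: residue_polys_def degree_mult_eq degree_add_less)
      qed
      show "(\<lambda>B. (B mod P, B div P)) \<in> residue_polys (P * P') \<rightarrow> residue_polys P \<times> residue_polys P'"
      proof safe
        fix B assume B: "B \<in> residue_polys (P * P')"
        show "B mod P \<in> residue_polys P" using P by (rule residue_polys_mod)
        show "B div P \<in> residue_polys P'"
        proof (rule ccontr)
          assume "B div P \<notin> residue_polys P'"
          then have ge: "degree P' \<le> degree (B div P)" and "B div P \<noteq> 0"
            using P' by (auto simp: residue_polys_def)
          then have "degree (P * P') \<le> degree (B div P * P)" using nz by (simp add: degree_mult_eq)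
          moreover have "degree (B - B mod P) < degree (P * P')"
            using B nz residue_polys_mod[OF P, of B] by (intro degree_diff_less) (auto simp: residue_polys_def degree_mult_eq)
          ultimately show False by (simp add: minus_mod_eq_div_mult)
        qed
      qed
      show "(\<lambda>B. (B mod P, B div P)) (?h x) = x" if "x \<in> residue_polys P \<times> residue_polys P'" for x
        using that nz by (auto simp: residue_polys_def mod_poly_less div_poly_less)
      show "?h ((\<lambda>B. (B mod P, B div P)) B) = B" for B by simp
    qed
    have "hecke_sum P (hecke_sum P' f) z =
        (\<Sum>Q\<in>residue_polys P. \<Sum>Q'\<in>residue_polys P'. sl f (mat2 1 (Q + Q' * P) 0 (P * P')) z)"
      unfolding hecke_sum_def sl_sum
      using nz by (intro sum.cong refl) (simp add: sl_sl det_mat2 mat2_mult mult.commute)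
    also have "\<dots> = (\<Sum>x\<in>residue_polys P \<times> residue_polys P'. sl f (mat2 1 (?h x) 0 (P * P')) z)"
      by (simp add: sum.cartesian_product case_prod_unfold)
    also have "\<dots> = (\<Sum>B\<in>residue_polys (P * P'). sl f (mat2 1 B 0 (P * P')) z)"
      by (rule sum.reindex_bij_betw[OF bij])
    finally show ?thesis .
  qed
  show ?thesis using main[OF assms] main[OF assms(2,1)] by (simp add: mult.commute)
qed

text \<open>
  Interchanging the two matrices replaces \<open>Q\<close> by \<open>R Q\<close>, which permutes the residues modulo \<open>P\<close>;
  reducing \<open>R Q\<close> modulo \<open>P\<close> costs a translation, under which \<open>f\<close> is invariant.
\<close>

lemma hecke_sum_delta:
  assumes f: "weakly_modular m f" and P: "monic_prime P" "\<not> P dvd R" and R: "R \<noteq> 0"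
  shows "hecke_sum P (sl f (mat2 R 0 0 1)) z = sl (hecke_sum P f) (mat2 R 0 0 1) z"
proof -
  have P0: "P \<noteq> 0" "0 < degree P"
    using monic_prime_nonzero[OF P(1)] monic_prime_degree_pos[OF P(1)] by auto
  let ?h = "\<lambda>Q. (R * Q) mod P"
  have inj: "inj_on ?h (residue_polys P)"
  proof (rule inj_onI)
    fix x y assume xy: "x \<in> residue_polys P" "y \<in> residue_polys P" "?h x = ?h y"
    then have "P dvd R * (x - y)" by (simp add: mod_eq_dvd_iff right_diff_distrib)
    then have "P dvd x - y" using monic_prime_dvd_mult[OF P(1)] P(2) by blast
    then show "x = y" using xy residue_polys_eq by blast
  qed
  have "?h ` residue_polys P \<subseteq> residue_polys P" using residue_polys_mod[OF P0(2)] by auto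
  then have bij: "bij_betw ?h (residue_polys P) (residue_polys P)"
    unfolding bij_betw_def using inj endo_inj_surj[OF _ _ inj] by auto
  have "sl (sl f (mat2 R 0 0 1)) (mat2 1 Q 0 P) z = sl (sl f (mat2 1 (?h Q) 0 P)) (mat2 R 0 0 1) z" for Q
  proof -
    have "mat2 1 (R * Q div P) 0 1 ** mat2 R (?h Q) 0 P = mat2 R (R * Q) 0 P"
      by (simp add: mat2_mult)
    moreover have "sl f (mat2 1 (R * Q div P) 0 1 ** mat2 R (?h Q) 0 P) = sl f (mat2 R (?h Q) 0 P)"
      using P0 R by (intro weakly_modular_coset[OF f]) (auto simp: det_mat2)
    ultimately have "sl f (mat2 R (R * Q) 0 P) = sl f (mat2 R (?h Q) 0 P)" by simp
    then show ?thesis using P0 R by (simp add: sl_sl det_mat2 mat2_mult)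
  qed
  then have "hecke_sum P (sl f (mat2 R 0 0 1)) z =
      (\<Sum>Q\<in>residue_polys P. sl (sl f (mat2 1 (?h Q) 0 P)) (mat2 R 0 0 1) z)"
    by (simp add: hecke_sum_def)
  also have "\<dots> = (\<Sum>Q\<in>residue_polys P. sl (sl f (mat2 1 Q 0 P)) (mat2 R 0 0 1) z)"
    by (rule sum.reindex_bij_betw[OF bij])
  finally show ?thesis by (simp add: hecke_sum_def sl_sum)
qed

lemma monic_primes_not_dvd: "monic_prime P \<Longrightarrow> monic_prime R \<Longrightarrow> P \<noteq> R \<Longrightarrow> \<not> P dvd R"
  using monic_prime_dvd_imp_eq by blast

lemma hecke_delta:
  assumes f: "weakly_modular m' f" and P: "monic_prime P" "monic_prime R" "P \<noteq> R"
  shows "hecke m P (sl f (mat2 R 0 0 1)) = sl (hecke m P f) (mat2 R 0 0 1)"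
proof
  fix z
  have nz: "P \<noteq> 0" "R \<noteq> 0" using P monic_prime_nonzero by auto
  have "sl (sl f (mat2 R 0 0 1)) (mat2 P 0 0 1) = sl (sl f (mat2 P 0 0 1)) (mat2 R 0 0 1)"
    using nz by (simp add: sl_sl det_mat2 mat2_mult mult.commute)
  then show "hecke m P (sl f (mat2 R 0 0 1)) z = sl (hecke m P f) (mat2 R 0 0 1) z"
    using hecke_sum_delta[OF f P(1) monic_primes_not_dvd[OF P] nz(2)]
    by (simp add: hecke_def sl_cmult sl_add sl_0)
qed

lemma hecke_hecke_sum:
  assumes f: "weakly_modular m' f" and P: "monic_prime P" "monic_prime R" "P \<noteq> R"
  shows "hecke m P (hecke_sum R f) = hecke_sum R (hecke m P f)"
proof
  fix z
  have nz: "P \<noteq> 0" using P monic_prime_nonzero by auto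
  have 1: "hecke_sum P (hecke_sum R f) z = hecke_sum R (hecke_sum P f) z" for z
    using P by (intro hecke_sum_comm monic_prime_degree_pos)
  have 2: "sl (hecke_sum R f) (mat2 P 0 0 1) z = hecke_sum R (sl f (mat2 P 0 0 1)) z" for z
    using hecke_sum_delta[OF f P(2) _ nz] monic_primes_not_dvd[OF P(2,1)] P(3) by auto
  show "hecke m P (hecke_sum R f) z = hecke_sum R (hecke m P f) z"
    by (cases "P dvd m") (simp_all add: hecke_def hecke_sum_cmult hecke_sum_add 1 2)
qed

section \<open>Atkin--Lehner matrices and traces\<close>

lemma atkin_lehner_matrixE:
  assumes P: "monic_prime P" "\<not> P dvd m"
  obtains b e where "atkin_lehner_matrix (P * m) P = mat2 P b (P * m) (P * e)" "P * e - m * b = 1"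
proof -
  have P0: "P \<noteq> 0" using P(1) by (rule monic_prime_nonzero)
  obtain s t where st: "s * P + t * m = 1" using monic_prime_bezout[OF P] by blast
  have "P\<^sup>2 * s - P * m * (- t) = P * (s * P + t * m)" by (simp add: algebra_simps power2_eq_square)
  then have "P\<^sup>2 * s - P * m * (- t) = P" by (simp only: st mult_1_right)
  then have "\<exists>b d. mat2 P (- t) (P * m) (P * s) = mat2 P b (P * m) (P * d) \<and> P\<^sup>2 * d - P * m * b = P"
    by (intro exI conjI) (rule refl)
  then have "\<exists>b d. atkin_lehner_matrix (P * m) P = mat2 P b (P * m) (P * d) \<and> P\<^sup>2 * d - P * m * b = P"
    unfolding atkin_lehner_matrix_def
    by (rule someI[where P = "\<lambda>\<gamma>. \<exists>b d. \<gamma> = mat2 P b (P * m) (P * d) \<and> P\<^sup>2 * d - P * m * b = P"])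
  then obtain b e where be: "atkin_lehner_matrix (P * m) P = mat2 P b (P * m) (P * e)" "P\<^sup>2 * e - P * m * b = P"
    by blast
  have "P * (P * e - m * b) = P * 1" using be(2) by (simp add: algebra_simps power2_eq_square)
  then have "P * e - m * b = 1" using P0 by (simp only: mult_cancel_left) simp
  with be(1) that show ?thesis by blast
qed

end

text \<open>
  The level is \<open>P m\<close>. Dividing the condition \<open>P\<^sup>2 e - P m b = P\<close> on the Atkin--Lehner matrix by \<open>P\<close>
  gives \<open>P e - m b = 1\<close>, the form used throughout.
\<close>

locale atkin_lehner_setup = modular \<iota> \<pi> k l
  for \<iota> :: "'q::{field,finite} fls \<Rightarrow> 'c::nonarch_complete_field" and \<pi> k l +
  fixes P m b e :: "'q poly"
  assumes P: "monic_prime P" and Pm: "\<not> P dvd m" and rel: "P * e - m * b = 1"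
begin

definition W :: "'q poly^2^2" where "W = mat2 P b (P * m) (P * e)"

lemma P_nonzero: "P \<noteq> 0" using P by (rule monic_prime_nonzero)

lemma det_W: "det W = P"
proof -
  have "det W = P * (P * e - m * b)" by (simp add: W_def det_mat2 algebra_simps)
  then show ?thesis by (simp add: rel)
qed

text \<open>
  Identities that hold modulo the relation \<open>P e - m b = 1\<close> become polynomial identities once the
  cofactor \<open>w\<close> is known. Below, products such as \<open>W \<gamma> W'\<close> with the adjugate \<open>W'\<close> of \<open>W\<close> are divided
  by \<open>P\<close>; as \<open>W' W = P (P e - m b)\<close>, the cofactor is always the entry on the right-hand side.
\<close>

lemma eq_by_rel: "x - y = (P * e - m * b - 1) * w \<Longrightarrow> x = y" for x y w :: "'q poly"
  by (simp add: rel)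

text \<open>
  \<open>W\<close> normalises \<open>\<Gamma>\<^sub>0(P m)\<close>: the witness is \<open>W \<gamma> W'\<close> divided by \<open>P\<close>, where \<open>W'\<close> is the adjugate of \<open>W\<close>.
\<close>

lemma W_Gamma0:
  assumes "\<gamma> \<in> Gamma0 (P * m)" obtains \<gamma>' where "\<gamma>' \<in> Gamma0 (P * m)" "W ** \<gamma> = \<gamma>' ** W"
proof -
  obtain a \<beta> c \<delta> where g: "\<gamma> = mat2 a \<beta> c \<delta>" by (rule mat2_cases)
  obtain c0 where c: "c = P * m * c0" using assms by (auto simp: g)
  let ?\<gamma>' = "mat2 (e * (P * a + b * c) - m * (P * \<beta> + b * \<delta>)) (P * \<beta> + b * \<delta> - b * a - b * b * m * c0)
    (P * m * (e * a + P * e * e * c0 - m * \<beta> - e * \<delta>)) (P * m * \<beta> + P * e * \<delta> - b * m * a - b * e * c)"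
  have eq: "?\<gamma>' ** W = W ** \<gamma>"
    unfolding W_def g mat2_mult mat2_eq_mat2_iff
  proof (intro conjI)
    show "(e * (P * a + b * c) - m * (P * \<beta> + b * \<delta>)) * P + (P * \<beta> + b * \<delta> - b * a - b * b * m * c0) * (P * m) = P * a + b * c"
      by (rule eq_by_rel[of _ _ "P * a + b * c"]) (simp add: c algebra_simps)
    show "(e * (P * a + b * c) - m * (P * \<beta> + b * \<delta>)) * b + (P * \<beta> + b * \<delta> - b * a - b * b * m * c0) * (P * e) = P * \<beta> + b * \<delta>"
      by (rule eq_by_rel[of _ _ "P * \<beta> + b * \<delta>"]) (simp add: c algebra_simps)
    show "P * m * (e * a + P * e * e * c0 - m * \<beta> - e * \<delta>) * P + (P * m * \<beta> + P * e * \<delta> - b * m * a - b * e * c) * (P * m) = P * m * a + P * e * c"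
      by (rule eq_by_rel[of _ _ "P * m * a + P * e * c"]) (simp add: c algebra_simps)
    show "P * m * (e * a + P * e * e * c0 - m * \<beta> - e * \<delta>) * b + (P * m * \<beta> + P * e * \<delta> - b * m * a - b * e * c) * (P * e) = P * m * \<beta> + P * e * \<delta>"
      by (rule eq_by_rel[of _ _ "P * m * \<beta> + P * e * \<delta>"]) (simp add: c algebra_simps)
  qed
  have "det ?\<gamma>' * P = P * det \<gamma>" using arg_cong[OF eq, of det] by (simp only: det_mul det_W)
  then have "det ?\<gamma>' = det \<gamma>" using P_nonzero by simp
  then have "?\<gamma>' \<in> Gamma0 (P * m)" using assms by (simp only: Gamma0_iff mat2_nth) simp
  then show ?thesis using eq that by metis
qed

lemma weakly_modular_W:
  assumes "weakly_modular (P * m) f" shows "weakly_modular (P * m) (sl f W)"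
  unfolding weakly_modular_def
proof (intro conjI allI impI ballI)
  fix \<gamma> assume \<gamma>: "\<gamma> \<in> Gamma0 (P * m)"
  then obtain \<gamma>' where g: "\<gamma>' \<in> Gamma0 (P * m)" "W ** \<gamma> = \<gamma>' ** W" by (rule W_Gamma0)
  have "sl (sl f W) \<gamma> = sl f (\<gamma>' ** W)"
    unfolding g(2)[symmetric] using \<gamma> P_nonzero by (intro sl_sl) (auto simp: det_W dest: Gamma0_det_nonzero)
  also have "\<dots> = sl f W" using P_nonzero by (intro weakly_modular_coset[OF assms g(1)]) (simp add: det_W)
  finally show "sl (sl f W) \<gamma> = sl f W" .
qed (rule sl_outside)

text \<open>
  Conjugation by \<open>W\<close> preserves the matrices that define the Hecke operator of another prime \<open>R\<close>; the
  witness is \<open>W' x W\<close> divided by \<open>P\<close>, with the adjugate \<open>W'\<close>. If \<open>R dvd m\<close> and the upper left entry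
  of \<open>x\<close> is \<open>1\<close>, the new one is \<open>P e\<close> modulo \<open>R\<close>, hence \<open>1\<close>.
\<close>

lemma W_hecke_matrix:
  assumes x: "x \<in> hecke_matrices (P * m) R" and R: "monic_prime R" "R \<noteq> P" and unip: "R dvd P * m \<Longrightarrow> x$1$1 = 1"
  shows "\<exists>y. y \<in> hecke_matrices (P * m) R \<and> W ** y = x ** W"
proof -
  obtain a \<beta> c \<delta> where g: "x = mat2 a \<beta> c \<delta>" by (rule mat2_cases)
  obtain c0 where c: "c = P * m * c0" using x by (auto simp: g hecke_matrices_def)
  let ?y = "mat2 (P * e * a - b * c + m * (P * e * \<beta> - b * \<delta>)) (b * e * a - b * b * m * c0 + e * (P * e * \<beta> - b * \<delta>))
    (P * m * (P * c0 - a - m * \<beta> + \<delta>)) (b * c - b * m * a + e * (P * \<delta> - P * m * \<beta>))"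
  have eq: "W ** ?y = x ** W"
    unfolding W_def g mat2_mult mat2_eq_mat2_iff
  proof (intro conjI)
    show "P * (P * e * a - b * c + m * (P * e * \<beta> - b * \<delta>)) + b * (P * m * (P * c0 - a - m * \<beta> + \<delta>)) = a * P + \<beta> * (P * m)"
      by (rule eq_by_rel[of _ _ "a * P + \<beta> * (P * m)"]) (simp add: c algebra_simps)
    show "P * (b * e * a - b * b * m * c0 + e * (P * e * \<beta> - b * \<delta>)) + b * (b * c - b * m * a + e * (P * \<delta> - P * m * \<beta>)) = a * b + \<beta> * (P * e)"
      by (rule eq_by_rel[of _ _ "a * b + \<beta> * (P * e)"]) (simp add: c algebra_simps)
    show "P * m * (P * e * a - b * c + m * (P * e * \<beta> - b * \<delta>)) + P * e * (P * m * (P * c0 - a - m * \<beta> + \<delta>)) = c * P + \<delta> * (P * m)"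
      by (rule eq_by_rel[of _ _ "c * P + \<delta> * (P * m)"]) (simp add: c algebra_simps)
    show "P * m * (b * e * a - b * b * m * c0 + e * (P * e * \<beta> - b * \<delta>)) + P * e * (b * c - b * m * a + e * (P * \<delta> - P * m * \<beta>)) = c * b + \<delta> * (P * e)"
      by (rule eq_by_rel[of _ _ "c * b + \<delta> * (P * e)"]) (simp add: c algebra_simps)
  qed
  have "P * det ?y = det x * P" using arg_cong[OF eq, of det] by (simp only: det_mul det_W)
  then have det: "det ?y = det x" using P_nonzero by simp
  have "\<not> R dvd P * e * a - b * c + m * (P * e * \<beta> - b * \<delta>)" if Rn: "R dvd P * m"
  proof
    assume *: "R dvd P * e * a - b * c + m * (P * e * \<beta> - b * \<delta>)"
    have "R dvd m" using monic_prime_dvd_mult[OF R(1) Rn] monic_prime_dvd_imp_eq[OF R(1) P] R(2) by blast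
    moreover have "P * e = 1 + m * b" using rel by (simp add: algebra_simps)
    then have "P * e * a - b * c + m * (P * e * \<beta> - b * \<delta>) = 1 + m * (b - b * P * c0 + P * e * \<beta> - b * \<delta>)"
      using unip[OF Rn] by (simp add: g c algebra_simps)
    ultimately have "R dvd 1" using * by (metis dvd_add_left_iff dvd_mult2)
    then show False using monic_prime_not_dvd_unit[OF R(1), of 1] by simp
  qed
  then have "?y \<in> hecke_matrices (P * m) R"
    using x det by (auto simp only: hecke_matrices_def mem_Collect_eq mat2_nth intro: dvd_mult2)
      (auto intro: dvd_mult2)
  then show ?thesis using eq by blast
qed

lemma hecke_W:
  assumes f: "weakly_modular (P * m) f" and R: "monic_prime R" "R \<noteq> P"
  shows "sl (hecke (P * m) R f) W = hecke (P * m) R (sl f W)"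
proof
  fix z
  let ?n = "P * m" and ?R = "hecke_reps (P * m) R"
  have dW: "det W \<noteq> 0" using P_nonzero by (simp add: det_W)
  have "\<exists>y. y \<in> hecke_matrices ?n R \<and> W ** y = \<alpha> ** W" if "\<alpha> \<in> ?R" for \<alpha>
  proof (rule W_hecke_matrix[OF _ R])
    show "\<alpha> \<in> hecke_matrices ?n R" using that hecke_reps_subset[OF R(1)] by blast
    show "\<alpha>$1$1 = 1" if "R dvd ?n" using that \<open>\<alpha> \<in> ?R\<close> by (auto simp: hecke_reps_def)
  qed
  then obtain \<phi> where \<phi>: "\<And>\<alpha>. \<alpha> \<in> ?R \<Longrightarrow> \<phi> \<alpha> \<in> hecke_matrices ?n R \<and> W ** \<phi> \<alpha> = \<alpha> ** W"
    by metis
  have "sl (hecke ?n R f) W z = hecke_factor R * (\<Sum>\<alpha>\<in>?R. sl f (\<alpha> ** W) z)"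
    by (rule sl_hecke[OF R(1) dW])
  also have "(\<Sum>\<alpha>\<in>?R. sl f (\<alpha> ** W) z) = (\<Sum>\<alpha>\<in>?R. sl (sl f W) (\<phi> \<alpha>) z)"
  proof (rule sum.cong[OF refl])
    fix \<alpha> assume "\<alpha> \<in> ?R"
    then have "W ** \<phi> \<alpha> = \<alpha> ** W" "det (\<phi> \<alpha>) \<noteq> 0"
      using \<phi> hecke_matrices_det_nonzero[OF R(1)] by blast+
    then show "sl f (\<alpha> ** W) z = sl (sl f W) (\<phi> \<alpha>) z" using sl_sl[of W "\<phi> \<alpha>" f] dW by simp
  qed
  also have "\<dots> = (\<Sum>\<alpha>\<in>?R. sl (sl f W) \<alpha> z)"
  proof (rule hecke_sum_permute[OF weakly_modular_W[OF f] R(1)])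
    show "\<phi> \<alpha> \<in> hecke_matrices ?n R" if "\<alpha> \<in> ?R" for \<alpha> using \<phi> that by blast
    fix \<alpha> \<beta> \<gamma> assume h: "\<alpha> \<in> ?R" "\<beta> \<in> ?R" "\<gamma> \<in> Gamma0 ?n" "\<phi> \<alpha> = \<gamma> ** \<phi> \<beta>"
    obtain \<gamma>' where g: "\<gamma>' \<in> Gamma0 ?n" "W ** \<gamma> = \<gamma>' ** W" using h(3) by (rule W_Gamma0)
    have "\<alpha> ** W = W ** (\<gamma> ** \<phi> \<beta>)" using \<phi>[OF h(1)] h(4) by simp
    also have "\<dots> = (\<gamma>' ** W) ** \<phi> \<beta>" unfolding g(2)[symmetric] by (rule matrix_mul_assoc)
    also have "\<dots> = \<gamma>' ** (W ** \<phi> \<beta>)" by (rule matrix_mul_assoc[symmetric])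
    also have "\<dots> = (\<gamma>' ** \<beta>) ** W" using \<phi>[OF h(2)] by (simp add: matrix_mul_assoc)
    finally have "\<alpha> = \<gamma>' ** \<beta>" using dW by (rule matrix_mult_right_cancel)
    then show "\<exists>\<delta>\<in>Gamma0 ?n. \<alpha> = \<delta> ** \<beta>" using g(1) by blast
  qed
  finally show "sl (hecke ?n R f) W z = hecke ?n R (sl f W) z"
    by (simp add: hecke_eq_sum_reps[OF R(1)])
qed

abbreviation trace_factor :: 'c where "trace_factor \<equiv> emb P ^ k / emb P ^ (2 * l)"

lemma trace_factor_nonzero: "trace_factor \<noteq> 0"
  using P_nonzero by simp

text \<open>
  \<open>W\<^sup>2\<close> is \<open>P\<close> times an element of \<open>\<Gamma>\<^sub>0(P m)\<close>.
\<close>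

lemma W_squared:
  assumes f: "weakly_modular (P * m) f"
  shows "trace_factor * sl (sl f W) W z = f z"
proof -
  let ?g = "mat2 (P + b * m) (b + b * e) (P * m * (1 + e)) (m * b + P * e * e)"
  have WW: "W ** W = mat2 (P * (P + b * m)) (P * (b + b * e)) (P * (P * m * (1 + e))) (P * (m * b + P * e * e))"
    by (simp add: W_def mat2_mult algebra_simps)
  have "(P + b * m) * (m * b + P * e * e) - (b + b * e) * (P * m * (1 + e)) = 1"
    by (rule eq_by_rel[of _ _ "P * e - m * b + 1"]) (simp add: algebra_simps)
  then have "?g \<in> Gamma0 (P * m)" by simp
  then have g: "sl f ?g = f" using f by (auto simp: weakly_modular_def)
  have "sl (sl f W) W z = sl f (W ** W) z" using sl_sl[of W W f] P_nonzero by (simp add: det_W)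
  also have "\<dots> = emb P ^ (2 * l) / emb P ^ k * f z"
    unfolding WW sl_scalar[OF P_nonzero] g ..
  finally show ?thesis using P_nonzero by simp
qed

text \<open>
  \<open>W\<close> times the matrix with rows \<open>(1, Q), (0, P)\<close>, divided by \<open>P\<close>.
\<close>

definition coset_rep :: "'q poly \<Rightarrow> 'q poly^2^2" where
  "coset_rep Q = mat2 1 (Q + b) m (m * Q + P * e)"

lemma coset_rep_Gamma0: "coset_rep Q \<in> Gamma0 m"
proof -
  have "m * Q + P * e - (Q + b) * m = 1" using rel by (simp add: algebra_simps)
  then show ?thesis by (simp add: coset_rep_def)
qed

text \<open>
  The identity and \<open>coset_rep Q\<close>, with \<open>Q\<close> modulo \<open>P\<close>, represent \<open>\<Gamma>\<^sub>0(P m)\<close> in \<open>\<Gamma>\<^sub>0(m)\<close>: a matrix with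
  lower left entry \<open>m c\<close> belongs to the identity if \<open>P dvd c\<close>, and otherwise to the \<open>Q\<close> that solves a
  linear congruence modulo \<open>P\<close>, which is possible because \<open>c m\<close> is invertible modulo \<open>P\<close>.
\<close>

lemma trace_form_eq:
  assumes f: "weakly_modular (P * m) f"
  shows "trace_form \<iota> k l (P * m) P f = (\<lambda>z. f z + trace_factor * hecke_sum P (sl f W) z)"
proof
  fix z
  let ?n = "P * m"
  have degP: "0 < degree P" using P by (rule monic_prime_degree_pos)
  define C where "C \<gamma> = (\<lambda>\<delta>. \<delta> ** \<gamma>) ` Gamma0 ?n" for \<gamma> :: "'q poly^2^2"
  define T where "T = insert (mat 1) (coset_rep ` residue_polys P)"
  have sub: "Gamma0 ?n \<subseteq> Gamma0 m" by (auto simp: Gamma0_iff dest: dvd_mult_right)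
  have T_sub: "T \<subseteq> Gamma0 m" by (auto simp: T_def Gamma0_1 coset_rep_Gamma0)
  have unit21: "\<not> ?n dvd m"
  proof
    assume "P * m dvd m"
    then have "P dvd m" by (rule dvd_mult_left)
    then show False using Pm by blast
  qed
  \<comment> \<open>The inverse of \<open>coset_rep Q\<close>.\<close>
  define J where "J Q = mat2 (m * Q + P * e) (- (Q + b)) (- m) 1" for Q
  have prod21: "coset_rep Q ** J Q' =
      mat2 (1 * (m * Q' + P * e) - (Q + b) * m) (Q - Q') (m * (m * (Q' - Q))) (m * Q + P * e - m * (Q' + b))" for Q Q'
    by (simp add: J_def coset_rep_def mat2_mult algebra_simps)
  have inverse_rep: "coset_rep Q ** J Q = mat 1" for Q
    unfolding prod21 using rel by (simp add: mat_1_mat2 algebra_simps)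
  have inverse_rep': "J Q ** coset_rep Q = mat 1" for Q
    using rel by (simp add: J_def coset_rep_def mat2_mult mat_1_mat2 algebra_simps)
  have not1: "mat 1 \<noteq> \<gamma> ** coset_rep Q" if \<gamma>: "\<gamma> \<in> Gamma0 ?n" for \<gamma> Q
  proof
    assume "mat 1 = \<gamma> ** coset_rep Q"
    then have "J Q = \<gamma> ** (coset_rep Q ** J Q)"
      by (metis matrix_mul_assoc matrix_mul_lid)
    then have "\<gamma> = J Q" by (simp add: inverse_rep)
    then show False using \<gamma> unit21 by (simp add: J_def)
  qed
  have uniq: "\<alpha> = \<beta>" if ab: "\<alpha> \<in> T" "\<beta> \<in> T" "\<gamma> \<in> Gamma0 ?n" "\<alpha> = \<gamma> ** \<beta>" for \<alpha> \<beta> \<gamma>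
  proof -
    obtain \<gamma>' where g': "\<gamma>' \<in> Gamma0 ?n" "\<gamma>' ** \<gamma> = mat 1" using Gamma0_inverse[OF ab(3)] by blast
    have ba: "\<beta> = \<gamma>' ** \<alpha>" unfolding ab(4) by (simp add: matrix_mul_assoc g'(2))
    consider "\<alpha> = mat 1" "\<beta> = mat 1" | Q where "\<alpha> = mat 1" "\<beta> = coset_rep Q"
      | Q where "\<alpha> = coset_rep Q" "\<beta> = mat 1"
      | Q Q' where "\<alpha> = coset_rep Q" "\<beta> = coset_rep Q'" "Q \<in> residue_polys P" "Q' \<in> residue_polys P"
      using ab(1,2) by (auto simp: T_def)
    then show ?thesis
    proof cases
      case 2
      then show ?thesis using not1[OF ab(3), of Q] ab(4) by auto
    next
      case 3
      then show ?thesis using not1[OF g'(1), of Q] ba by auto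
    next
      case 4
      have "coset_rep Q ** J Q' = \<gamma>"
        using ab(4) 4 by (simp add: matrix_mul_assoc[symmetric] inverse_rep)
      then have "?n dvd m * (m * (Q' - Q))" using ab(3) unfolding prod21 by auto
      then have "P * m dvd (m * (Q' - Q)) * m" by (simp add: mult.commute)
      moreover have "m \<noteq> 0" using Pm by auto
      ultimately have "P dvd m * (Q' - Q)" by simp
      then have "P dvd Q' - Q" using monic_prime_dvd_mult[OF P] Pm by blast
      then show ?thesis using 4 residue_polys_eq[of Q' P Q] by simp
    qed simp
  qed
  have C_mem: "\<gamma> \<in> C \<gamma>" for \<gamma> using Gamma0_1[of ?n] by (auto simp: C_def intro: image_eqI[of _ _ "mat 1"])
  have C_eq: "C (\<delta> ** \<gamma>) = C \<gamma>" if \<delta>: "\<delta> \<in> Gamma0 ?n" for \<delta> \<gamma>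
  proof -
    obtain \<delta>' where d': "\<delta>' \<in> Gamma0 ?n" "\<delta>' ** \<delta> = mat 1" using Gamma0_inverse[OF \<delta>] by blast
    have sub: "C (\<delta> ** \<gamma>) \<subseteq> C \<gamma>" if "\<delta> \<in> Gamma0 ?n" for \<delta> \<gamma>
      using Gamma0_mult that by (auto simp: C_def matrix_mul_assoc)
    have "C \<gamma> = C (\<delta>' ** (\<delta> ** \<gamma>))" by (simp add: matrix_mul_assoc d'(2))
    with sub[OF \<delta>, of \<gamma>] sub[OF d'(1), of "\<delta> ** \<gamma>"] show ?thesis by simp
  qed
  have cover: "C x \<in> C ` T" if x: "x \<in> Gamma0 m" for x
  proof -
    obtain a \<beta> c \<delta> where g: "x = mat2 a \<beta> c \<delta>" by (rule mat2_cases)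
    obtain c0 where c: "c = m * c0" using x by (auto simp: g)
    show ?thesis
    proof (cases "P dvd c0")
      case True
      then have "P * m dvd c" unfolding c by (simp add: mult.commute)
      then have "x \<in> Gamma0 ?n" using x by (simp add: g)
      then have "C (x ** mat 1) = C (mat 1)" by (rule C_eq)
      then show ?thesis by (simp add: T_def)
    next
      case False
      then have "\<not> P dvd c0 * m" using monic_prime_dvd_mult[OF P] Pm by blast
      then obtain s t where st: "s * P + t * (c0 * m) = 1" using monic_prime_bezout[OF P] by blast
      define Q where "Q = (t * \<delta>) mod P"
      define w where "w = (t * \<delta>) div P"
      have Qw: "Q = t * \<delta> - w * P" by (simp add: Q_def w_def minus_div_mult_eq_mod)
      have "c0 * (m * Q + P * e) - \<delta> = P * (c0 * e - s * \<delta> - c0 * m * w) + (s * P + t * (c0 * m) - 1) * \<delta>"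
        unfolding Qw by (simp add: algebra_simps)
      then have "c0 * (m * Q + P * e) - \<delta> = P * (c0 * e - s * \<delta> - c0 * m * w)" using st by simp
      then have "m * (c0 * (m * Q + P * e) - \<delta>) = P * m * (c0 * e - s * \<delta> - c0 * m * w)" by (simp add: mult_ac)
      moreover have "c * (m * Q + P * e) - \<delta> * m = m * (c0 * (m * Q + P * e) - \<delta>)"
        by (simp add: c algebra_simps)
      ultimately have dvd: "P * m dvd c * (m * Q + P * e) - \<delta> * m" by (metis dvd_triv_left)
      let ?i = "J Q"
      have "det ?i = 1" using rel by (simp add: J_def det_mat2 algebra_simps)
      then have "x ** ?i \<in> Gamma0 ?n" using x dvd
        by (simp add: Gamma0_iff det_mul) (simp add: g J_def mat2_mult)
      then have "C ((x ** ?i) ** coset_rep Q) = C (coset_rep Q)" by (rule C_eq)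
      then have "C x = C (coset_rep Q)" by (simp add: matrix_mul_assoc[symmetric] inverse_rep')
      moreover have "Q \<in> residue_polys P" unfolding Q_def by (rule residue_polys_mod[OF degP])
      ultimately show ?thesis by (auto simp: T_def)
    qed
  qed
  have "Gamma0_cosets ?n (?n div P) = C ` Gamma0 m"
    using P_nonzero by (simp add: Gamma0_cosets_def C_def[abs_def])
  also have "\<dots> = C ` T" using cover T_sub by blast
  finally have cosets: "Gamma0_cosets ?n (?n div P) = C ` T" .
  have injC: "inj_on C T"
  proof (rule inj_onI)
    fix \<alpha> \<beta> assume ab: "\<alpha> \<in> T" "\<beta> \<in> T" "C \<alpha> = C \<beta>"
    then have "\<alpha> \<in> C \<beta>" using C_mem by blast
    then show "\<alpha> = \<beta>" using uniq[OF ab(1,2)] by (auto simp: C_def)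
  qed
  have some: "sl f (SOME \<gamma>. \<gamma> \<in> C \<tau>) = sl f \<tau>" if "\<tau> \<in> T" for \<tau>
  proof -
    have "(SOME \<gamma>. \<gamma> \<in> C \<tau>) \<in> C \<tau>" using C_mem by (rule someI)
    then obtain \<delta> where "\<delta> \<in> Gamma0 ?n" "(SOME \<gamma>. \<gamma> \<in> C \<tau>) = \<delta> ** \<tau>" by (auto simp: C_def)
    then show ?thesis
      using weakly_modular_coset[OF f, of \<delta> \<tau>] Gamma0_det_nonzero[of \<tau> m] that T_sub by auto
  qed
  have rep: "sl f (coset_rep Q) z = trace_factor * sl (sl f W) (mat2 1 Q 0 P) z" for Q
  proof -
    have "W ** mat2 1 Q 0 P = mat2 (P * 1) (P * (Q + b)) (P * m) (P * (m * Q + P * e))"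
      by (simp add: W_def mat2_mult algebra_simps)
    moreover have "sl (sl f W) (mat2 1 Q 0 P) = sl f (W ** mat2 1 Q 0 P)"
      using P_nonzero by (intro sl_sl) (simp_all add: det_W det_mat2)
    ultimately have "sl (sl f W) (mat2 1 Q 0 P) z = emb P ^ (2 * l) / emb P ^ k * sl f (coset_rep Q) z"
      by (simp only: sl_scalar[OF P_nonzero] coset_rep_def)
    then show ?thesis using P_nonzero by simp
  qed
  have notin: "mat 1 \<notin> coset_rep ` residue_polys P"
    using not1[OF Gamma0_1] by auto
  have "trace_form \<iota> k l ?n P f z = (\<Sum>\<tau>\<in>T. sl f \<tau> z)"
    unfolding trace_form_def cosets using some by (simp add: sum.reindex[OF injC])
  also have "\<dots> = sl f (mat 1) z + (\<Sum>\<tau>\<in>coset_rep ` residue_polys P. sl f \<tau> z)"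
    unfolding T_def using notin by simp
  also have "sl f (mat 1) = f" using f by (intro sl_mat_1) (simp add: weakly_modular_def)
  also have "(\<Sum>\<tau>\<in>coset_rep ` residue_polys P. sl f \<tau> z) = (\<Sum>Q\<in>residue_polys P. sl f (coset_rep Q) z)"
    by (subst sum.reindex) (auto simp: inj_on_def coset_rep_def)
  also have "\<dots> = trace_factor * hecke_sum P (sl f W) z"
    by (simp add: rep hecke_sum_def sum_distrib_left)
  finally show "trace_form \<iota> k l ?n P f z = f z + trace_factor * hecke_sum P (sl f W) z" .
qed

end

context modular
begin

section \<open>Old forms and new forms\<close>

text \<open>
  All terms coincide: the product of the two matrices is \<open>P\<close> times a translation. Their number is a
  power of \<open>q\<close> with positive exponent, which is \<open>0\<close> in \<open>C\<close>.
\<close>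

lemma hecke_sum_delta_self:
  assumes g: "weakly_modular m g" and P: "monic_prime P"
  shows "hecke_sum P (sl g (mat2 P 0 0 1)) z = 0"
proof -
  have P0: "P \<noteq> 0" using P by (rule monic_prime_nonzero)
  have "sl (sl g (mat2 P 0 0 1)) (mat2 1 Q 0 P) z = emb P ^ (2 * l) / emb P ^ k * g z" for Q
  proof -
    have "sl (sl g (mat2 P 0 0 1)) (mat2 1 Q 0 P) z = sl g (mat2 (P * 1) (P * Q) (P * 0) (P * 1)) z"
      using P0 by (simp add: sl_sl det_mat2 mat2_mult)
    also have "\<dots> = emb P ^ (2 * l) / emb P ^ k * sl g (mat2 1 Q 0 1) z" by (rule sl_scalar[OF P0])
    also have "sl g (mat2 1 Q 0 1) = g" using g by (auto simp: weakly_modular_def)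
    finally show ?thesis .
  qed
  moreover have "of_nat (card (residue_polys P)) = (0 :: 'c)"
    using of_nat_card_eq_0 monic_prime_degree_pos[OF P] by (simp add: card_residue_polys)
  ultimately show ?thesis by (simp add: hecke_sum_def)
qed

text \<open>
  For \<open>P \<noteq> R\<close> the operator acts on both components at level \<open>n / R\<close>. For \<open>P = R\<close> it kills the second
  component, and on the first one it is the operator of level \<open>n / R\<close> without its last term, which is
  again of the form \<open>G|\<delta>\<close>.
\<close>

lemma hecke_old_forms_at:
  assumes n: "n \<noteq> 0" "squarefree n" and P: "monic_prime P" and R: "monic_prime R" "R dvd n"
    and h: "h \<in> old_forms_at \<iota> \<pi> k l n R"
  shows "hecke n P h \<in> old_forms_at \<iota> \<pi> k l n R"
proof -
  obtain m where nm: "n = R * m" using R(2) by blast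
  have R0: "R \<noteq> 0" using R(1) by (rule monic_prime_nonzero)
  have m: "m \<noteq> 0" "n div R = m" using n R0 by (auto simp: nm)
  have Rm: "\<not> R dvd m" using squarefree_cofactor_not_dvd[of R m] n(2) R(1) by (simp add: nm)
  let ?\<delta> = "mat2 R 0 0 1" and ?S = "cusp_forms \<iota> \<pi> k l m"
  obtain f g where fg: "h = (\<lambda>z. f z + sl g ?\<delta> z)" "f \<in> ?S" "g \<in> ?S"
    using h by (auto simp: old_forms_at_def m)
  have wm: "weakly_modular m f" "weakly_modular m g" using fg m by (auto simp: cusp_forms_iff)
  have intro: "(\<lambda>z. F z + sl G ?\<delta> z) \<in> old_forms_at \<iota> \<pi> k l n R" if "F \<in> ?S" "G \<in> ?S" for F G
    using that by (auto simp: old_forms_at_def m)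
  show ?thesis
  proof (cases "P = R")
    case False
    have "P dvd n \<longleftrightarrow> P dvd m"
      using monic_prime_dvd_mult[OF P, of R m] monic_primes_not_dvd[OF P R(1) False] by (auto simp: nm)
    then have eq: "hecke n P = hecke m P" by (intro ext) (simp add: hecke_def)
    have "hecke n P h = (\<lambda>z. hecke m P f z + sl (hecke m P g) ?\<delta> z)"
      unfolding fg(1) eq by (intro ext) (simp only: hecke_add hecke_delta[OF wm(2) P R(1) False])
    then show ?thesis using intro hecke_cusp_forms[OF m(1) P] fg by simp
  next
    case True
    have "hecke n R h z = hecke m R f z + sl (\<lambda>z. - hecke_factor R * f z) ?\<delta> z" for z
      using R(2) Rm hecke_sum_delta_self[OF wm(2) R(1)]
      by (simp only: fg(1) hecke_def hecke_sum_add sl_cmult) (simp add: algebra_simps)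
    then have "hecke n P h = (\<lambda>z. hecke m R f z + sl (\<lambda>z. - hecke_factor R * f z) ?\<delta> z)"
      using True by auto
    moreover have "(\<lambda>z. - hecke_factor R * f z) \<in> ?S" by (rule cusp_forms_cmult[OF m(1) fg(2)])
    ultimately show ?thesis using intro[OF hecke_cusp_forms[OF m(1) R(1) fg(2)]] by (simp only:)
  qed
qed

lemma hecke_old_forms:
  assumes n: "n \<noteq> 0" "squarefree n" and P: "monic_prime P" and f: "f \<in> old_forms \<iota> \<pi> k l n"
  shows "hecke n P f \<in> old_forms \<iota> \<pi> k l n"
proof -
  obtain h where h: "f = (\<lambda>z. \<Sum>R\<in>monic_prime_divisors n. h R z)"
    "\<And>R. R \<in> monic_prime_divisors n \<Longrightarrow> h R \<in> old_forms_at \<iota> \<pi> k l n R"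
    using f by (auto simp: old_forms_def)
  have "hecke n P f = (\<lambda>z. \<Sum>R\<in>monic_prime_divisors n. hecke n P (h R) z)"
    unfolding h(1) by (intro ext hecke_finite_sum)
  moreover have "hecke n P (h R) \<in> old_forms_at \<iota> \<pi> k l n R" if "R \<in> monic_prime_divisors n" for R
    using that hecke_old_forms_at[OF n P _ _ h(2)] by (auto simp: monic_prime_divisors_def)
  ultimately show ?thesis
    unfolding old_forms_def by (intro CollectI exI[of _ "\<lambda>R. hecke n P (h R)"]) auto
qed

text \<open>
  For the condition at a prime \<open>R \<noteq> P\<close>, the operator commutes with the trace and with \<open>W\<close>. At \<open>R = P\<close>
  both conditions follow from \<open>\<Sigma>\<^sub>P f = - f|W\<close>, which is the vanishing of the twisted trace of \<open>f\<close>.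
\<close>

lemma hecke_new_forms:
  assumes n: "n \<noteq> 0" "squarefree n" and P: "monic_prime P" and f: "f \<in> new_forms \<iota> \<pi> k l n"
  shows "hecke n P f \<in> new_forms \<iota> \<pi> k l n"
proof -
  have fS: "f \<in> cusp_forms \<iota> \<pi> k l n" using f by (simp add: new_forms_def)
  have wm: "weakly_modular n f" using fS n by (simp add: cusp_forms_iff)
  have "trace_form \<iota> k l n R (hecke n P f) = (\<lambda>_. 0) \<and> twisted_trace_form \<iota> k l n R (hecke n P f) = (\<lambda>_. 0)"
    if R: "R \<in> monic_prime_divisors n" for R
  proof -
    have R1: "monic_prime R" "R dvd n" using R by (auto simp: monic_prime_divisors_def)
    obtain m where nm: "n = R * m" using R1(2) by blast
    have Rm: "\<not> R dvd m" using squarefree_cofactor_not_dvd[of R m] n(2) R1(1) by (simp add: nm)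
    obtain b e where be: "atkin_lehner_matrix n R = mat2 R b n (R * e)" "R * e - m * b = 1"
      using atkin_lehner_matrixE[OF R1(1) Rm] unfolding nm by blast
    interpret A: atkin_lehner_setup \<iota> \<pi> k l R m b e
      by unfold_locales (use R1 Rm be in auto)
    let ?W = "A.W" and ?c = "A.trace_factor"
    have W: "atkin_lehner_matrix n R = ?W" by (simp only: be(1) A.W_def) (simp add: nm)
    have tr: "trace_form \<iota> k l n R g = (\<lambda>z. g z + ?c * hecke_sum R (sl g ?W) z)" if "weakly_modular n g" for g
      using A.trace_form_eq[of g] that by (simp add: nm)
    have tw: "twisted_trace_form \<iota> k l n R g = trace_form \<iota> k l n R (sl g ?W)" for g
      by (simp add: twisted_trace_form_def atkin_lehner_def W)
    have wmW: "weakly_modular n (sl g ?W)" if "weakly_modular n g" for g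
      using A.weakly_modular_W that by (simp add: nm)
    have f0: "trace_form \<iota> k l n R f = (\<lambda>_. 0)" "trace_form \<iota> k l n R (sl f ?W) = (\<lambda>_. 0)"
      using f R by (auto simp: new_forms_def tw)
    show ?thesis
    proof (cases "P = R")
      case False
      have comm: "trace_form \<iota> k l n R (hecke n P g) = hecke n P (trace_form \<iota> k l n R g)"
        if g: "weakly_modular n g" for g
      proof
        fix z
        have "sl (hecke n P g) ?W = hecke n P (sl g ?W)"
          using A.hecke_W[OF _ P] g False by (simp add: nm)
        moreover have "hecke_sum R (hecke n P (sl g ?W)) = hecke n P (hecke_sum R (sl g ?W))"
          using hecke_hecke_sum[OF wmW[OF g] P R1(1) False] by simp
        ultimately show "trace_form \<iota> k l n R (hecke n P g) z = hecke n P (trace_form \<iota> k l n R g) z"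
          by (simp only: tr[OF g] tr[OF weakly_modular_hecke[OF g P]] hecke_add hecke_cmult)
      qed
      have "sl (hecke n P f) ?W = hecke n P (sl f ?W)"
        using A.hecke_W[OF _ P] wm False by (simp add: nm)
      then show ?thesis
        by (simp add: tw comm[OF wm] comm[OF wmW[OF wm]] f0 hecke_0[abs_def])
    next
      case True
      define F where "F = sl f ?W"
      have wF: "weakly_modular n F" unfolding F_def by (rule wmW[OF wm])
      have WW: "?c * sl F ?W z = f z" for z
        unfolding F_def by (rule A.W_squared) (use wm in \<open>simp add: nm\<close>)
      then have WW': "(\<lambda>z. ?c * sl F ?W z) = f" by blast
      have "hecke_sum R f z = - F z" for z
      proof -
        have "0 = F z + ?c * hecke_sum R (sl F ?W) z"
          using f0(2) fun_cong[OF tr[OF wF], of z] by (simp add: F_def)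
        also have "?c * hecke_sum R (sl F ?W) z = hecke_sum R (\<lambda>z. ?c * sl F ?W z) z"
          by (rule hecke_sum_cmult[symmetric])
        finally have "0 = F z + hecke_sum R f z" by (simp only: WW')
        then show ?thesis by (simp add: eq_neg_iff_add_eq_0 add.commute)
      qed
      then have H: "hecke n P f = (\<lambda>z. - hecke_factor R * F z)"
        using True R1(2) by (simp add: hecke_def)
      have lin: "trace_form \<iota> k l n R (\<lambda>z. c * g z) = (\<lambda>z. c * trace_form \<iota> k l n R g z)" for c g
        by (simp add: trace_form_def sl_cmult sum_distrib_left)
      have FW: "sl F ?W = (\<lambda>z. inverse ?c * f z)"
        using WW A.trace_factor_nonzero by (auto simp: field_simps)
      have "sl (hecke n P f) ?W = (\<lambda>z. - hecke_factor R * (inverse ?c * f z))"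
        unfolding H using FW by (simp only: sl_cmult[abs_def])
      moreover have "trace_form \<iota> k l n R F = (\<lambda>_. 0)" using f0(2) by (simp add: F_def)
      ultimately show ?thesis using f0(1) by (simp only: tw H lin mult_zero_right)
    qed
  qed
  then show ?thesis using hecke_cusp_forms[OF n(1) P fS] by (simp add: new_forms_def)
qed

end

theorem theorem5p5:
  fixes \<iota> :: "'q::{field,finite} fls \<Rightarrow> 'c::nonarch_complete_field"
    and \<pi> :: 'c
    and n :: "'q poly"
    and k l :: nat
  assumes "odd CARD('q)"
    and "completed_alg_closure \<iota>"
    and "carlitz_period \<iota> \<pi>"
    and "lead_coeff n = 1" and "squarefree n"
    and "k \<ge> 1" and "l \<le> CARD('q) - 2" and "[k = 2 * l] (mod (CARD('q) - 1))"
  shows "(\<forall>P. monic_prime P \<and> \<not> P dvd n \<longrightarrow>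
           hecke_T \<iota> k l P ` old_forms \<iota> \<pi> k l n \<subseteq> old_forms \<iota> \<pi> k l n \<and>
           hecke_T \<iota> k l P ` new_forms \<iota> \<pi> k l n \<subseteq> new_forms \<iota> \<pi> k l n) \<and>
         (\<forall>P. monic_prime P \<and> P dvd n \<longrightarrow>
           hecke_U \<iota> k l P ` old_forms \<iota> \<pi> k l n \<subseteq> old_forms \<iota> \<pi> k l n \<and>
           hecke_U \<iota> k l P ` new_forms \<iota> \<pi> k l n \<subseteq> new_forms \<iota> \<pi> k l n)"
proof -
  interpret modular \<iota> \<pi> k l
    by unfold_locales (use assms in auto)
  have n: "n \<noteq> 0" "squarefree n" using assms by auto
  show ?thesis
    using hecke_old_forms[OF n] hecke_new_forms[OF n] by (auto simp: hecke_T_eq[of _ n] hecke_U_eq[of _ n])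
qed

end
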